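(* Let $d\ge 1$ be an integer, let $n_0$ be a real number with $n_0>\frac{d+2}{2}$ and $n_0\ge 2$, and let $0<\epsilon_0<1$. Then there is a constant $C$, depending only on $n_0$, $\epsilon_0$ and $d$, such that the following holds. Let $\Phi\in C^{n_0}(\mathbb B_1)$ be real-valued and $\psi\in C_c^{[d/2]+1}(\mathbb B_{1-\epsilon_0})$. Suppose that the map $\mathbb B_1\ni x\mapsto \nabla\Phi(x)$ is injective and $L^\ast(\Phi)>0$. Then for every $\lambda\ge 1$, $$\lambda^{\frac d2}\,|I(\lambda,\Phi,\psi)|\le \frac{C}{L^\ast(\Phi)}\,\bigl(1+\mathcal P_{n_0}^{\frac d2}\bigr)\,\mathcal A_{[d/2]+1}.$$
   Context: Notation: $\mathbb B_r=\{x\in\mathbb R^d:|x|<r\}$; $[r]$ denotes the integer part of $r$. The oscillatory integral is $I(\lambda,\Phi,\psi)=\int_{\mathbb R^d} e^{i\lambda\Phi(x)}\psi(x)\,dx$ (the integrand being $0$ off $\operatorname{supp}\psi$). For a nonnegative integer $k$ and $0<\beta<1$, $C^{k+\beta}=C^{k,\beta}$ is the Hölder space (and for integer order $C^k$ is the usual space with its usual sup-type norm of derivatives up to order $k$). For non-integer $r>0$, $\|\phi\|_{C^r(\mathbb B_1)}=\|\phi\|_{C^{[r]}(\mathbb B_1)}+\sum_{|\alpha|=[r]}|\mathcal D^\alpha\phi|_{C^{0,r-[r]}(\mathbb B_1)}$, where $|f|_{C^{0,\beta}}=\sup_{x,y\in\mathbb B_1,\,x\ne y}|f(x)-f(y)|/|x-y|^\beta$.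 For $r\ge 2$, $\mathcal P_r=\sum_{|\beta|=2}\|\mathcal D^\beta\Phi\|_{C^{r-2}(\mathbb B_1)}$. Also $\mathcal A_r=\|\psi\|_{C^r(\mathbb B_1)}$, and $L^\ast(\Phi)=\inf_{x\in\mathbb B_1}|\det \mathrm H\Phi(x)|$, where $\mathrm H\Phi$ is the Hessian matrix of $\Phi$. $C_c^k(\mathbb B_{1-\epsilon_0})$ is the space of $C^k$ functions compactly supported in $\mathbb B_{1-\epsilon_0}$. *)

theory Defs
  imports "HOL-Analysis.Analysis"
begin

section \<open>Partial derivatives and the spaces \<open>C\<^sup>k\<close>\<close>

definition has_partial :: "'n \<Rightarrow> (real ^ 'n \<Rightarrow> 'b::real_normed_vector) \<Rightarrow> real ^ 'n::finite \<Rightarrow> bool" where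
  "has_partial i f x \<longleftrightarrow> (\<lambda>t::real. f (x + t *\<^sub>R axis i 1)) differentiable (at 0)"

definition partial :: "'n \<Rightarrow> (real ^ 'n \<Rightarrow> 'b::real_normed_vector) \<Rightarrow> real ^ 'n::finite \<Rightarrow> 'b" where
  "partial i f x = vector_derivative (\<lambda>t::real. f (x + t *\<^sub>R axis i 1)) (at 0)"

text \<open>\<open>Ck_on k S f\<close> is meant for open \<open>S\<close>: every iterated partial derivative of order at most
  \<open>k\<close>, in any order of differentiation, exists and is continuous on \<open>S\<close> (boundedness is not
  included).\<close>

primrec Ck_on :: "nat \<Rightarrow> (real ^ 'n::finite) set \<Rightarrow> (real ^ 'n \<Rightarrow> 'b::real_normed_vector) \<Rightarrow> bool" where
  "Ck_on 0 S f \<longleftrightarrow> continuous_on S f"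
| "Ck_on (Suc k) S f \<longleftrightarrow>
     continuous_on S f \<and> (\<forall>i. (\<forall>x\<in>S. has_partial i f x) \<and> Ck_on k S (partial i f))"

text \<open>Compact support is taken in the whole space, so the functions vanish outside \<open>U\<close>.\<close>

definition Cck :: "nat \<Rightarrow> (real ^ 'n::finite) set \<Rightarrow> (real ^ 'n \<Rightarrow> 'b::real_normed_vector) \<Rightarrow> bool" where
  "Cck k U f \<longleftrightarrow> Ck_on k U f \<and> compact (closure {x. f x \<noteq> 0}) \<and> closure {x. f x \<noteq> 0} \<subseteq> U"

section \<open>Multi-indices\<close>

definition mi_order :: "('n::finite \<Rightarrow> nat) \<Rightarrow> nat" where
  "mi_order \<alpha> = (\<Sum>i\<in>UNIV. \<alpha> i)"

text \<open>The partial derivatives in \<open>D\<^sup>\<alpha>\<close> are taken in some unspecified order in which each index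
  \<open>i\<close> occurs \<open>\<alpha> i\<close> times; on an open set where \<open>f\<close> is of class \<open>C\<^sup>k\<close>, \<open>k \<ge> |\<alpha>|\<close>, the result
  does not depend on that order.\<close>

definition Dmi :: "('n::finite \<Rightarrow> nat) \<Rightarrow> (real ^ 'n \<Rightarrow> 'b::real_normed_vector) \<Rightarrow> real ^ 'n \<Rightarrow> 'b" where
  "Dmi \<alpha> f = foldr partial (SOME is. \<forall>i. count_list is i = \<alpha> i) f"

lemma ex_list_of_multi_index:
  fixes \<alpha> :: "'n::finite \<Rightarrow> nat"
  shows "\<exists>is. \<forall>i. count_list is i = \<alpha> i"
proof -
  obtain xs :: "'n list" where xs: "mset xs = Abs_multiset \<alpha>"
    using ex_mset by blast
  have "count (mset xs) i = \<alpha> i" for i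
    unfolding xs by (subst count_Abs_multiset) auto
  then show ?thesis
    by (metis count_mset)
qed

lemma finite_multi_indices: "finite {\<alpha> :: 'n::finite \<Rightarrow> nat. mi_order \<alpha> \<le> k}"
proof (rule finite_subset)
  have "\<alpha> i \<le> mi_order \<alpha>" for \<alpha> :: "'n \<Rightarrow> nat" and i
    unfolding mi_order_def by (rule member_le_sum) simp_all
  then show "{\<alpha> :: 'n \<Rightarrow> nat. mi_order \<alpha> \<le> k} \<subseteq> Pi\<^sub>E UNIV (\<lambda>_. {..k})"
    by (auto intro: order_trans)
  show "finite (Pi\<^sub>E (UNIV :: 'n set) (\<lambda>_. {..k}))"
    by (rule finite_PiE) simp_all
qed

section \<open>Hoelder spaces\<close>

definition holder_quotients ::
  "real \<Rightarrow> (real ^ 'n::finite) set \<Rightarrow> (real ^ 'n \<Rightarrow> 'b::real_normed_vector) \<Rightarrow> real set" where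
  "holder_quotients b S f = {norm (f x - f y) / norm (x - y) powr b | x y. x \<in> S \<and> y \<in> S \<and> x \<noteq> y}"

definition holder_seminorm ::
  "real \<Rightarrow> (real ^ 'n::finite) set \<Rightarrow> (real ^ 'n \<Rightarrow> 'b::real_normed_vector) \<Rightarrow> real" where
  "holder_seminorm b S f = Sup (holder_quotients b S f)"

definition Ck_norm ::
  "nat \<Rightarrow> (real ^ 'n::finite) set \<Rightarrow> (real ^ 'n \<Rightarrow> 'b::real_normed_vector) \<Rightarrow> real" where
  "Ck_norm k S f = (\<Sum>\<alpha> | mi_order \<alpha> \<le> k. SUP x\<in>S. norm (Dmi \<alpha> f x))"

text \<open>The \<open>C\<^sup>k\<close> functions, \<open>k\<close> the integer part of \<open>r\<close>, for which \<open>Cr_norm r S\<close> below is finite, that is, for which all suprema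
  occurring in it are suprema of bounded sets. Here \<open>r \<ge> 0\<close>.\<close>

definition Cr_on :: "real \<Rightarrow> (real ^ 'n::finite) set \<Rightarrow> (real ^ 'n \<Rightarrow> 'b::real_normed_vector) \<Rightarrow> bool" where
  "Cr_on r S f \<longleftrightarrow>
     Ck_on (nat \<lfloor>r\<rfloor>) S f \<and>
     (\<forall>\<alpha>. mi_order \<alpha> \<le> nat \<lfloor>r\<rfloor> \<longrightarrow> bounded (Dmi \<alpha> f ` S)) \<and>
     (r \<notin> \<int> \<longrightarrow> (\<forall>\<alpha>. mi_order \<alpha> = nat \<lfloor>r\<rfloor> \<longrightarrow> bdd_above (holder_quotients (frac r) S (Dmi \<alpha> f))))"

definition Cr_norm ::
  "real \<Rightarrow> (real ^ 'n::finite) set \<Rightarrow> (real ^ 'n \<Rightarrow> 'b::real_normed_vector) \<Rightarrow> real" where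
  "Cr_norm r S f =
     (if r \<in> \<int> then Ck_norm (nat \<lfloor>r\<rfloor>) S f
      else Ck_norm (nat \<lfloor>r\<rfloor>) S f
         + (\<Sum>\<alpha> | mi_order \<alpha> = nat \<lfloor>r\<rfloor>. holder_seminorm (frac r) S (Dmi \<alpha> f)))"

section \<open>Phase, amplitude and the oscillatory integral\<close>

definition grad :: "(real ^ 'n::finite \<Rightarrow> real) \<Rightarrow> real ^ 'n \<Rightarrow> real ^ 'n" where
  "grad \<Phi> x = (\<chi> i. partial i \<Phi> x)"

definition hessian :: "(real ^ 'n::finite \<Rightarrow> real) \<Rightarrow> real ^ 'n \<Rightarrow> real ^ 'n ^ 'n" where
  "hessian \<Phi> x = (\<chi> i j. partial i (partial j \<Phi>) x)"

definition Lstar :: "(real ^ 'n::finite \<Rightarrow> real) \<Rightarrow> real" where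
  "Lstar \<Phi> = (INF x\<in>ball 0 1. \<bar>det (hessian \<Phi> x)\<bar>)"

definition Pnorm :: "real \<Rightarrow> (real ^ 'n::finite \<Rightarrow> real) \<Rightarrow> real" where
  "Pnorm r \<Phi> = (\<Sum>\<beta> | mi_order \<beta> = 2. Cr_norm (r - 2) (ball 0 1) (Dmi \<beta> \<Phi>))"

definition Anorm :: "real \<Rightarrow> (real ^ 'n::finite \<Rightarrow> complex) \<Rightarrow> real" where
  "Anorm r \<psi> = Cr_norm r (ball 0 1) \<psi>"

definition osc_integral :: "real \<Rightarrow> (real ^ 'n::finite \<Rightarrow> real) \<Rightarrow> (real ^ 'n \<Rightarrow> complex) \<Rightarrow> complex" where
  "osc_integral l \<Phi> \<psi> = (LINT x|lborel. exp (\<i> * complex_of_real (l * \<Phi> x)) * \<psi> x)"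

end

theory Submission
  imports Defs
begin

text \<open>Write \<open>d\<close> for the dimension, \<open>Q = max 1 P\<close> with \<open>P\<close> the norm of the second derivatives of the phase, and
\<open>\<delta> = (\<lambda>Q)\<^bsup>-1/2\<^esup>\<close>. On a cell of size \<open>\<delta>\<close> the phase \<open>\<lambda>\<Phi>\<close> is linear up to a bounded error, so the
contribution of the cell around \<open>y\<close> is a Fourier coefficient, at the frequency \<open>\<lambda>\<delta> \<nabla>\<Phi>(y)\<close>, of a function
with bounded derivatives. It therefore decays in \<open>|\<lambda>\<delta> \<nabla>\<Phi>(y)|\<close>. Summing over the cells amounts to integrating
this decay over \<open>y\<close>, and there the two global hypotheses enter: \<open>y \<mapsto> \<nabla>\<Phi>(y)\<close> is injective with Jacobian at least
\<open>L\<^sup>*\<close>, so the set where \<open>|\<nabla>\<Phi>| \<le> t\<close> has measure at most \<open>C t\<^sup>d / L\<^sup>*\<close> (\<open>small_gradient_measure\<close>), and a decay of order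
larger than \<open>d\<close> gives \<open>C (\<lambda>\<delta>)\<^bsup>-d\<^esup> / L\<^sup>* = C \<lambda>\<^bsup>-d/2\<^esup> Q\<^bsup>d/2\<^esup> / L\<^sup>*\<close> in total.

The cells are the translates of one compactly supported cutoff, and the sum over cells is an integral over their
centres \<open>y\<close>, so that Fubini and translation invariance replace a partition of unity
(\<open>integral_eq_cell_average\<close>).

The delicate point is the limited regularity. With \<open>K = [d/2] + 1\<close> and \<open>\<beta> = min 1 (n\<^sub>0 - K)\<close> the phase is
\<open>C\<^bsup>K,\<beta>\<^esup>\<close> and the amplitude \<open>C\<^sup>K\<close>, so the Fourier coefficient of a cell decays only like the power \<open>K + \<beta>\<close> or \<open>K\<close>
of the frequency, which need not exceed \<open>d\<close>. The loss is compensated by the scale: after rescaling a cell to unit size, the phase is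
a polynomial of degree \<open>K\<close> with bounded coefficients plus a remainder of size \<open>\<delta>\<^bsup>K+\<beta>-2\<^esup>\<close>, and the amplitude is a
polynomial plus a remainder of size \<open>\<delta>\<^sup>K\<close>. If \<open>h\<close> is the inverse frequency, the cell is bounded by
\<open>h\<^bsup>2K\<^esup> + \<delta>\<^bsup>K+\<beta>-2\<^esup> h\<^bsup>K+\<beta>\<^esup> + \<delta>\<^sup>K h\<^sup>K\<close> (\<open>cell_oscillation\<close>), hence by \<open>\<delta>\<^sup>M + h\<^sup>M\<close> up to a constant, with
\<open>M = 2 (K + \<beta>) - 2\<close>, and \<open>M > d\<close> is exactly the assumption \<open>n\<^sub>0 > d/2 + 1\<close> (or follows from \<open>K > d/2\<close> when \<open>\<beta> = 1\<close>).

To use a Hoelder remainder without differentiating it, oscillation is not exploited by integration by parts but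
by finite differences: translating by half a period \<open>\<pi>/|\<xi>|\<close> in the coordinate direction of the largest component of
\<open>\<nabla>\<Phi>(y)\<close> changes the sign of the exponential, so the integral equals \<open>2\<^bsup>-N\<^esup>\<close> times that of an \<open>N\<close>th difference
of the remaining factor (\<open>oscillation_by_differences\<close>). Differences annihilate polynomials of degree below \<open>N\<close> and
are bounded by the size of a remainder (\<open>line_difference\<close>). Apart from the mixed second
derivatives, which control the variation of the gradient over a cell, only pure derivatives occur.\<close>

section \<open>Calculus of iterated partial derivatives\<close>

lemma has_vector_derivative_line:
  fixes f :: "real ^ 'n::finite \<Rightarrow> 'b::real_normed_vector"
  assumes "has_partial i f (x + t *\<^sub>R axis i 1)"
  shows "((\<lambda>s. f (x + s *\<^sub>R axis i 1)) has_vector_derivative partial i f (x + t *\<^sub>R axis i 1)) (at t)"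
proof -
  let ?g = "\<lambda>s. f (x + t *\<^sub>R axis i 1 + s *\<^sub>R axis i 1)"
  have "(?g has_vector_derivative partial i f (x + t *\<^sub>R axis i 1)) (at (t - t))"
    using assms unfolding has_partial_def partial_def by (simp add: vector_derivative_works)
  then have "((?g \<circ> (\<lambda>s. s - t)) has_vector_derivative 1 *\<^sub>R partial i f (x + t *\<^sub>R axis i 1)) (at t)"
    by (intro vector_diff_chain_at) (auto intro!: derivative_eq_intros)
  moreover have "?g \<circ> (\<lambda>s. s - t) = (\<lambda>s. f (x + s *\<^sub>R axis i 1))"
    by (auto simp: fun_eq_iff algebra_simps)
  ultimately show ?thesis by simp
qed

lemma eventually_line_in_open:
  fixes x v :: "'a::real_normed_vector"
  assumes "open S" "x \<in> S"
  shows "\<forall>\<^sub>F t in nhds (0::real). x + t *\<^sub>R v \<in> S"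
proof -
  have "((\<lambda>t. x + t *\<^sub>R v) \<longlongrightarrow> x + 0 *\<^sub>R v) (nhds (0::real))"
    by (intro tendsto_intros filterlim_ident)
  with assms show ?thesis by (auto simp: tendsto_def)
qed

lemma partial_cong_open:
  fixes f g :: "real ^ 'n::finite \<Rightarrow> 'b::real_normed_vector"
  assumes "open S" "x \<in> S" "\<And>y. y \<in> S \<Longrightarrow> f y = g y"
  shows "has_partial i f x \<longleftrightarrow> has_partial i g x" "partial i f x = partial i g x"
proof -
  have ev: "\<forall>\<^sub>F t in nhds 0. f (x + t *\<^sub>R axis i 1) = g (x + t *\<^sub>R axis i 1)"
    using eventually_line_in_open[OF assms(1,2), of "axis i 1"] by eventually_elim (rule assms(3))
  have eq: "((\<lambda>t. f (x + t *\<^sub>R axis i 1)) has_vector_derivative D) (at 0)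
     = ((\<lambda>t. g (x + t *\<^sub>R axis i 1)) has_vector_derivative D) (at 0)" for D
    by (rule has_vector_derivative_cong_ev)
       (use ev eventually_nhds_x_imp_x[OF ev] in \<open>auto elim: eventually_mono\<close>)
  show "partial i f x = partial i g x"
    unfolding partial_def vector_derivative_def eq ..
  show "has_partial i f x \<longleftrightarrow> has_partial i g x"
    unfolding has_partial_def
    by (rule iffI; rule differentiableI_vector, (rule iffD1[OF eq] | rule iffD2[OF eq]),
        erule iffD1[OF vector_derivative_works])
qed

lemma Ck_on_SucD: "Ck_on (Suc k) S f \<Longrightarrow> Ck_on k S f"
  by (induction k arbitrary: f) auto

lemma Ck_on_mono:
  assumes "Ck_on k S f" "m \<le> k"
  shows "Ck_on m S f"
  using assms(2,1) by (induction rule: inc_induct) (auto intro: Ck_on_SucD)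

lemma Ck_on_imp_continuous_on: "Ck_on k S f \<Longrightarrow> continuous_on S f"
  by (cases k) auto

lemma Ck_on_foldr_partial: "Ck_on (length is + k) S f \<Longrightarrow> Ck_on k S (foldr partial is f)"
proof (induction "is" arbitrary: k)
  case (Cons i "is")
  then have "Ck_on (Suc k) S (foldr partial is f)" by (intro Cons.IH) simp
  then show ?case by simp
qed simp

text \<open>Two applications of the mean value theorem, first along \<open>i\<close> and then along \<open>j\<close>, turn the second difference into
a mixed derivative at a nearby point. The quotient is symmetric in \<open>i\<close> and \<open>j\<close>, so comparing the two limits proves
Schwarz's theorem.\<close>

lemma mixed_difference_quotient:
  fixes f :: "real ^ 'n::finite \<Rightarrow> real"
  assumes "open S" "Ck_on 2 S f" "x \<in> S"
  shows "((\<lambda>h. (f (x + h *\<^sub>R axis i 1 + h *\<^sub>R axis j 1) - f (x + h *\<^sub>R axis i 1)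
              - f (x + h *\<^sub>R axis j 1) + f x) / h\<^sup>2) \<longlongrightarrow> partial j (partial i f) x) (at_right 0)"
proof (rule tendstoI)
  fix e :: real assume "e > 0"
  let ?a = "axis i 1 :: real ^ 'n" and ?b = "axis j 1 :: real ^ 'n"
  have C2: "Ck_on (Suc (Suc 0)) S f" using assms(2) by (simp add: numeral_2_eq_2)
  have hp1: "has_partial i f y" and hp2: "has_partial j (partial i f) y" if "y \<in> S" for y
    using C2 that by auto
  have "continuous_on S (partial j (partial i f))" using C2 by auto
  then obtain d where d: "d > 0" "\<And>y. y \<in> S \<Longrightarrow> dist y x < d \<Longrightarrow>
      dist (partial j (partial i f) y) (partial j (partial i f) x) < e"
    using \<open>e > 0\<close> assms(3) unfolding continuous_on_iff by metis
  obtain r where r: "r > 0" "ball x r \<subseteq> S" using assms(1,3) open_contains_ball by blast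
  define \<eta> where "\<eta> = min d r / 2"
  have \<eta>: "\<eta> > 0" using d r by (simp add: \<eta>_def)
  have near: "dist (x + s *\<^sub>R ?a + t *\<^sub>R ?b) x < min d r" if "0 \<le> s" "s < \<eta>" "0 \<le> t" "t < \<eta>" for s t
  proof -
    have "norm (s *\<^sub>R ?a + t *\<^sub>R ?b) \<le> s + t"
      using norm_triangle_ineq[of "s *\<^sub>R ?a" "t *\<^sub>R ?b"] that by simp
    then show ?thesis using that by (simp add: dist_norm \<eta>_def add.assoc)
  qed
  have inS: "x + s *\<^sub>R ?a + t *\<^sub>R ?b \<in> S" if "0 \<le> s" "s < \<eta>" "0 \<le> t" "t < \<eta>" for s t
    using near[OF that] r by (auto simp: dist_commute)
  have main: "dist ((f (x + h *\<^sub>R ?a + h *\<^sub>R ?b) - f (x + h *\<^sub>R ?a) - f (x + h *\<^sub>R ?b) + f x) / h\<^sup>2)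
        (partial j (partial i f) x) < e" if h: "0 < h" "h < \<eta>" for h
  proof -
    define u where "u s = f (x + h *\<^sub>R ?b + s *\<^sub>R ?a) - f (x + s *\<^sub>R ?a)" for s
    have du: "(u has_real_derivative
        partial i f (x + h *\<^sub>R ?b + s *\<^sub>R ?a) - partial i f (x + s *\<^sub>R ?a)) (at s)"
      if "0 \<le> s" "s \<le> h" for s
    proof -
      have m1: "x + h *\<^sub>R ?b + s *\<^sub>R ?a \<in> S" using inS[of s h] that h by (simp add: add_ac)
      have m2: "x + s *\<^sub>R ?a \<in> S" using inS[of s 0] that h by simp
      show ?thesis
        unfolding u_def has_real_derivative_iff_has_vector_derivative
        by (rule has_vector_derivative_diff[OF has_vector_derivative_line[OF hp1[OF m1]]
            has_vector_derivative_line[OF hp1[OF m2]]])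
    qed
    obtain s where s: "0 < s" "s < h" "u h - u 0 = (h - 0) *
        (partial i f (x + h *\<^sub>R ?b + s *\<^sub>R ?a) - partial i f (x + s *\<^sub>R ?a))"
      using MVT2[OF h(1) du] by auto
    have dv: "((\<lambda>t. partial i f (x + s *\<^sub>R ?a + t *\<^sub>R ?b)) has_real_derivative
        partial j (partial i f) (x + s *\<^sub>R ?a + t *\<^sub>R ?b)) (at t)" if "0 \<le> t" "t \<le> h" for t
      unfolding has_real_derivative_iff_has_vector_derivative
      by (rule has_vector_derivative_line[OF hp2[OF inS]]) (use that h s in auto)
    obtain t where t: "0 < t" "t < h" "partial i f (x + s *\<^sub>R ?a + h *\<^sub>R ?b) - partial i f (x + s *\<^sub>R ?a + 0 *\<^sub>R ?b)
        = (h - 0) * partial j (partial i f) (x + s *\<^sub>R ?a + t *\<^sub>R ?b)"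
      using MVT2[OF h(1) dv] by auto
    have "u h - u 0 = h\<^sup>2 * partial j (partial i f) (x + s *\<^sub>R ?a + t *\<^sub>R ?b)"
      using s(3) t(3) by (simp add: algebra_simps power2_eq_square)
    moreover have "u h - u 0 = f (x + h *\<^sub>R ?a + h *\<^sub>R ?b) - f (x + h *\<^sub>R ?a) - f (x + h *\<^sub>R ?b) + f x"
      by (simp add: u_def algebra_simps)
    ultimately have "(f (x + h *\<^sub>R ?a + h *\<^sub>R ?b) - f (x + h *\<^sub>R ?a) - f (x + h *\<^sub>R ?b) + f x) / h\<^sup>2
        = partial j (partial i f) (x + s *\<^sub>R ?a + t *\<^sub>R ?b)"
      using h by simp
    then show ?thesis using d(2)[OF inS[of s t]] near[of s t] s t h by simp
  qed
  show "\<forall>\<^sub>F h in at_right 0. dist ((f (x + h *\<^sub>R ?a + h *\<^sub>R ?b) - f (x + h *\<^sub>R ?a)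
      - f (x + h *\<^sub>R ?b) + f x) / h\<^sup>2) (partial j (partial i f) x) < e"
    using main \<eta> by (auto simp: eventually_at_right_field intro!: exI[of _ \<eta>])
qed

lemma partial_commute:
  fixes f :: "real ^ 'n::finite \<Rightarrow> real"
  assumes "open S" "Ck_on 2 S f" "x \<in> S"
  shows "partial i (partial j f) x = partial j (partial i f) x"
  using mixed_difference_quotient[OF assms, of i j] mixed_difference_quotient[OF assms, of j i]
  by (intro tendsto_unique[OF trivial_limit_at_right_real]) (auto simp: algebra_simps)

lemma foldr_partial_move:
  fixes f :: "real ^ 'n::finite \<Rightarrow> real"
  assumes "open S" "Ck_on (length ps + Suc (length qs)) S f" "x \<in> S"
  shows "foldr partial (ps @ i # qs) f x = foldr partial (i # ps @ qs) f x"
  using assms(2,3)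
proof (induction ps arbitrary: x)
  case (Cons p ps)
  have "Ck_on (length ps + Suc (length qs)) S f"
    by (rule Ck_on_mono[OF Cons.prems(1)]) simp
  then have IH: "foldr partial (ps @ i # qs) f y = foldr partial (i # ps @ qs) f y" if "y \<in> S" for y
    using Cons.IH that by blast
  have "foldr partial ((p # ps) @ i # qs) f x = partial p (foldr partial (ps @ i # qs) f) x" by simp
  also have "\<dots> = partial p (partial i (foldr partial (ps @ qs) f)) x"
    using partial_cong_open(2)[OF assms(1) Cons.prems(2) IH] by simp
  also have "\<dots> = partial i (partial p (foldr partial (ps @ qs) f)) x"
    by (rule partial_commute[OF assms(1) Ck_on_foldr_partial Cons.prems(2)])
       (use Cons.prems(1) in \<open>simp add: numeral_2_eq_2\<close>)
  finally show ?case by simp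
qed simp

text \<open>\<open>Dmi\<close> differentiates in a chosen order. The norm of the phase contains the derivatives \<open>D\<^sup>\<alpha> D\<^sup>\<beta> \<Phi>\<close>, whose order of
differentiation is in general not the one chosen for \<open>\<alpha> + \<beta>\<close>; this lemma identifies them.\<close>

lemma foldr_partial_perm:
  fixes f :: "real ^ 'n::finite \<Rightarrow> real"
  assumes "open S" "Ck_on (length is) S f" "mset is = mset js" "x \<in> S"
  shows "foldr partial is f x = foldr partial js f x"
  using assms(2-4)
proof (induction "is" arbitrary: js x)
  case (Cons i "is")
  have "i \<in> set js" using Cons.prems(2) by (metis list.set_intros(1) set_mset_mset)
  then obtain ps qs where js: "js = ps @ i # qs" by (meson split_list)
  have ms: "mset is = mset (ps @ qs)" using Cons.prems(2) js by simp
  have len: "length is = length ps + length qs" using mset_eq_length[OF ms] by simp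
  have "Ck_on (length is) S f" by (rule Ck_on_mono[OF Cons.prems(1)]) simp
  then have IH: "foldr partial is f y = foldr partial (ps @ qs) f y" if "y \<in> S" for y
    using Cons.IH[OF _ ms that] by blast
  have "foldr partial js f x = foldr partial (i # ps @ qs) f x"
    unfolding js by (rule foldr_partial_move[OF assms(1)]) (use Cons.prems len in auto)
  also have "\<dots> = foldr partial (i # is) f x"
    using partial_cong_open(2)[OF assms(1) Cons.prems(3) IH] by simp
  finally show ?case by simp
qed simp

lemma Dmi_eq_foldr:
  obtains "is" where "\<And>i. count_list is i = \<alpha> i" "length is = mi_order \<alpha>" "\<And>f. Dmi \<alpha> f = foldr partial is f"
proof -
  define js where "js = (SOME is. \<forall>i. count_list is i = \<alpha> i)"
  have c: "\<forall>i. count_list js i = \<alpha> i" unfolding js_def by (rule someI_ex[OF ex_list_of_multi_index])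
  have "sum (count_list js) (set js) = sum (count_list js) UNIV"
    by (rule sum.mono_neutral_left) auto
  with c have "length js = mi_order \<alpha>" using sum_count_set[of js UNIV] by (simp add: mi_order_def)
  with c show ?thesis by (intro that[of js]) (auto simp: Dmi_def js_def)
qed

lemma Dmi_eq_on:
  fixes f :: "real ^ 'n::finite \<Rightarrow> real"
  assumes "open S" "Ck_on (length is) S f" "x \<in> S"
  shows "Dmi (count_list is) f x = foldr partial is f x"
proof -
  obtain js where js: "\<And>i. count_list js i = count_list is i" "Dmi (count_list is) f = foldr partial js f"
    using Dmi_eq_foldr by metis
  have "mset is = mset js" using js(1) by (intro multiset_eqI) (simp flip: count_mset)
  from foldr_partial_perm[OF assms(1,2) this assms(3)] js(2) show ?thesis by simp
qed

lemma mi_order_axis: "mi_order (\<lambda>j. if j = i then m else 0) = m"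
  by (simp add: mi_order_def)

text \<open>A list that contains only \<open>i\<close> is determined by its length, so for a pure power the choice in \<open>Dmi\<close> is forced.\<close>

lemma Dmi_axis: "Dmi (\<lambda>j. if j = i then m else 0) f = (partial i ^^ m) f"
proof -
  obtain js where js: "\<And>j. count_list js j = (if j = i then m else 0)"
     "length js = mi_order (\<lambda>j. if j = i then m else 0)"
     "Dmi (\<lambda>j. if j = i then m else 0) f = foldr partial js f"
    by (rule Dmi_eq_foldr[of "\<lambda>j. if j = i then m else 0"]) blast
  have "j = i" if "j \<in> set js" for j
    using js(1)[of j] that by (metis count_list_0_iff)
  then have "js = replicate m i"
    using js(2) by (simp add: mi_order_axis replicate_eqI)
  then show ?thesis using js(3) by simp
qed

lemma mi_order_count_list: "mi_order (count_list is) = length is"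
  by (simp add: mi_order_def sum_count_set)

lemma Cck_imp_Ck_on_UNIV:
  fixes f :: "real ^ 'n::finite \<Rightarrow> 'b::real_normed_vector"
  assumes "open U" "Cck k U f"
  shows "Ck_on k UNIV f"
  using assms(2)
proof (induction k arbitrary: f)
  case 0
  let ?Z = "- closure {x. f x \<noteq> 0}"
  have "f x = 0" if "x \<in> ?Z" for x using that closure_subset[of "{x. f x \<noteq> 0}"] by auto
  then have "continuous_on ?Z f"
    by (intro continuous_on_eq[OF continuous_on_const[of ?Z 0]]) (simp only:)
  moreover have "continuous_on U f" using 0 by (simp add: Cck_def)
  ultimately have "continuous_on (U \<union> ?Z) f" using assms(1) by (intro continuous_on_open_Un) auto
  moreover have "U \<union> ?Z = UNIV" using 0 by (auto simp: Cck_def)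
  ultimately show ?case by simp
next
  case (Suc k)
  let ?Z = "- closure {x. f x \<noteq> 0}"
  have Z: "open ?Z" by (rule open_Compl[OF closed_closure])
  have f0: "f x = 0" if "x \<in> ?Z" for x using that closure_subset[of "{x. f x \<noteq> 0}"] by auto
  have U: "x \<in> U \<or> x \<in> ?Z" for x using Suc.prems by (auto simp: Cck_def)
  have hp0: "has_partial i (\<lambda>x. 0::'b) x" "partial i (\<lambda>x. 0::'b) x = 0" for i and x :: "real ^ 'n"
    by (simp_all add: has_partial_def partial_def)
  have hpZ: "has_partial i f x" "partial i f x = 0" if "x \<in> ?Z" for i x
    using partial_cong_open[where i = i, OF Z that f0] hp0 by auto
  have hp: "has_partial i f x" for i x using U[of x] hpZ(1) Suc.prems by (auto simp: Cck_def)
  have sub: "closure {x. partial i f x \<noteq> 0} \<subseteq> closure {x. f x \<noteq> 0}" for i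
    by (rule closure_minimal) (use hpZ(2) in auto)
  have "Cck k U (partial i f)" for i
    unfolding Cck_def
  proof (intro conjI)
    show "Ck_on k U (partial i f)" using Suc.prems by (simp add: Cck_def)
    show "compact (closure {x. partial i f x \<noteq> 0})"
      using Suc.prems sub[of i] by (metis Cck_def closed_closure closed_Int_compact inf.absorb_iff1)
    show "closure {x. partial i f x \<noteq> 0} \<subseteq> U" using sub Suc.prems by (force simp: Cck_def)
  qed
  then have "Ck_on k UNIV (partial i f)" for i by (rule Suc.IH)
  moreover have "Cck k U f"
    using Suc.prems Ck_on_SucD[of k U f] unfolding Cck_def by blast
  from Suc.IH[OF this] have "continuous_on UNIV f" by (rule Ck_on_imp_continuous_on)
  ultimately show ?case using hp by simp
qed

text \<open>The increment is built up one coordinate at a time. Each coordinate contributes an increment along one axis,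
which the mean value inequality compares with the partial derivative at \<open>x\<close>.\<close>

lemma has_derivative_of_continuous_partials:
  fixes f :: "real ^ 'n::finite \<Rightarrow> real"
  assumes S: "open S" "x \<in> S" and C1: "Ck_on 1 S f"
  shows "(f has_derivative (\<lambda>v. \<Sum>i\<in>UNIV. v $ i * partial i f x)) (at x)"
proof -
  define p where "p I v = (\<Sum>i\<in>I. (v $ i) *\<^sub>R axis i (1::real))" for I and v :: "real ^ 'n"
  have pc: "p I v $ j = (if j \<in> I then v $ j else 0)" if "finite I" for I v j
    using that by (simp add: p_def axis_def if_distrib cong: if_cong)
  have pn: "norm (p I v) \<le> norm v" if "finite I" for I v
    by (rule norm_le_componentwise_cart) (simp add: pc[OF that])
  have step: "\<exists>d>0. \<forall>v. norm v < d \<longrightarrow> \<bar>f (x + p I v) - f x - (\<Sum>i\<in>I. v $ i * partial i f x)\<bar> \<le> e * norm v"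
    if "finite I" "e > 0" for I e
    using that
  proof (induction I arbitrary: e)
    case empty
    then show ?case by (auto simp: p_def intro!: exI[of _ 1])
  next
    case (insert j I)
    obtain d1 where d1: "d1 > 0" "\<And>v. norm v < d1 \<Longrightarrow>
        \<bar>f (x + p I v) - f x - (\<Sum>i\<in>I. v $ i * partial i f x)\<bar> \<le> e/2 * norm v"
      using insert.IH[of "e/2"] insert.prems by auto
    have hp: "has_partial j f y" if "y \<in> S" for y using C1 that by auto
    have "continuous_on S (partial j f)" using C1 by auto
    then obtain d2 where d2: "d2 > 0" "\<And>y. y \<in> S \<Longrightarrow> dist y x < d2 \<Longrightarrow>
        dist (partial j f y) (partial j f x) < e/2"
      using insert.prems S(2) unfolding continuous_on_iff by (metis half_gt_zero)
    obtain r where r: "r > 0" "ball x r \<subseteq> S" using S open_contains_ball by blast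
    define d where "d = min d1 (min d2 r) / 2"
    have "d > 0" using d1 d2 r by (simp add: d_def)
    moreover have "\<bar>f (x + p (insert j I) v) - f x - (\<Sum>i\<in>insert j I. v $ i * partial i f x)\<bar> \<le> e * norm v"
      if v: "norm v < d" for v
    proof -
      have vj: "\<bar>v $ j\<bar> \<le> norm v" by (rule component_le_norm_cart)
      have near: "dist (x + p I v + t *\<^sub>R axis j 1) x < min d2 r" if "\<bar>t\<bar> \<le> \<bar>v $ j\<bar>" for t
      proof -
        have "norm (p I v + t *\<^sub>R axis j 1) \<le> norm v + norm v"
          by (rule order_trans[OF norm_triangle_ineq]) (use pn[OF insert.hyps(1), of v] that vj in simp)
        then show ?thesis using v by (simp add: dist_norm d_def add.assoc)
      qed
      have inS: "x + p I v + t *\<^sub>R axis j 1 \<in> S" if "\<bar>t\<bar> \<le> \<bar>v $ j\<bar>" for t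
        using near[OF that] r by (auto simp: dist_commute)
      define g where "g t = f (x + p I v + t *\<^sub>R axis j 1) - t * partial j f x" for t
      have dg: "(g has_derivative (\<lambda>s. s * (partial j f (x + p I v + t *\<^sub>R axis j 1) - partial j f x)))
           (at t within {- \<bar>v $ j\<bar>..\<bar>v $ j\<bar>})" if "t \<in> {- \<bar>v $ j\<bar>..\<bar>v $ j\<bar>}" for t
      proof -
        have "((\<lambda>t. f (x + p I v + t *\<^sub>R axis j 1)) has_real_derivative
            partial j f (x + p I v + t *\<^sub>R axis j 1)) (at t)"
          unfolding has_real_derivative_iff_has_vector_derivative
          by (rule has_vector_derivative_line[OF hp[OF inS]]) (use that in auto)
        then have "(g has_real_derivative (partial j f (x + p I v + t *\<^sub>R axis j 1) - partial j f x)) (at t)"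
          unfolding g_def by (auto intro!: derivative_eq_intros)
        then show ?thesis
          unfolding has_field_derivative_def
          by (subst mult.commute) (rule has_derivative_at_withinI)
      qed
      have "norm (g (v $ j) - g 0) \<le> e/2 * norm (v $ j - 0)"
      proof (rule differentiable_bound[OF _ dg])
        fix t assume t: "t \<in> {- \<bar>v $ j\<bar>..\<bar>v $ j\<bar>}"
        then have t': "\<bar>t\<bar> \<le> \<bar>v $ j\<bar>" by auto
        then have "dist (partial j f (x + p I v + t *\<^sub>R axis j 1)) (partial j f x) < e/2"
          using d2(2)[OF inS[OF t']] near[OF t'] by simp
        then have "\<bar>partial j f (x + p I v + t *\<^sub>R axis j 1) - partial j f x\<bar> \<le> e/2"
          by (simp add: dist_real_def)
        then show "onorm (\<lambda>s. s * (partial j f (x + p I v + t *\<^sub>R axis j 1) - partial j f x)) \<le> e/2"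
          using mult_right_mono[of "\<bar>partial j f (x + p I v + t *\<^sub>R axis j 1) - partial j f x\<bar>" "e/2" "\<bar>s\<bar>" for s]
          by (intro onorm_le) (simp add: abs_mult mult.commute)
      qed auto
      then have 1: "\<bar>g (v $ j) - g 0\<bar> \<le> e/2 * norm v"
        using vj insert.prems by (smt (verit) mult_left_mono half_gt_zero real_norm_def)
      have 2: "\<bar>f (x + p I v) - f x - (\<Sum>i\<in>I. v $ i * partial i f x)\<bar> \<le> e/2 * norm v"
        using d1(2)[of v] v d1 d2 r by (auto simp: d_def)
      have "x + p (insert j I) v = x + p I v + (v $ j) *\<^sub>R axis j 1"
        using insert.hyps by (simp add: p_def)
      then have "f (x + p (insert j I) v) - f x - (\<Sum>i\<in>insert j I. v $ i * partial i f x)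
         = (g (v $ j) - g 0) + (f (x + p I v) - f x - (\<Sum>i\<in>I. v $ i * partial i f x))"
        using insert.hyps by (simp add: g_def add.assoc)
      with 1 2 show ?thesis by linarith
    qed
    ultimately show ?case by blast
  qed
  have pU: "p UNIV v = v" for v by (simp add: vec_eq_iff pc)
  show ?thesis
    unfolding has_derivative_at_alt
  proof (intro conjI allI impI)
    show "bounded_linear (\<lambda>v. \<Sum>i\<in>UNIV. v $ i * partial i f x)"
      by (intro bounded_linear_sum bounded_linear_mult_const bounded_linear_vec_nth)
    fix e :: real assume "e > 0"
    from step[OF finite_class.finite_UNIV this] obtain d where
      d: "d > 0" "\<And>v. norm v < d \<Longrightarrow> \<bar>f (x + v) - f x - (\<Sum>i\<in>UNIV. v $ i * partial i f x)\<bar> \<le> e * norm v"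
      unfolding pU by blast
    show "\<exists>d>0. \<forall>y. norm (y - x) < d \<longrightarrow>
        norm (f y - f x - (\<Sum>i\<in>UNIV. (y - x) $ i * partial i f x)) \<le> e * norm (y - x)"
      using d(1) d(2)[of "y - x" for y] by (intro exI[of _ d]) auto
  qed
qed

section \<open>Measure of the image of an injective map\<close>

text \<open>The change of variables formula is used over index types that are well-ordered. Any finite type has a well-ordered
copy, with the order pulled back from the natural numbers along an injection; relabelling the coordinates by
the copy changes neither Lebesgue measure nor determinants.\<close>

typedef 'a ordered_copy = "UNIV :: 'a set"
  morphisms of_copy to_copy by simp

lemma bij_of_copy: "bij of_copy"
  by (metis bijI' of_copy_inject UNIV_I to_copy_inverse)

instance ordered_copy :: (finite) finite
proof
  have "inj (of_copy :: 'a ordered_copy \<Rightarrow> 'a)" using bij_of_copy by (rule bij_is_inj)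
  then show "finite (UNIV :: 'a ordered_copy set)" by (rule finite_imageD[rotated]) simp
qed

definition copy_index :: "'a::finite \<Rightarrow> nat" where
  "copy_index = (SOME f. inj f)"

lemma inj_copy_index: "inj (copy_index :: 'a::finite \<Rightarrow> nat)"
proof -
  have "\<exists>f :: 'a \<Rightarrow> nat. inj f" using finite_imp_inj_to_nat_seg[of "UNIV :: 'a set"] by auto
  then show ?thesis unfolding copy_index_def by (rule someI_ex)
qed

instantiation ordered_copy :: (finite) wellorder
begin

definition less_eq_ordered_copy :: "'a ordered_copy \<Rightarrow> 'a ordered_copy \<Rightarrow> bool" where
  "x \<le> y \<longleftrightarrow> copy_index (of_copy x) \<le> copy_index (of_copy y)"

definition less_ordered_copy :: "'a ordered_copy \<Rightarrow> 'a ordered_copy \<Rightarrow> bool" where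
  "x < y \<longleftrightarrow> copy_index (of_copy x) < copy_index (of_copy y)"

instance
proof
  fix x y z :: "'a ordered_copy"
  show "x < y \<longleftrightarrow> x \<le> y \<and> \<not> y \<le> x" "x \<le> x" "x \<le> y \<or> y \<le> x"
    unfolding less_eq_ordered_copy_def less_ordered_copy_def by linarith+
  show "x \<le> z" if "x \<le> y" "y \<le> z"
    using that unfolding less_eq_ordered_copy_def by linarith
  show "x = y" if "x \<le> y" "y \<le> x"
  proof -
    have "copy_index (of_copy x) = copy_index (of_copy y)"
      using that unfolding less_eq_ordered_copy_def by linarith
    then have "of_copy x = of_copy y" by (rule injD[OF inj_copy_index])
    then show ?thesis by (simp only: of_copy_inject)
  qed
next
  fix P and a :: "'a ordered_copy"
  assume "\<And>x :: 'a ordered_copy. (\<And>y. y < x \<Longrightarrow> P y) \<Longrightarrow> P x"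
  then show "P a"
    unfolding less_ordered_copy_def
    by (rule measure_induct_rule[of "\<lambda>x. copy_index (of_copy x)"])
qed

end

text \<open>Conjugation sends transpositions to transpositions.\<close>

lemma sign_conjugate:
  fixes f :: "'m::finite \<Rightarrow> 'n::finite"
  assumes "bij f" "p permutes UNIV"
  shows "sign (f \<circ> p \<circ> inv f) = sign p"
  using assms(2) finite_class.finite_UNIV
proof (induction p rule: permutes_induct)
  case id
  have "f \<circ> id \<circ> inv f = id" using assms(1) by (simp add: fun_eq_iff bij_is_surj surj_f_inv_f)
  then show ?case by simp
next
  case (swap a b p)
  have "f \<circ> (Transposition.transpose a b \<circ> p) \<circ> inv f
      = Transposition.transpose (f a) (f b) \<circ> (f \<circ> p \<circ> inv f)"
    using bij_is_inj[OF assms(1)] by (auto simp: fun_eq_iff Transposition.transpose_def inj_eq)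
  moreover have "bij (f \<circ> p \<circ> inv f)"
    using assms(1) swap by (intro bij_comp bij_imp_bij_inv permutes_bij)
  then have "permutation (f \<circ> p \<circ> inv f)" unfolding permutation by simp
  moreover have "permutation p"
    unfolding permutation_permutes by (rule exI[of _ UNIV]) (simp add: \<open>p permutes UNIV\<close>)
  moreover have "f a \<noteq> f b" using \<open>a \<noteq> b\<close> bij_is_inj[OF assms(1)] by (simp add: inj_eq)
  ultimately show ?case using \<open>sign (f \<circ> p \<circ> inv f) = sign p\<close> \<open>a \<noteq> b\<close>
    by (simp add: sign_compose sign_swap_id permutation_swap_id del: comp_apply)
qed

lemma det_reindex:
  fixes f :: "'m::finite \<Rightarrow> 'n::finite" and A :: "real ^ 'n ^ 'n"
  assumes f: "bij f"
  shows "det (\<chi> i j. A $ f i $ f j) = det A"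
  unfolding det_def
proof (rule sum.reindex_bij_witness[where i = "\<lambda>p. inv f \<circ> p \<circ> f" and j = "\<lambda>p. f \<circ> p \<circ> inv f"])
  have ff: "f (inv f x) = x" "inv f (f y) = y" for x y
    using f by (simp_all add: bij_is_surj surj_f_inv_f bij_is_inj)
  fix p :: "'m \<Rightarrow> 'm" assume "p \<in> {p. p permutes UNIV}"
  then have p: "p permutes UNIV" by simp
  show "inv f \<circ> (f \<circ> p \<circ> inv f) \<circ> f = p" by (simp add: fun_eq_iff ff)
  have "bij (f \<circ> p \<circ> inv f)" using f p by (intro bij_comp bij_imp_bij_inv permutes_bij)
  then show "f \<circ> p \<circ> inv f \<in> {p. p permutes UNIV}" by (auto intro!: bij_imp_permutes)
  have "(\<Prod>i\<in>UNIV. A $ i $ (f \<circ> p \<circ> inv f) i) = (\<Prod>i\<in>UNIV. A $ f i $ f (p i))"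
    using prod.reindex_bij_betw[OF f, of "\<lambda>i. A $ i $ (f \<circ> p \<circ> inv f) i"] by (simp add: ff)
  then show "of_int (sign (f \<circ> p \<circ> inv f)) * (\<Prod>i\<in>UNIV. A $ i $ (f \<circ> p \<circ> inv f) i)
     = of_int (sign p) * (\<Prod>i\<in>UNIV. (\<chi> i j. A $ f i $ f j) $ i $ p i)"
    by (simp add: sign_conjugate[OF f p])
next
  have ff: "f (inv f x) = x" "inv f (f y) = y" for x y
    using f by (simp_all add: bij_is_surj surj_f_inv_f bij_is_inj)
  fix p :: "'n \<Rightarrow> 'n" assume "p \<in> {p. p permutes UNIV}"
  then have p: "p permutes UNIV" by simp
  show "f \<circ> (inv f \<circ> p \<circ> f) \<circ> inv f = p" by (simp add: fun_eq_iff ff)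
  have "bij (inv f \<circ> p \<circ> f)" using f p by (intro bij_comp bij_imp_bij_inv permutes_bij)
  then show "inv f \<circ> p \<circ> f \<in> {p. p permutes UNIV}" by (auto intro!: bij_imp_permutes)
qed

lemma prod_Basis_cart: "(\<Prod>b\<in>Basis. (w :: real ^ 'n::finite) \<bullet> b) = (\<Prod>i\<in>UNIV. w $ i)"
proof -
  have B: "(Basis :: (real ^ 'n) set) = (\<lambda>i. axis i 1) ` UNIV" by (auto simp: Basis_vec_def)
  have "inj (\<lambda>i. axis i (1::real) :: real ^ 'n)" by (simp add: inj_on_def axis_eq_axis)
  then show ?thesis unfolding B by (subst prod.reindex) (simp_all add: cart_eq_inner_axis)
qed

lemma emeasure_reindex:
  fixes f :: "'m::finite \<Rightarrow> 'n::finite"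
  assumes f: "bij f" and S: "S \<in> sets borel"
  shows "emeasure lborel ((\<lambda>w :: real ^ 'm. \<chi> i. w $ inv f i) -` S) = emeasure lborel (S :: (real ^ 'n) set)"
proof -
  let ?V = "\<lambda>w :: real ^ 'm. (\<chi> i. w $ inv f i) :: real ^ 'n"
  have ff: "f (inv f x) = x" "inv f (f y) = y" for x y
    using f by (simp_all add: bij_is_surj surj_f_inv_f bij_is_inj)
  have "linear ?V" by (rule linearI) (simp_all add: vec_eq_iff)
  then have cont: "continuous_on UNIV ?V" by (simp add: linear_continuous_on linear_linear)
  then have meas: "?V \<in> borel_measurable borel" by (rule borel_measurable_continuous_onI)
  have "lborel = distr lborel borel ?V"
  proof (rule lborel_eqI)
    fix l u :: "real ^ 'n"
    assume le: "\<And>b. b \<in> Basis \<Longrightarrow> l \<bullet> b \<le> u \<bullet> b"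
    have le': "l $ i \<le> u $ i" for i
      using le[of "axis i 1"] by (simp add: cart_eq_inner_axis axis_in_Basis_iff)
    have "?V -` box l u = box (\<chi> k. l $ f k) (\<chi> k. u $ f k)"
      by (auto simp: mem_box_cart) (metis ff)+
    then have "emeasure (distr lborel borel ?V) (box l u) = emeasure lborel (box (\<chi> k. l $ f k) (\<chi> k. u $ f k) :: (real ^ 'm) set)"
      using meas by (simp add: emeasure_distr)
    also have "\<dots> = (\<Prod>b\<in>Basis. ((\<chi> k. u $ f k) - (\<chi> k. l $ f k)) \<bullet> b)"
      by (rule emeasure_lborel_box) (use le' in \<open>auto simp: Basis_vec_def inner_axis\<close>)
    also have "(\<Prod>b\<in>Basis. (((\<chi> k. u $ f k) - (\<chi> k. l $ f k)) :: real ^ 'm) \<bullet> b) = (\<Prod>b\<in>Basis. (u - l) \<bullet> b)"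
      unfolding prod_Basis_cart using prod.reindex_bij_betw[OF f, of "\<lambda>i. (u - l) $ i"] by simp
    finally show "emeasure (distr lborel borel ?V) (box l u) = (\<Prod>b\<in>Basis. (u - l) \<bullet> b)" .
  qed simp
  then have "emeasure lborel S = emeasure (distr lborel borel ?V) S" by simp
  also have "\<dots> = emeasure lborel (?V -` S)" using meas S by (simp add: emeasure_distr)
  finally show ?thesis by simp
qed

text \<open>The measure of the image is the integral of the Jacobian.\<close>

lemma jacobian_lower_bound_ordered:
  fixes f :: "real ^ 'n::{finite,wellorder} \<Rightarrow> real ^ 'n::_"
  assumes S: "S \<in> lmeasurable" and T: "T \<in> lmeasurable" "f ` S \<subseteq> T"
    and der: "\<And>x. x \<in> S \<Longrightarrow> (f has_derivative (\<lambda>v. H x *v v)) (at x)"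
    and inj: "inj_on f S" and L: "\<And>x. x \<in> S \<Longrightarrow> L \<le> \<bar>det (H x)\<bar>"
  shows "L * measure lebesgue S \<le> measure lebesgue T"
proof -
  have der': "(f has_derivative (\<lambda>v. H x *v v)) (at x within S)" if "x \<in> S" for x
    using der[OF that] by (rule has_derivative_at_withinI)
  then have "f differentiable_on S" by (auto simp: differentiable_on_def differentiable_def)
  then have "f ` S \<in> sets lebesgue"
    using S by (intro differentiable_image_in_sets_lebesgue) auto
  then have fS: "f ` S \<in> lmeasurable" by (rule fmeasurableI2[OF T])
  then have "((\<lambda>x. \<bar>det (matrix (\<lambda>v. H x *v v))\<bar>) has_integral measure lebesgue (f ` S)) S"
    using has_measure_differentiable_image[OF _ der' inj] S by blast
  then have I: "((\<lambda>x. \<bar>det (H x)\<bar>) has_integral measure lebesgue (f ` S)) S"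
    by (simp add: matrix_of_matrix_vector_mul)
  have "((\<lambda>x. 1) has_integral measure lebesgue S) S"
    using S by (simp add: has_integral_iff lmeasurable_iff_integrable_on lmeasure_integral)
  from has_integral_mult_right[OF this, of L] have "((\<lambda>x. L) has_integral L * measure lebesgue S) S" by simp
  then have "L * measure lebesgue S \<le> measure lebesgue (f ` S)"
    using I L by (rule has_integral_le)
  also have "\<dots> \<le> measure lebesgue T" using fS T by (intro measure_mono_fmeasurable) auto
  finally show ?thesis .
qed

lemma jacobian_lower_bound:
  fixes f :: "real ^ 'n::finite \<Rightarrow> real ^ 'n"
  assumes S: "S \<in> sets borel" "emeasure lborel S < \<infinity>"
    and T: "T \<in> sets borel" "emeasure lborel T < \<infinity>" "f ` S \<subseteq> T"
    and der: "\<And>x. x \<in> S \<Longrightarrow> (f has_derivative (\<lambda>v. H x *v v)) (at x)"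
    and inj: "inj_on f S" and L: "\<And>x. x \<in> S \<Longrightarrow> L \<le> \<bar>det (H x)\<bar>"
  shows "L * measure lborel S \<le> measure lborel T"
proof -
  let ?\<rho> = "of_copy :: 'n ordered_copy \<Rightarrow> 'n"
  define V where "V w = (\<chi> i. w $ inv ?\<rho> i)" for w :: "real ^ 'n ordered_copy"
  define U where "U v = (\<chi> k. v $ ?\<rho> k)" for v :: "real ^ 'n"
  have ff: "?\<rho> (inv ?\<rho> x) = x" "inv ?\<rho> (?\<rho> y) = y" for x y
    using bij_of_copy[where 'a = 'n] by (simp_all add: bij_is_surj surj_f_inv_f bij_is_inj)
  have UV: "U (V w) = w" "V (U v) = v" for w v by (simp_all add: U_def V_def ff)
  have linV: "linear V" unfolding V_def by (rule linearI) (simp_all add: vec_eq_iff)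
  have linU: "linear U" unfolding U_def by (rule linearI) (simp_all add: vec_eq_iff)
  have measV: "V -` X \<in> sets borel" if "X \<in> sets borel" for X
  proof -
    have "V \<in> borel_measurable borel"
      using linV by (intro borel_measurable_continuous_onI) (simp add: linear_continuous_on linear_linear)
    then show ?thesis using measurable_sets[of V borel borel X] that by simp
  qed
  have em: "emeasure lborel (V -` X) = emeasure lborel X" if "X \<in> sets borel" for X
    using emeasure_reindex[OF bij_of_copy that] by (simp add: V_def[abs_def])
  have me: "measure lebesgue (V -` X) = measure lborel X" if "X \<in> sets borel" for X
    using em[OF that] measV[OF that] by (simp add: measure_def)
  have lm: "V -` X \<in> lmeasurable" if "X \<in> sets borel" "emeasure lborel X < \<infinity>" for X
    using em[OF that(1)] measV[OF that(1)] that(2) by (intro fmeasurableI) auto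
  \<comment> \<open>The Jacobian matrix in the relabelled coordinates.\<close>
  define H' where "H' w = (\<chi> i j. H (V w) $ ?\<rho> i $ ?\<rho> j)" for w
  have H': "H' w *v z = U (H (V w) *v V z)" for w z
  proof -
    have "(\<Sum>j\<in>UNIV. H (V w) $ i $ ?\<rho> j * z $ j) = (\<Sum>k\<in>UNIV. H (V w) $ i $ k * z $ inv ?\<rho> k)" for i
      using sum.reindex_bij_betw[OF bij_of_copy, of "\<lambda>k. H (V w) $ i $ k * z $ inv ?\<rho> k"] by (simp add: ff)
    then show ?thesis by (simp add: H'_def U_def V_def matrix_vector_mult_def vec_eq_iff)
  qed
  have "L * measure lebesgue (V -` S) \<le> measure lebesgue (V -` T)"
  proof (rule jacobian_lower_bound_ordered[where f = "U \<circ> f \<circ> V" and H = H'])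
    show "(U \<circ> f \<circ> V) ` (V -` S) \<subseteq> V -` T" using T(3) by (auto simp: UV)
    show "((U \<circ> f \<circ> V) has_derivative (\<lambda>v. H' w *v v)) (at w)" if "w \<in> V -` S" for w
    proof -
      have "((U \<circ> (f \<circ> V)) has_derivative (U \<circ> ((\<lambda>v. H (V w) *v v) \<circ> V))) (at w)"
        using that by (intro diff_chain_at linear_imp_has_derivative linV linU der) auto
      then show ?thesis by (simp add: H' o_def)
    qed
    show "inj_on (U \<circ> f \<circ> V) (V -` S)"
    proof (rule inj_onI)
      fix x y assume "x \<in> V -` S" "y \<in> V -` S" "(U \<circ> f \<circ> V) x = (U \<circ> f \<circ> V) y"
      then have "f (V x) = f (V y)" by (metis UV(2) o_apply)
      then have "V x = V y" using inj \<open>x \<in> V -` S\<close> \<open>y \<in> V -` S\<close> by (auto dest: inj_onD)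
      then show "x = y" by (metis UV(1))
    qed
    show "L \<le> \<bar>det (H' w)\<bar>" if "w \<in> V -` S" for w
      using L[of "V w"] that det_reindex[OF bij_of_copy, of "H (V w)"] by (simp add: H'_def)
  qed (use lm S T in auto)
  then show ?thesis using me S T by simp
qed

section \<open>Taylor expansions and finite differences in one variable\<close>

lemma taylor_holder:
  fixes D :: "nat \<Rightarrow> real \<Rightarrow> real"
  assumes "K > 0" "t \<in> {0..1}"
    and deriv: "\<And>m s. m < K \<Longrightarrow> s \<in> {0..1} \<Longrightarrow> (D m has_real_derivative D (Suc m) s) (at s)"
    and holder: "\<And>s. s \<in> {0..1} \<Longrightarrow> \<bar>D K s - D K 0\<bar> \<le> H * s powr b"
    and "H \<ge> 0" "b > 0"
  shows "\<bar>D 0 t - (\<Sum>m\<le>K. D m 0 / fact m * t ^ m)\<bar> \<le> H * t powr b * t ^ K"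
proof (cases "t = 0")
  case True
  then show ?thesis using assms by (simp add: sum.atMost_shift)
next
  case False
  with assms(2) have t: "0 < t" "t \<le> 1" by auto
  obtain s where s: "0 < s" "s < t"
      "D 0 t = (\<Sum>m<K. D m 0 / fact m * t ^ m) + D K s / fact K * t ^ K"
    using Maclaurin[OF t(1) assms(1) refl, of D] deriv t by auto
  have "D 0 t - (\<Sum>m\<le>K. D m 0 / fact m * t ^ m) = (D K s - D K 0) / fact K * t ^ K"
    unfolding s(3) by (simp add: lessThan_Suc_atMost[symmetric] field_simps)
  also have "\<bar>\<dots>\<bar> = \<bar>D K s - D K 0\<bar> / fact K * t ^ K"
    using t by (simp add: abs_mult)
  also have "\<dots> \<le> (H * t powr b) / 1 * t ^ K"
  proof (intro mult_right_mono frac_le)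
    have "\<bar>D K s - D K 0\<bar> \<le> H * s powr b" using holder s t by auto
    also have "\<dots> \<le> H * t powr b" using s assms(5,6) by (intro mult_left_mono powr_mono2) auto
    finally show "\<bar>D K s - D K 0\<bar> \<le> H * t powr b" .
  qed (use t assms(5) in \<open>auto simp: fact_ge_1\<close>)
  finally show ?thesis by simp
qed

text \<open>The Lagrange form of the remainder holds for the real and the imaginary part separately, at different
intermediate points; this costs the factor 2.\<close>

lemma taylor_complex:
  fixes D :: "nat \<Rightarrow> real \<Rightarrow> complex"
  assumes "K > 0" "t \<in> {0..1}"
    and deriv: "\<And>m s. m < K \<Longrightarrow> s \<in> {0..1} \<Longrightarrow> (D m has_vector_derivative D (Suc m) s) (at s)"
    and bound: "\<And>s. s \<in> {0..1} \<Longrightarrow> norm (D K s) \<le> B"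
  shows "norm (D 0 t - (\<Sum>m<K. D m 0 / fact m * of_real t ^ m)) \<le> 2 * B * t ^ K"
proof (cases "t = 0")
  case True
  have "(\<Sum>m<K. D m 0 / fact m * 0 ^ m) = D 0 0"
    using assms(1) by (cases K) (simp_all add: sum.lessThan_Suc_shift del: sum.lessThan_Suc)
  moreover have "0 \<le> B" using order_trans[OF norm_ge_zero bound[of 0]] by simp
  ultimately show ?thesis using True assms(1) by simp
next
  case False
  with assms(2) have t: "0 < t" "t \<le> 1" by auto
  have key: "\<bar>L (D 0 t - (\<Sum>m<K. D m 0 / fact m * of_real t ^ m))\<bar> \<le> B * t ^ K"
    if L: "bounded_linear L" "\<And>z. \<bar>L z\<bar> \<le> norm z" for L :: "complex \<Rightarrow> real"
  proof -
    interpret L: bounded_linear L by fact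
    have scale: "L (z / fact m * of_real r ^ m) = L z / fact m * r ^ m" for z r and m :: nat
      using L.scaleR[of "r ^ m / fact m" z] by (simp add: scaleR_conv_of_real mult.commute)
    have "((\<lambda>s. L (D m s)) has_real_derivative L (D (Suc m) s)) (at s)" if "m < K" "s \<in> {0..1}" for m s
      unfolding has_real_derivative_iff_has_vector_derivative
      by (rule L.has_vector_derivative[OF deriv[OF that]])
    then obtain s where s: "0 < s" "s < t"
      "L (D 0 t) = (\<Sum>m<K. L (D m 0) / fact m * t ^ m) + L (D K s) / fact K * t ^ K"
      using Maclaurin[OF t(1) assms(1), of "\<lambda>m s. L (D m s)" "\<lambda>s. L (D 0 s)"] t by auto
    have "L (D 0 t - (\<Sum>m<K. D m 0 / fact m * of_real t ^ m)) = L (D K s) / fact K * t ^ K"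
      unfolding L.diff L.sum scale s(3) by simp
    also have "\<bar>\<dots>\<bar> = \<bar>L (D K s)\<bar> / fact K * t ^ K" using t by (simp add: abs_mult)
    also have "\<dots> \<le> B / 1 * t ^ K"
      using order_trans[OF L(2) bound, of s] s t
      by (intro mult_right_mono frac_le) (auto simp: fact_ge_1 intro: order_trans[OF norm_ge_zero bound[of 0]])
    finally show ?thesis by simp
  qed
  show ?thesis
    using key[OF bounded_linear_Re abs_Re_le_cmod] key[OF bounded_linear_Im abs_Im_le_cmod]
      cmod_le[of "D 0 t - (\<Sum>m<K. D m 0 / fact m * of_real t ^ m)"] by linarith
qed

text \<open>Contact of order \<open>N\<close> at \<open>0\<close> with a polynomial of degree below \<open>N\<close>, where one constant controls both the coefficients and
the error on the unit interval. This is all that an \<open>N\<close>th difference sees of a smooth function, and the class is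
closed under sums and products and, for real \<open>u\<close> with \<open>u(t) = O(t)\<close>, under \<open>u \<mapsto> e\<^bsup>iu\<^esup>\<close>, so that no derivative of a product or a composition has to be computed.\<close>

definition poly_approx :: "nat \<Rightarrow> real \<Rightarrow> (real \<Rightarrow> complex) \<Rightarrow> bool" where
  "poly_approx N B f \<longleftrightarrow> (\<exists>a. (\<forall>m. norm (a m) \<le> B) \<and>
     (\<forall>t\<in>{0..1}. norm (f t - (\<Sum>m<N. a m * of_real t ^ m)) \<le> B * t ^ N))"

lemma poly_approx_nonneg: "poly_approx N B f \<Longrightarrow> 0 \<le> B"
  unfolding poly_approx_def using norm_ge_zero order_trans by blast

lemma poly_approx_mono:
  assumes "poly_approx N B f" "B \<le> B'"
  shows "poly_approx N B' f"
proof -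
  obtain a where a: "\<And>m. norm (a m) \<le> B"
    "\<And>t. t \<in> {0..1} \<Longrightarrow> norm (f t - (\<Sum>m<N. a m * of_real t ^ m)) \<le> B * t ^ N"
    using assms(1) unfolding poly_approx_def by blast
  have "norm (a m) \<le> B'" for m using a(1)[of m] assms(2) by simp
  moreover have "norm (f t - (\<Sum>m<N. a m * of_real t ^ m)) \<le> B' * t ^ N" if "t \<in> {0..1}" for t
    using a(2)[OF that] mult_right_mono[OF assms(2), of "t ^ N"] that by auto
  ultimately show ?thesis unfolding poly_approx_def by blast
qed

lemma poly_approx_poly:
  assumes "n \<le> N" "\<And>m. m < n \<Longrightarrow> norm (a m) \<le> B" "0 \<le> B"
  shows "poly_approx N B (\<lambda>t. \<Sum>m<n. a m * of_real t ^ m)"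
proof -
  have "(\<Sum>m<n. a m * of_real t ^ m) = (\<Sum>m<N. (if m < n then a m else 0) * of_real t ^ m)" for t :: real
    using assms(1) by (intro sum.mono_neutral_cong_left) auto
  then show ?thesis
    unfolding poly_approx_def using assms(2,3)
    by (intro exI[of _ "\<lambda>m. if m < n then a m else 0"]) auto
qed

lemma poly_approx_const:
  assumes "norm c \<le> B"
  shows "poly_approx N B (\<lambda>t. c)"
proof (cases N)
  case 0
  have "0 \<le> B" using assms norm_ge_zero order_trans by blast
  then show ?thesis unfolding poly_approx_def using assms 0 by (intro exI[of _ "\<lambda>m. 0"]) auto
next
  case (Suc n)
  then show ?thesis using poly_approx_poly[of 1 N "\<lambda>_. c" B] assms order_trans[OF norm_ge_zero assms] by simp
qed

lemma poly_approx_id: "poly_approx N 1 of_real"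
proof -
  consider "N = 0" | "N = 1" | "2 \<le> N" by linarith
  then show ?thesis
  proof cases
    case 3
    then show ?thesis
      using poly_approx_poly[of 2 N "\<lambda>m. if m = 1 then 1 else 0" 1] by (simp add: numeral_2_eq_2)
  qed (auto simp: poly_approx_def intro!: exI[of _ "\<lambda>_. 0"])
qed

lemma poly_approx_perturb:
  assumes "poly_approx N B f" "\<And>t. t \<in> {0..1} \<Longrightarrow> norm (g t - f t) \<le> E * t ^ N" "0 \<le> E"
  shows "poly_approx N (B + E) g"
proof -
  obtain a where a: "\<And>m. norm (a m) \<le> B"
    "\<And>t. t \<in> {0..1} \<Longrightarrow> norm (f t - (\<Sum>m<N. a m * of_real t ^ m)) \<le> B * t ^ N"
    using assms(1) unfolding poly_approx_def by blast
  have "norm (g t - (\<Sum>m<N. a m * of_real t ^ m)) \<le> (B + E) * t ^ N" if "t \<in> {0..1}" for t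
    using norm_triangle_ineq[of "g t - f t" "f t - (\<Sum>m<N. a m * of_real t ^ m)"]
      a(2)[OF that] assms(2)[OF that] by (simp add: algebra_simps)
  moreover have "norm (a m) \<le> B + E" for m using a(1)[of m] assms(3) by simp
  ultimately show ?thesis unfolding poly_approx_def by blast
qed

lemma poly_approx_add:
  assumes "poly_approx N B1 f" "poly_approx N B2 g"
  shows "poly_approx N (B1 + B2) (\<lambda>t. f t + g t)"
proof -
  obtain a where a: "\<And>m. norm (a m) \<le> B1"
    "\<And>t. t \<in> {0..1} \<Longrightarrow> norm (f t - (\<Sum>m<N. a m * of_real t ^ m)) \<le> B1 * t ^ N"
    using assms(1) unfolding poly_approx_def by blast
  obtain b where b: "\<And>m. norm (b m) \<le> B2"
    "\<And>t. t \<in> {0..1} \<Longrightarrow> norm (g t - (\<Sum>m<N. b m * of_real t ^ m)) \<le> B2 * t ^ N"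
    using assms(2) unfolding poly_approx_def by blast
  have "norm (f t + g t - (\<Sum>m<N. (a m + b m) * of_real t ^ m)) \<le> (B1 + B2) * t ^ N" if "t \<in> {0..1}" for t
    using norm_triangle_ineq[of "f t - (\<Sum>m<N. a m * of_real t ^ m)" "g t - (\<Sum>m<N. b m * of_real t ^ m)"]
      a(2)[OF that] b(2)[OF that] by (simp add: algebra_simps sum.distrib)
  moreover have "norm (a m + b m) \<le> B1 + B2" for m
    using a(1)[of m] b(1)[of m] norm_triangle_ineq[of "a m" "b m"] by simp
  ultimately show ?thesis unfolding poly_approx_def
    by (intro exI[of _ "\<lambda>m. a m + b m"]) blast
qed

lemma poly_approx_sum:
  fixes n :: nat
  assumes "\<And>j. j < n \<Longrightarrow> poly_approx N (B j) (f j)"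
  shows "poly_approx N (\<Sum>j<n. B j) (\<lambda>t. \<Sum>j<n. f j t)"
  using assms
proof (induction n)
  case 0
  then show ?case by (simp add: poly_approx_const)
next
  case (Suc n)
  have "poly_approx N (\<Sum>j<n. B j) (\<lambda>t. \<Sum>j<n. f j t)" using Suc by simp
  from poly_approx_add[OF this Suc.prems[of n]] show ?case by simp
qed

lemma poly_approx_bound:
  assumes "poly_approx N B f" "t \<in> {0..1}"
  shows "norm (f t) \<le> (real N + 1) * B"
proof -
  obtain a where a: "\<And>m. norm (a m) \<le> B"
    "norm (f t - (\<Sum>m<N. a m * of_real t ^ m)) \<le> B * t ^ N"
    using assms unfolding poly_approx_def by blast
  have B: "0 \<le> B" by (rule poly_approx_nonneg[OF assms(1)])
  have "norm (\<Sum>m<N. a m * of_real t ^ m) \<le> (\<Sum>m<N. B * 1)"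
  proof (rule sum_norm_le)
    fix m
    have "norm (a m) * t ^ m \<le> B * 1"
      using assms(2) a(1)[of m] B by (intro mult_mono power_le_one) auto
    then show "norm (a m * of_real t ^ m) \<le> B * 1"
      using assms(2) by (simp add: norm_mult norm_power)
  qed
  moreover have "B * t ^ N \<le> B * 1"
    using assms(2) B by (intro mult_left_mono power_le_one) auto
  ultimately show ?thesis
    using a(2) norm_triangle_sub[of "f t" "\<Sum>m<N. a m * of_real t ^ m"] by (simp add: algebra_simps)
qed

text \<open>In the product of the two polynomials the monomials of degree at least \<open>N\<close> are part of the error.\<close>

lemma poly_approx_mult:
  assumes f: "poly_approx N B1 f" and g: "poly_approx N B2 g"
  shows "poly_approx N ((2 * real N + 2)\<^sup>2 * B1 * B2) (\<lambda>t. f t * g t)"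
proof -
  obtain a where a: "\<And>m. norm (a m) \<le> B1"
    "\<And>t. t \<in> {0..1} \<Longrightarrow> norm (f t - (\<Sum>m<N. a m * of_real t ^ m)) \<le> B1 * t ^ N"
    using f unfolding poly_approx_def by blast
  obtain b where b: "\<And>m. norm (b m) \<le> B2"
    "\<And>t. t \<in> {0..1} \<Longrightarrow> norm (g t - (\<Sum>m<N. b m * of_real t ^ m)) \<le> B2 * t ^ N"
    using g unfolding poly_approx_def by blast
  have B: "0 \<le> B1" "0 \<le> B2" using poly_approx_nonneg f g by blast+
  define p where "p t = (\<Sum>m<N. a m * of_real t ^ m)" for t :: real
  define q where "q t = (\<Sum>m<N. b m * of_real t ^ m)" for t :: real
  have paf: "poly_approx N B1 p" unfolding p_def using a(1) B by (intro poly_approx_poly) auto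
  (* Multiply the polynomials monomial by monomial. *)
  have mono: "poly_approx N (B1 * B2) (\<lambda>t. (a i * of_real t ^ i) * (b j * of_real t ^ j))" for i j
  proof (cases "i + j < N")
    case True
    have "(\<lambda>t. (a i * of_real t ^ i) * (b j * of_real t ^ j)) = (\<lambda>t::real. \<Sum>m<Suc (i + j). (if m = i + j then a i * b j else 0) * of_real t ^ m)"
      by (auto simp: fun_eq_iff power_add if_distrib[of "\<lambda>x. x * _"] cong: if_cong)
    moreover have "poly_approx N (B1 * B2) (\<lambda>t. \<Sum>m<Suc (i + j). (if m = i + j then a i * b j else 0) * of_real t ^ m)"
      using True B a b by (intro poly_approx_poly) (auto simp: norm_mult intro: mult_mono)
    ultimately show ?thesis by simp
  next
    case False
    have "norm ((a i * of_real t ^ i) * (b j * of_real t ^ j)) \<le> B1 * B2 * t ^ N" if "t \<in> {0..1}" for t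
    proof -
      have "norm ((a i * of_real t ^ i) * (b j * of_real t ^ j)) = norm (a i) * norm (b j) * t ^ (i + j)"
        using that by (simp add: norm_mult norm_power power_add)
      also have "\<dots> \<le> B1 * B2 * t ^ N"
        using that False a(1)[of i] b(1)[of j] B by (intro mult_mono power_decreasing) auto
      finally show ?thesis .
    qed
    then show ?thesis unfolding poly_approx_def using B by (intro exI[of _ "\<lambda>_. 0"]) auto
  qed
  have "poly_approx N (\<Sum>i<N. \<Sum>j<N. B1 * B2) (\<lambda>t. \<Sum>i<N. \<Sum>j<N. (a i * of_real t ^ i) * (b j * of_real t ^ j))"
    by (intro poly_approx_sum mono)
  also have "(\<lambda>t. \<Sum>i<N. \<Sum>j<N. (a i * of_real t ^ i) * (b j * of_real t ^ j)) = (\<lambda>t. p t * q t)"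
    by (simp add: p_def q_def sum_product)
  finally have pq: "poly_approx N (\<Sum>i<N. \<Sum>j<N. B1 * B2) (\<lambda>t. p t * q t)" .
  have err: "norm (f t * g t - p t * q t) \<le> (2 * (real N + 1) * B1 * B2) * t ^ N" if t: "t \<in> {0..1}" for t
  proof -
    have "f t * g t - p t * q t = (f t - p t) * g t + p t * (g t - q t)" by (simp add: algebra_simps)
    then have "norm (f t * g t - p t * q t) \<le> norm (f t - p t) * norm (g t) + norm (p t) * norm (g t - q t)"
      by (metis norm_mult norm_triangle_ineq)
    also have "\<dots> \<le> (B1 * t ^ N) * ((real N + 1) * B2) + ((real N + 1) * B1) * (B2 * t ^ N)"
      using a(2)[OF t] b(2)[OF t] poly_approx_bound[OF g t] poly_approx_bound[OF paf t] B t
      by (intro add_mono mult_mono) (auto simp: p_def q_def)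
    finally show ?thesis by (simp add: algebra_simps)
  qed
  have "poly_approx N ((\<Sum>i<N. \<Sum>j<N. B1 * B2) + 2 * (real N + 1) * B1 * B2) (\<lambda>t. f t * g t)"
    using B by (intro poly_approx_perturb[OF pq err]) auto
  moreover have "(\<Sum>i<N. \<Sum>j<N. B1 * B2) + 2 * (real N + 1) * B1 * B2 \<le> (2 * real N + 2)\<^sup>2 * B1 * B2"
  proof -
    have "(real N ^ 2 + 2 * (real N + 1)) * (B1 * B2) \<le> (2 * real N + 2)\<^sup>2 * (B1 * B2)"
      using B by (intro mult_right_mono) (auto simp: power2_eq_square algebra_simps)
    then show ?thesis by (simp add: power2_eq_square algebra_simps)
  qed
  ultimately show ?thesis by (rule poly_approx_mono)
qed

lemma poly_approx_power:
  assumes "poly_approx N B f"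
  shows "poly_approx N (((2 * real N + 2)\<^sup>2 * B) ^ j) (\<lambda>t. f t ^ j)"
proof (induction j)
  case 0
  then show ?case by (simp add: poly_approx_const)
next
  case (Suc j)
  from poly_approx_mult[OF assms Suc.IH] show ?case by simp
qed

text \<open>As \<open>u(t) = O(t)\<close>, the exponential series can be cut after \<open>N\<close> terms with an error \<open>O(t\<^sup>N)\<close>.\<close>

lemma poly_approx_iexp:
  assumes u: "poly_approx N B (\<lambda>t. of_real (u t))" and D: "\<And>t. t \<in> {0..1} \<Longrightarrow> \<bar>u t\<bar> \<le> D * t"
    and "N > 0"
  shows "poly_approx N ((\<Sum>j<N. (2 * real N + 2)\<^sup>2 * 1 * ((2 * real N + 2)\<^sup>2 * B) ^ j) + D ^ N) (\<lambda>t. exp (\<i> * of_real (u t)))"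
proof (rule poly_approx_perturb)
  show "poly_approx N (\<Sum>j<N. (2 * real N + 2)\<^sup>2 * 1 * ((2 * real N + 2)\<^sup>2 * B) ^ j)
      (\<lambda>t. \<Sum>j<N. (\<i> ^ j / fact j) * of_real (u t) ^ j)"
    by (intro poly_approx_sum poly_approx_mult poly_approx_const poly_approx_power u)
       (simp add: norm_divide norm_power fact_ge_1)
  have D0: "0 \<le> D" using D[of 1] by simp
  show "0 \<le> D ^ N" using D0 by simp
  fix t :: real assume t: "t \<in> {0..1}"
  obtain n where n: "N = Suc n" using \<open>N > 0\<close> by (cases N) auto
  have "norm (exp (\<i> * of_real (u t)) - (\<Sum>j<N. (\<i> ^ j / fact j) * of_real (u t) ^ j))
      \<le> \<bar>u t\<bar> ^ N / fact n"
    using Taylor_exp[of "\<i> * of_real (u t)" n]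
    by (simp add: n lessThan_Suc_atMost power_mult_distrib norm_mult norm_power)
  also have "\<dots> \<le> (D * t) ^ N / 1"
    using D[OF t] D0 t by (intro frac_le power_mono) (auto simp: fact_ge_1)
  finally show "norm (exp (\<i> * of_real (u t)) - (\<Sum>j<N. (\<i> ^ j / fact j) * of_real (u t) ^ j)) \<le> D ^ N * t ^ N"
    by (simp add: power_mult_distrib)
qed

text \<open>The positive part is not smooth, but its \<open>N\<close>th power behaves as if it were: if \<open>p\<close> changes sign between \<open>0\<close> and \<open>t\<close>, then
\<open>|p(t)| \<le> |p(t) - p(0)| = O(t)\<close>, so that replacing the power of the positive part by \<open>p\<^sup>N\<close> (when \<open>p(0) \<ge> 0\<close>) or by \<open>0\<close> (when \<open>p(0) < 0\<close>)
costs only \<open>O(t\<^sup>N)\<close>.\<close>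

lemma poly_approx_cutoff:
  fixes p :: "real \<Rightarrow> real"
  assumes p: "poly_approx N B (\<lambda>t. of_real (p t))" and D: "\<And>t. t \<in> {0..1} \<Longrightarrow> \<bar>p t - p 0\<bar> \<le> D * t"
  shows "poly_approx N (((2 * real N + 2)\<^sup>2 * B) ^ N + D ^ N) (\<lambda>t. of_real (max 0 (p t) ^ N))"
proof -
  have D0: "0 \<le> D" using D[of 1] by simp
  have B: "0 \<le> B" by (rule poly_approx_nonneg[OF p])
  show ?thesis
  proof (cases "p 0 \<ge> 0")
    case True
    have "norm (of_real (max 0 (p t) ^ N) - (of_real (p t) :: complex) ^ N) \<le> D ^ N * t ^ N" if t: "t \<in> {0..1}" for t
    proof (cases "p t \<ge> 0")
      case False
      have "norm (of_real (max 0 (p t) ^ N) - (of_real (p t) :: complex) ^ N) = \<bar>max 0 (p t) ^ N - p t ^ N\<bar>"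
        by (metis norm_of_real of_real_diff of_real_power)
      also have "\<dots> \<le> \<bar>p t\<bar> ^ N" using False by (cases "N = 0") (simp_all add: max_def zero_power power_abs)
      also have "\<dots> \<le> (D * t) ^ N" using D[OF t] True False by (intro power_mono) auto
      finally show ?thesis by (simp add: power_mult_distrib)
    qed (use D0 t in auto)
    then show ?thesis using D0 by (intro poly_approx_perturb[OF poly_approx_power[OF p]]) auto
  next
    case False
    have "norm (of_real (max 0 (p t) ^ N) - (0 :: complex)) \<le> (((2 * real N + 2)\<^sup>2 * B) ^ N + D ^ N) * t ^ N" if t: "t \<in> {0..1}" for t
    proof -
      have "max 0 (p t) \<le> D * t" using D[OF t] False D0 t by (auto simp: max_def)
      then have "max 0 (p t) ^ N \<le> (D * t) ^ N" by (intro power_mono) auto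
      moreover have "0 \<le> ((2 * real N + 2)\<^sup>2 * B) ^ N * t ^ N" using B t by auto
      moreover have "norm (of_real (max 0 (p t) ^ N) - (0 :: complex)) = max 0 (p t) ^ N"
        by (simp only: diff_zero norm_of_real) simp
      ultimately show ?thesis by (simp add: power_mult_distrib algebra_simps)
    qed
    then show ?thesis unfolding poly_approx_def using B D0 by (intro exI[of _ "\<lambda>_. 0"]) auto
  qed
qed

lemma alternating_binomial_Suc:
  fixes f :: "nat \<Rightarrow> complex"
  shows "(\<Sum>k\<le>Suc N. (- 1) ^ k * of_nat (Suc N choose k) * f k)
    = (\<Sum>k\<le>N. (- 1) ^ k * of_nat (N choose k) * f k) - (\<Sum>k\<le>N. (- 1) ^ k * of_nat (N choose k) * f (Suc k))"
proof -
  have "(\<Sum>k\<le>Suc N. (- 1) ^ k * of_nat (Suc N choose k) * f k)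
     = f 0 + (\<Sum>k\<le>N. (- 1) ^ Suc k * of_nat (Suc N choose Suc k) * f (Suc k))"
    by (subst sum.atMost_Suc_shift) simp
  also have "\<dots> = (f 0 + (\<Sum>k\<le>N. (- 1) ^ Suc k * of_nat (N choose Suc k) * f (Suc k)))
      - (\<Sum>k\<le>N. (- 1) ^ k * of_nat (N choose k) * f (Suc k))"
    by (simp add: algebra_simps sum.distrib sum_subtractf sum_negf)
  also have "f 0 + (\<Sum>k\<le>N. (- 1) ^ Suc k * of_nat (N choose Suc k) * f (Suc k))
      = (\<Sum>k\<le>Suc N. (- 1) ^ k * of_nat (N choose k) * f k)"
    by (subst sum.atMost_Suc_shift) simp
  also have "\<dots> = (\<Sum>k\<le>N. (- 1) ^ k * of_nat (N choose k) * f k)" by simp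
  finally show ?thesis .
qed

text \<open>An \<open>N\<close>th difference annihilates polynomials of degree below \<open>N\<close>: each difference lowers the degree.\<close>

lemma alternating_binomial_power:
  assumes "m < N"
  shows "(\<Sum>k\<le>N. (- 1) ^ k * of_nat (N choose k) * of_nat k ^ m) = (0 :: complex)"
  using assms
proof (induction N arbitrary: m)
  case (Suc N)
  have bin: "(of_nat (Suc k) :: complex) ^ m = of_nat k ^ m + (\<Sum>j<m. of_nat (m choose j) * of_nat k ^ j)" for k
    using binomial_ring[of "of_nat k :: complex" 1 m]
    by (simp add: add.commute lessThan_Suc_atMost[symmetric])
  have "(\<Sum>k\<le>Suc N. (- 1) ^ k * of_nat (Suc N choose k) * of_nat k ^ m)
    = - (\<Sum>k\<le>N. \<Sum>j<m. of_nat (m choose j) * ((- 1) ^ k * of_nat (N choose k) * (of_nat k :: complex) ^ j))"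
    unfolding alternating_binomial_Suc bin
    by (simp add: algebra_simps sum.distrib sum_distrib_left)
  also have "\<dots> = - (\<Sum>j<m. of_nat (m choose j) * (\<Sum>k\<le>N. (- 1) ^ k * of_nat (N choose k) * (of_nat k :: complex) ^ j))"
    by (subst sum.swap) (simp add: sum_distrib_left)
  also have "\<dots> = 0" using Suc by simp
  finally show ?case .
qed simp

lemma finite_difference_poly_approx:
  assumes f: "poly_approx N B f" and h: "0 \<le> h" "real N * h \<le> 1"
  shows "norm (\<Sum>k\<le>N. (- 1) ^ k * of_nat (N choose k) * f (real k * h)) \<le> 2 ^ N * B * (real N * h) ^ N"
proof -
  obtain a where a: "\<And>m. norm (a m) \<le> B"
    "\<And>t. t \<in> {0..1} \<Longrightarrow> norm (f t - (\<Sum>m<N. a m * of_real t ^ m)) \<le> B * t ^ N"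
    using f unfolding poly_approx_def by blast
  have B: "0 \<le> B" by (rule poly_approx_nonneg[OF f])
  have "(\<Sum>k\<le>N. (- 1) ^ k * of_nat (N choose k) * (\<Sum>m<N. a m * of_real (real k * h) ^ m))
    = (\<Sum>k\<le>N. \<Sum>m<N. (a m * of_real h ^ m) * ((- 1) ^ k * of_nat (N choose k) * of_nat k ^ m))"
    by (simp add: sum_distrib_left power_mult_distrib mult_ac)
  also have "\<dots> = (\<Sum>m<N. (a m * of_real h ^ m) * (\<Sum>k\<le>N. (- 1) ^ k * of_nat (N choose k) * of_nat k ^ m))"
    by (subst sum.swap) (simp add: sum_distrib_left)
  also have "\<dots> = 0" using alternating_binomial_power by simp
  finally have z: "(\<Sum>k\<le>N. (- 1) ^ k * of_nat (N choose k) * (\<Sum>m<N. a m * of_real (real k * h) ^ m)) = 0" .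
  have "(\<Sum>k\<le>N. (- 1) ^ k * of_nat (N choose k) * f (real k * h))
    = (\<Sum>k\<le>N. (- 1) ^ k * of_nat (N choose k) * (f (real k * h) - (\<Sum>m<N. a m * of_real (real k * h) ^ m)))"
    unfolding right_diff_distrib sum_subtractf z by simp
  also have "norm \<dots> \<le> (\<Sum>k\<le>N. of_nat (N choose k) * (B * (real N * h) ^ N))"
  proof (rule sum_norm_le)
    fix k assume "k \<in> {..N}"
    then have kh: "0 \<le> real k * h" "real k * h \<le> real N * h" using h by (auto intro: mult_right_mono)
    have "norm (f (real k * h) - (\<Sum>m<N. a m * of_real (real k * h) ^ m)) \<le> B * (real k * h) ^ N"
      using kh h by (intro a(2)) auto
    also have "\<dots> \<le> B * (real N * h) ^ N" using kh B by (intro mult_left_mono power_mono) auto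
    finally show "norm ((- 1) ^ k * of_nat (N choose k) * (f (real k * h) - (\<Sum>m<N. a m * of_real (real k * h) ^ m)))
        \<le> of_nat (N choose k) * (B * (real N * h) ^ N)"
      by (simp add: norm_mult norm_power mult_left_mono)
  qed
  also have "\<dots> = 2 ^ N * B * (real N * h) ^ N"
    by (simp add: sum_distrib_right[symmetric] choose_row_sum flip: of_nat_sum)
  finally show ?thesis .
qed

section \<open>Oscillation along one line\<close>

lemma norm_iexp_diff_le:
  fixes a b :: real
  shows "norm (exp (\<i> * of_real a) - exp (\<i> * of_real b)) \<le> \<bar>a - b\<bar>"
proof -
  have "exp (\<i> * of_real a) - exp (\<i> * of_real b) = exp (\<i> * of_real b) * (exp (\<i> * of_real (a - b)) - 1)"
    by (simp add: algebra_simps flip: exp_add)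
  then have "norm (exp (\<i> * of_real a) - exp (\<i> * of_real b)) = norm (exp (\<i> * of_real (a - b)) - 1)"
    by (simp add: norm_mult)
  also have "\<dots> = 2 * \<bar>sin ((a - b) / 2)\<bar>" by (rule dist_exp_i_1)
  also have "\<dots> \<le> \<bar>a - b\<bar>" using abs_sin_x_le_abs_x[of "(a - b) / 2"] by simp
  finally show ?thesis .
qed

lemma finite_difference_bound:
  assumes "\<And>k. k \<le> N \<Longrightarrow> norm (f k) \<le> E"
  shows "norm (\<Sum>k\<le>N. (- 1) ^ k * of_nat (N choose k) * (f k :: complex)) \<le> 2 ^ N * E"
proof -
  have "norm (\<Sum>k\<le>N. (- 1) ^ k * of_nat (N choose k) * f k) \<le> (\<Sum>k\<le>N. of_nat (N choose k) * E)"
    using assms by (intro sum_norm_le) (simp add: norm_mult norm_power mult_left_mono)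
  also have "\<dots> = 2 ^ N * E"
    by (simp add: sum_distrib_right[symmetric] choose_row_sum flip: of_nat_sum)
  finally show ?thesis .
qed

text \<open>The constant of \<open>line_difference\<close>. \<open>Ce\<close> and \<open>Cc\<close> are the approximation constants of the exponential and of the cutoff, and
the products by \<open>q\<close> come from \<open>poly_approx_mult\<close>.\<close>

definition line_const :: "nat \<Rightarrow> nat \<Rightarrow> real \<Rightarrow> real" where
  "line_const K N B =
    (let q = (2 * real N + 2)\<^sup>2;
         Ce = (\<Sum>j<N. q * 1 * (q * B) ^ j) + ((real K + 1) * B) ^ N;
         Cc = (q * B) ^ N + B ^ N
     in 2 ^ N * (q * (q * (q * 1 * Ce) * 1) * Cc + 2) * real N ^ N)"

text \<open>The estimate for one line of a cell. \<open>P\<close> and \<open>W\<close> list the derivatives of the rescaled phase and amplitude along the line,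
\<open>\<xi>\<close> is the frequency that is removed from the phase, and \<open>p\<close> is the polynomial whose positive part is the base of the cutoff.
Replacing phase and amplitude by their Taylor polynomials makes the factor of \<open>e\<^bsup>i\<xi>t\<^esup>\<close> a function of class \<open>poly_approx\<close>, whose \<open>N\<close>th
difference is \<open>O(h\<^sup>N)\<close>; the Taylor remainders are small enough to be estimated by their size, with no use of
cancellation.\<close>

lemma line_difference:
  fixes P :: "nat \<Rightarrow> real \<Rightarrow> real" and W :: "nat \<Rightarrow> real \<Rightarrow> complex" and B b :: real
  assumes "0 < K" "Suc K \<le> N" "0 < b" "b \<le> 1" "0 \<le> B"
    and dP: "\<And>m s. m < K \<Longrightarrow> s \<in> {0..1} \<Longrightarrow> (P m has_real_derivative P (Suc m) s) (at s)"
    and dW: "\<And>m s. m < K \<Longrightarrow> s \<in> {0..1} \<Longrightarrow> (W m has_vector_derivative W (Suc m) s) (at s)"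
    and P1: "\<bar>P 1 0 - \<xi>\<bar> \<le> B" and P2: "\<And>m. 2 \<le> m \<Longrightarrow> m \<le> K \<Longrightarrow> \<bar>P m 0\<bar> \<le> B"
    and PK: "\<And>s. s \<in> {0..1} \<Longrightarrow> \<bar>P K s - P K 0\<bar> \<le> r1 * s powr b"
    and W: "\<And>m s. m < K \<Longrightarrow> s \<in> {0..1} \<Longrightarrow> norm (W m s) \<le> A"
    and WK: "\<And>s. s \<in> {0..1} \<Longrightarrow> norm (W K s) \<le> A * r2"
    and p: "poly_approx N B (\<lambda>t. of_real (p t))" "\<And>t. t \<in> {0..1} \<Longrightarrow> \<bar>p t - p 0\<bar> \<le> B * t"
      "\<And>t. t \<in> {0..1} \<Longrightarrow> p t \<le> 1"
    and r: "0 \<le> r1" "0 \<le> r2" and h: "0 < h" "real N * h \<le> 1"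
  shows "norm (\<Sum>k\<le>N. (- 1) ^ k * of_nat (N choose k) *
        (exp (\<i> * of_real (P 0 (real k * h) - \<xi> * (real k * h))) * W 0 (real k * h)
          * of_real (max 0 (p (real k * h)) ^ N)))
       \<le> line_const K N B * A * (h ^ N + r1 * h powr (real K + b) + r2 * h ^ K)"
proof -
  define q where "q = (2 * real N + 2)\<^sup>2"
  define Ce where "Ce = (\<Sum>j<N. q * 1 * (q * B) ^ j) + ((real K + 1) * B) ^ N"
  define Cc where "Cc = (q * B) ^ N + B ^ N"
  define C0 where "C0 = q * (q * (q * 1 * Ce) * 1) * Cc"
  have C_def: "line_const K N B = 2 ^ N * (C0 + 2) * real N ^ N"
    by (simp only: line_const_def Let_def C0_def Cc_def Ce_def q_def)
  have N: "N > 0" "real N \<ge> 1" using assms(1,2) by auto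
  have q0: "q \<ge> 0" by (simp add: q_def)
  have C00: "C0 \<ge> 0" using assms(5) q0 by (auto simp: C0_def Ce_def Cc_def intro!: mult_nonneg_nonneg add_nonneg_nonneg sum_nonneg)
  have A0: "A \<ge> 0" using order_trans[OF norm_ge_zero W[of 0 0]] assms(1) by simp
  define c where "c m = (if m = 0 then 0 else if m = 1 then P 1 0 - \<xi> else P m 0 / fact m)" for m
  have c: "\<bar>c m\<bar> \<le> B" if "m < Suc K" for m
  proof -
    have "\<bar>P m 0\<bar> / fact m \<le> B / 1" if "2 \<le> m" "m \<le> K"
      using P2[OF that] by (intro frac_le) (auto simp: fact_ge_1 assms(5))
    then show ?thesis using that P1 assms(5) by (auto simp: c_def)
  qed
  define u where "u t = (\<Sum>m<Suc K. c m * t ^ m)" for t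
  have u_pa: "poly_approx N B (\<lambda>t. of_real (u t))"
    using poly_approx_poly[OF assms(2), of "\<lambda>m. of_real (c m)" B] c assms(5)
    by (simp add: u_def del: sum.lessThan_Suc)
  have u_le: "\<bar>u t\<bar> \<le> ((real K + 1) * B) * t" if t: "t \<in> {0..1}" for t
  proof -
    have "\<bar>u t\<bar> \<le> (\<Sum>m<Suc K. B * t)"
      unfolding u_def
    proof (rule order_trans[OF sum_abs], rule sum_mono)
      fix m assume m: "m \<in> {..<Suc K}"
      show "\<bar>c m * t ^ m\<bar> \<le> B * t"
      proof (cases "m = 0")
        case False
        then have "t ^ m \<le> t ^ 1" using t by (intro power_decreasing) auto
        then show ?thesis using c[of m] m t assms(5) by (auto simp: abs_mult intro!: mult_mono)
      qed (use t assms(5) in \<open>simp add: c_def\<close>)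
    qed
    then show ?thesis by (simp add: algebra_simps)
  qed
  define Q where "Q t = (\<Sum>m<K. (W m 0 / fact m) * of_real t ^ m)" for t :: real
  have Q_pa: "poly_approx N A Q"
    unfolding Q_def
  proof (rule poly_approx_poly)
    fix m assume "m < K"
    then have "norm (W m 0) / fact m \<le> A / 1"
      using W[of m 0] by (intro frac_le) (auto simp: fact_ge_1 A0)
    then show "norm (W m 0 / fact m) \<le> A" by (simp add: norm_divide)
  qed (use assms(2) A0 in auto)
  define s where "s t = exp (\<i> * of_real (P 0 0)) * exp (\<i> * of_real (u t)) * Q t * of_real (max 0 (p t) ^ N)" for t
  have Ce: "poly_approx N Ce (\<lambda>t. exp (\<i> * of_real (u t)))"
    unfolding Ce_def q_def by (rule poly_approx_iexp[OF u_pa u_le N(1)])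
  have Cc: "poly_approx N Cc (\<lambda>t. of_real (max 0 (p t) ^ N))"
    unfolding Cc_def q_def by (rule poly_approx_cutoff[OF p(1,2)])
  have "poly_approx N (q * (q * (q * 1 * Ce) * A) * Cc) s"
    unfolding q_def s_def
    by (intro poly_approx_mult Ce[unfolded q_def] Cc Q_pa poly_approx_const) simp
  then have s_pa: "poly_approx N (C0 * A) s" by (simp add: C0_def mult_ac)
  have smooth: "norm (\<Sum>k\<le>N. (- 1) ^ k * of_nat (N choose k) * s (real k * h)) \<le> 2 ^ N * (C0 * A) * (real N * h) ^ N"
    using h by (intro finite_difference_poly_approx[OF s_pa]) auto
  define g where "g t = exp (\<i> * of_real (P 0 t - \<xi> * t)) * W 0 t * of_real (max 0 (p t) ^ N)" for t
  \<comment> \<open>The size of the two Taylor remainders at the far end of the segment.\<close>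
  define E where "E = A * (r1 * (real N * h) powr b * (real N * h) ^ K) + 2 * (A * r2) * (real N * h) ^ K"
  have E0: "E \<ge> 0" using A0 r h by (simp add: E_def)
  have err: "norm (g t - s t) \<le> E" if t: "t \<in> {0..1}" "t \<le> real N * h" for t
  proof -
    have ch: "0 \<le> max 0 (p t) ^ N" "max 0 (p t) ^ N \<le> 1"
      using p(3)[OF t(1)] by (auto intro!: power_le_one)
    \<comment> \<open>The Taylor polynomial without its constant term and with the frequency \<open>\<xi>\<close> removed from its linear term is \<open>u\<close>.\<close>
    have ut: "(\<Sum>m\<le>K. P m 0 / fact m * t ^ m) = P 0 0 + \<xi> * t + u t"
    proof -
      have "(\<Sum>m\<le>K. P m 0 / fact m * t ^ m) = (\<Sum>m<Suc K. c m * t ^ m + (if m = 0 then P 0 0 else 0) + (if m = 1 then \<xi> * t else 0))"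
        unfolding lessThan_Suc_atMost by (intro sum.cong) (auto simp: c_def algebra_simps)
      also have "\<dots> = u t + P 0 0 + \<xi> * t"
        unfolding sum.distrib u_def using assms(1) by (simp del: sum.lessThan_Suc)
      finally show ?thesis by simp
    qed
    have "\<bar>(P 0 t - \<xi> * t) - (P 0 0 + u t)\<bar> \<le> r1 * t powr b * t ^ K"
      using taylor_holder[of K t P r1 b, OF assms(1) t(1) dP PK r(1) assms(3)] unfolding ut by (simp add: algebra_simps)
    also have "\<dots> \<le> r1 * (real N * h) powr b * (real N * h) ^ K"
      using t r assms(3) by (intro mult_mono powr_mono2 power_mono) auto
    finally have ph: "\<bar>(P 0 t - \<xi> * t) - (P 0 0 + u t)\<bar> \<le> r1 * (real N * h) powr b * (real N * h) ^ K" .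
    have "norm (W 0 t - Q t) \<le> 2 * (A * r2) * t ^ K"
      unfolding Q_def by (rule taylor_complex[OF assms(1) t(1) dW WK])
    also have "\<dots> \<le> 2 * (A * r2) * (real N * h) ^ K"
      using t A0 r by (intro mult_left_mono power_mono) auto
    finally have am: "norm (W 0 t - Q t) \<le> 2 * (A * r2) * (real N * h) ^ K" .
    define e1 where "e1 = exp (\<i> * of_real (P 0 t - \<xi> * t))"
    define e2 where "e2 = exp (\<i> * of_real (P 0 0 + u t))"
    have e: "norm (e1 - e2) \<le> r1 * (real N * h) powr b * (real N * h) ^ K" "norm e2 = 1"
      using order_trans[OF norm_iexp_diff_le ph] by (auto simp: e1_def e2_def simp del: of_real_add of_real_diff)
    have "g t - s t = ((e1 - e2) * W 0 t + e2 * (W 0 t - Q t)) * of_real (max 0 (p t) ^ N)"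
      by (simp add: g_def s_def e1_def e2_def ring_distribs exp_add[symmetric] del: of_real_power)
    also have "norm \<dots> = norm ((e1 - e2) * W 0 t + e2 * (W 0 t - Q t)) * (max 0 (p t) ^ N)"
      using ch by (simp only: norm_mult norm_of_real abs_of_nonneg)
    also have "\<dots> \<le> norm ((e1 - e2) * W 0 t + e2 * (W 0 t - Q t)) * 1"
      using ch by (intro mult_left_mono) auto
    also have "\<dots> \<le> norm (e1 - e2) * norm (W 0 t) + norm e2 * norm (W 0 t - Q t)"
      using norm_triangle_ineq by (metis mult.right_neutral norm_mult)
    also have "\<dots> \<le> (r1 * (real N * h) powr b * (real N * h) ^ K) * A + 1 * (2 * (A * r2) * (real N * h) ^ K)"
      using e am W[of 0 t] t assms(1) A0 r h by (intro add_mono mult_mono) auto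
    also have "\<dots> = E" by (simp add: E_def)
    finally show ?thesis .
  qed
  have rough: "norm (\<Sum>k\<le>N. (- 1) ^ k * of_nat (N choose k) * (g (real k * h) - s (real k * h))) \<le> 2 ^ N * E"
  proof (rule finite_difference_bound)
    fix k assume "k \<le> N"
    then have k: "real k * h \<le> real N * h" using h by (intro mult_right_mono) auto
    have "0 \<le> real k * h" using h by simp
    moreover have "real k * h \<le> 1" using k h(2) by linarith
    ultimately have "real k * h \<in> {0..1}" unfolding atLeastAtMost_iff by blast
    from err[OF this k] show "norm (g (real k * h) - s (real k * h)) \<le> E" .
  qed
  have "norm (\<Sum>k\<le>N. (- 1) ^ k * of_nat (N choose k) * g (real k * h))
     = norm ((\<Sum>k\<le>N. (- 1) ^ k * of_nat (N choose k) * s (real k * h))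
          + (\<Sum>k\<le>N. (- 1) ^ k * of_nat (N choose k) * (g (real k * h) - s (real k * h))))"
    by (simp add: right_diff_distrib sum_subtractf)
  also have "\<dots> \<le> 2 ^ N * (C0 * A) * (real N * h) ^ N + 2 ^ N * E"
    by (rule order_trans[OF norm_triangle_ineq add_mono[OF smooth rough]])
  also have "\<dots> \<le> line_const K N B * A * (h ^ N + r1 * h powr (real K + b) + r2 * h ^ K)"
  proof -
    have nK: "real N ^ K \<le> real N ^ N" using assms(2) N by (intro power_increasing) auto
    have "real N powr b * real N ^ K \<le> real N ^ 1 * real N ^ K"
      using N assms(4) powr_mono[of b 1 "real N"] by (intro mult_right_mono) auto
    also have "\<dots> = real N ^ Suc K" by simp
    also have "\<dots> \<le> real N ^ N" using assms(2) N by (intro power_increasing) auto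
    finally have nb: "real N powr b * real N ^ K \<le> real N ^ N" .
    have "r1 * (real N * h) powr b * (real N * h) ^ K = (real N powr b * real N ^ K) * (r1 * h powr (real K + b))"
      using h by (simp add: powr_mult power_mult_distrib powr_add powr_realpow)
    also have "\<dots> \<le> real N ^ N * (r1 * h powr (real K + b))"
      using nb r by (intro mult_right_mono) auto
    finally have t1: "r1 * (real N * h) powr b * (real N * h) ^ K \<le> real N ^ N * (r1 * h powr (real K + b))" .
    have t2: "r2 * (real N * h) ^ K \<le> real N ^ N * (r2 * h ^ K)"
      using mult_right_mono[OF nK, of "r2 * h ^ K"] r h by (simp add: power_mult_distrib mult_ac)
    define X where "X = real N ^ N * h ^ N"
    define Y where "Y = real N ^ N * (r1 * h powr (real K + b))"
    define Z where "Z = real N ^ N * (r2 * h ^ K)"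
    have XYZ: "X \<ge> 0" "Y \<ge> 0" "Z \<ge> 0" using h r by (auto simp: X_def Y_def Z_def)
    have "E \<le> A * Y + 2 * A * Z"
      unfolding E_def Y_def Z_def
      using mult_left_mono[OF t1 A0] mult_left_mono[OF t2, of "2 * A"] A0 by (simp add: mult_ac)
    then have "C0 * A * X + E \<le> C0 * A * X + (A * Y + 2 * A * Z)" by simp
    also have "\<dots> \<le> (C0 + 2) * A * (X + Y + Z)"
      using C00 A0 XYZ by (simp add: algebra_simps)
    finally have "2 ^ N * (C0 * A * X + E) \<le> 2 ^ N * ((C0 + 2) * A * (X + Y + Z))" by (intro mult_left_mono) auto
    then show ?thesis by (simp add: C_def X_def Y_def Z_def power_mult_distrib algebra_simps)
  qed
  finally show ?thesis by (simp only: g_def)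
qed

lemma lborel_translate:
  fixes f :: "'a::euclidean_space \<Rightarrow> 'b::{banach, second_countable_topology}"
  assumes "f \<in> borel_measurable borel"
  shows "integrable lborel (\<lambda>x. f (x + c)) \<longleftrightarrow> integrable lborel f"
    and "(LINT x|lborel. f (x + c)) = (LINT x|lborel. f x)"
proof -
  have "integrable lborel f \<longleftrightarrow> integrable (distr lborel borel ((+) c)) f" by (simp add: lborel_distr_plus)
  also have "\<dots> \<longleftrightarrow> integrable lborel (\<lambda>x. f (c + x))" using assms by (intro integrable_distr_eq) auto
  finally show "integrable lborel (\<lambda>x. f (x + c)) \<longleftrightarrow> integrable lborel f" by (simp add: add.commute)
  have "(LINT x|lborel. f x) = (LINT x|distr lborel borel ((+) c). f x)" by (simp add: lborel_distr_plus)
  also have "\<dots> = (LINT x|lborel. f (c + x))" using assms by (intro integral_distr) auto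
  finally show "(LINT x|lborel. f (x + c)) = (LINT x|lborel. f x)" by (simp add: add.commute)
qed

text \<open>The step \<open>h\<close> is half a period of \<open>e\<^bsup>i\<xi>t\<^esup>\<close>, so that \<open>e\<^bsup>-i\<xi>kh\<^esup> = (-1)\<^sup>k\<close>. The \<open>N\<close>th difference of \<open>e\<^bsup>-i\<xi>t\<^esup> F\<close> is therefore a sum of translates
of \<open>F\<close> with binomial coefficients as weights and no signs, and its integral is \<open>2\<^sup>N\<close> times the integral of \<open>F\<close>.\<close>

lemma oscillation_by_differences:
  fixes F :: "real ^ 'n::finite \<Rightarrow> complex"
  assumes F: "F \<in> borel_measurable borel" "integrable lborel F" and \<xi>: "\<bar>\<xi>\<bar> * h = pi"
    and bound: "\<And>z. z \<in> cball 0 2 \<Longrightarrow> norm (\<Sum>k\<le>N. (- 1) ^ k * of_nat (N choose k) *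
        (exp (- \<i> * of_real (\<xi> * (real k * h))) * F (z + (real k * h) *\<^sub>R axis i 1))) \<le> E"
    and zero: "\<And>z k. z \<notin> cball 0 2 \<Longrightarrow> k \<le> N \<Longrightarrow> F (z + (real k * h) *\<^sub>R axis i 1) = 0"
  shows "norm (LINT z|lborel. F z) \<le> E * measure lborel (cball (0 :: real ^ 'n) 2)"
proof -
  define T where "T z = (\<Sum>k\<le>N. of_nat (N choose k) * F (z + (real k * h) *\<^sub>R axis i 1))" for z
  have e: "exp (- \<i> * of_real (\<xi> * (real k * h))) = (- 1) ^ k" for k
  proof -
    consider "\<xi> * h = pi" | "\<xi> * h = - pi" using \<xi> by (auto simp: abs_if split: if_splits)
    then have "exp (- \<i> * of_real (\<xi> * h)) = - 1"
      by cases (simp_all add: exp_minus del: of_real_mult)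
    moreover have "exp (- \<i> * of_real (\<xi> * (real k * h))) = exp (- \<i> * of_real (\<xi> * h)) ^ k"
      by (simp add: exp_of_nat_mult[symmetric] mult_ac)
    ultimately show ?thesis by simp
  qed
  have "T z = (\<Sum>k\<le>N. (- 1) ^ k * of_nat (N choose k) *
        (exp (- \<i> * of_real (\<xi> * (real k * h))) * F (z + (real k * h) *\<^sub>R axis i 1)))" for z
    unfolding T_def e by (intro sum.cong) (auto simp: power_mult_distrib[symmetric])
  then have b1: "norm (T z) \<le> E" if "z \<in> cball 0 2" for z using bound[OF that] by simp
  have b2: "T z = 0" if "z \<notin> cball 0 2" for z using zero[OF that] by (simp add: T_def)
  have int: "integrable lborel (\<lambda>z. of_nat (N choose k) * F (z + (real k * h) *\<^sub>R axis i 1))" for k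
    using F lborel_translate(1)[OF F(1)] by simp
  have "(LINT z|lborel. T z) = (\<Sum>k\<le>N. of_nat (N choose k) * (LINT z|lborel. F z))"
    unfolding T_def using int lborel_translate(2)[OF F(1)] by (subst Bochner_Integration.integral_sum) auto
  also have "\<dots> = 2 ^ N * (LINT z|lborel. F z)"
    by (simp add: sum_distrib_right[symmetric] choose_row_sum flip: of_nat_sum)
  finally have "2 ^ N * norm (LINT z|lborel. F z) = norm (LINT z|lborel. T z)"
    by (simp add: norm_mult norm_power)
  also have "\<dots> \<le> (LINT z|lborel. norm (T z))" by (rule integral_norm_bound)
  also have "\<dots> \<le> (LINT z|lborel. E * indicator (cball (0 :: real ^ 'n) 2) z)"
  proof (rule integral_mono)
    show "integrable lborel (\<lambda>z. norm (T z))" unfolding T_def using int by (intro integrable_norm Bochner_Integration.integrable_sum)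
    show "integrable lborel (\<lambda>z. E * indicator (cball (0 :: real ^ 'n) 2) z)"
      using emeasure_lborel_cball_finite[of "0 :: real ^ 'n" 2]
      by (intro integrable_mult_right integrable_real_indicator) auto
    show "norm (T z) \<le> E * indicator (cball 0 2) z" for z
      using b1[of z] b2[of z] by (auto simp: indicator_def)
  qed
  also have "\<dots> = E * measure lborel (cball (0 :: real ^ 'n) 2)" by simp
  finally have "2 ^ N * norm (LINT z|lborel. F z) \<le> E * measure lborel (cball (0 :: real ^ 'n) 2)" .
  moreover have "norm (LINT z|lborel. F z) \<le> 2 ^ N * norm (LINT z|lborel. F z)"
    using mult_right_mono[of 1 "2 ^ N" "norm (LINT z|lborel. F z)"] by simp
  ultimately show ?thesis by linarith
qed

section \<open>One cell of the partition of unity\<close>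

lemma Ck_on_has_partial_power:
  assumes "Ck_on K S f" "m < K" "x \<in> S"
  shows "has_partial i ((partial i ^^ m) f) x"
proof -
  have "Ck_on (m + Suc 0) S f" by (rule Ck_on_mono[OF assms(1)]) (use assms(2) in simp)
  then have "Ck_on (Suc 0) S (foldr partial (replicate m i) f)"
    by (intro Ck_on_foldr_partial) simp
  then show ?thesis using assms(3) by simp
qed

text \<open>What the argument uses of the phase and of the amplitude: only pure derivatives appear, except for the Lipschitz
bound on the gradient, and the Hoelder condition is imposed along the coordinate axes. The condition \<open>K + b \<ge> 2\<close> says that the
phase is at least \<open>C\<^bsup>1,1\<^esup>\<close>.\<close>

locale stationary_phase_data =
  fixes \<Phi> :: "real ^ 'n::finite \<Rightarrow> real" and \<psi> :: "real ^ 'n \<Rightarrow> complex"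
    and K :: nat and b P A eps :: real
  assumes K: "0 < K" and b: "0 < b" "b \<le> 1" and Kb: "2 \<le> real K + b" and eps: "0 < eps" "eps < 1"
    and Phi_Ck: "Ck_on K (ball 0 1) \<Phi>"
    and Phi_bound: "\<And>i m x. 2 \<le> m \<Longrightarrow> m \<le> K \<Longrightarrow> norm x < 1 \<Longrightarrow> \<bar>(partial i ^^ m) \<Phi> x\<bar> \<le> P"
    and Phi_holder: "\<And>i x s. 0 \<le> s \<Longrightarrow> s \<le> 1 \<Longrightarrow> norm x < 1 \<Longrightarrow> norm (x + s *\<^sub>R axis i 1) < 1 \<Longrightarrow>
        \<bar>(partial i ^^ K) \<Phi> (x + s *\<^sub>R axis i 1) - (partial i ^^ K) \<Phi> x\<bar> \<le> P * s powr b"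
    and Phi_lipschitz: "\<And>i x y. norm x < 1 \<Longrightarrow> norm y < 1 \<Longrightarrow>
        \<bar>partial i \<Phi> x - partial i \<Phi> y\<bar> \<le> real CARD('n) * P * norm (x - y)"
    and psi_Ck: "Ck_on K UNIV \<psi>"
    and psi_bound: "\<And>i m x. m \<le> K \<Longrightarrow> norm ((partial i ^^ m) \<psi> x) \<le> A"
    and psi_support: "\<And>x. 1 - eps \<le> norm x \<Longrightarrow> \<psi> x = 0"
begin

definition integrand :: "real \<Rightarrow> real ^ 'n \<Rightarrow> complex" where
  "integrand l x = exp (\<i> * of_real (l * \<Phi> x)) * \<psi> x"

text \<open>The integrand on the cell of size \<open>\<delta>\<close> around \<open>y\<close>, rescaled to the unit ball. The power \<open>2 K\<close> makes the cutoff smooth enough for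
differences of order \<open>2 K\<close>.\<close>

definition cell :: "real \<Rightarrow> real \<Rightarrow> real ^ 'n \<Rightarrow> real ^ 'n \<Rightarrow> complex" where
  "cell l \<delta> y z = integrand l (y + \<delta> *\<^sub>R z) * of_real (max 0 (1 - (norm z)\<^sup>2) ^ (2 * K))"

lemma A_nonneg: "0 \<le> A"
  using order_trans[OF norm_ge_zero psi_bound[of 0]] by simp

lemma P_nonneg: "0 \<le> P"
proof -
  have "0 \<le> real CARD('n) * P * norm (0 - (1 / 2) *\<^sub>R axis i 1 :: real ^ 'n)" for i :: 'n
    by (rule order_trans[OF abs_ge_zero Phi_lipschitz[of 0 "(1 / 2) *\<^sub>R axis i 1" i]]) auto
  then show ?thesis by (simp add: zero_le_mult_iff)
qed

lemma norm_integrand_le: "norm (integrand l x) \<le> A"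
  using psi_bound[of 0] by (simp add: integrand_def norm_mult)

lemma integrand_eq_0: "1 - eps \<le> norm x \<Longrightarrow> integrand l x = 0"
  by (simp add: integrand_def psi_support)

lemma continuous_on_integrand: "continuous_on UNIV (integrand l)"
proof -
  let ?Z = "- cball 0 (1 - eps) :: (real ^ 'n) set"
  have "continuous_on (ball 0 1) (integrand l)"
    unfolding integrand_def
    using Ck_on_imp_continuous_on[OF Phi_Ck] continuous_on_subset[OF Ck_on_imp_continuous_on[OF psi_Ck]]
    by (intro continuous_intros) auto
  moreover have "continuous_on ?Z (integrand l)"
    by (rule continuous_on_eq[OF continuous_on_const[of ?Z 0]]) (auto simp: integrand_eq_0)
  ultimately have "continuous_on (ball 0 1 \<union> ?Z) (integrand l)"
    by (intro continuous_on_open_Un) auto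
  moreover have "ball 0 1 \<union> ?Z = UNIV" using eps by auto
  ultimately show ?thesis by simp
qed

lemma continuous_on_cell: "continuous_on UNIV (cell l \<delta> y)"
  unfolding cell_def
  by (intro continuous_intros continuous_on_compose2[OF continuous_on_integrand]) auto

lemma cutoff_bounds:
  fixes z :: "real ^ 'n"
  shows "0 \<le> max 0 (1 - (norm z)\<^sup>2) ^ (2 * K)" "max 0 (1 - (norm z)\<^sup>2) ^ (2 * K) \<le> 1"
    "norm z \<ge> 1 \<Longrightarrow> max 0 (1 - (norm z)\<^sup>2) ^ (2 * K) = 0"
proof -
  assume "norm z \<ge> 1"
  then have "1 \<le> (norm z)\<^sup>2" by (rule one_le_power)
  then show "max 0 (1 - (norm z)\<^sup>2) ^ (2 * K) = 0" using K by (simp add: max_def)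
qed (auto intro!: power_le_one)

lemma cell_eq_0: "norm z \<ge> 1 \<Longrightarrow> cell l \<delta> y z = 0"
  using cutoff_bounds(3)[of z] by (simp add: cell_def)

lemma norm_cell_le: "norm (cell l \<delta> y z) \<le> A"
proof -
  have "norm (cell l \<delta> y z) = norm (integrand l (y + \<delta> *\<^sub>R z)) * max 0 (1 - (norm z)\<^sup>2) ^ (2 * K)"
    using cutoff_bounds(1)[of z] by (simp add: cell_def norm_mult del: of_real_power)
  also have "\<dots> \<le> A * 1"
    using cutoff_bounds[of z] norm_integrand_le A_nonneg by (intro mult_mono) auto
  finally show ?thesis by simp
qed

lemma measurable_cell: "cell l \<delta> y \<in> borel_measurable borel"
  using continuous_on_cell by (rule borel_measurable_continuous_onI)

lemma integrable_cell: "integrable lborel (cell l \<delta> y)"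
proof -
  have "integrable lborel (\<lambda>z. indicator (cball 0 1) z *\<^sub>R cell l \<delta> y z)"
    by (intro borel_integrable_compact continuous_on_subset[OF continuous_on_cell]) auto
  moreover have "(\<lambda>z. indicator (cball 0 1) z *\<^sub>R cell l \<delta> y z) = cell l \<delta> y"
    using cell_eq_0 by (auto simp: fun_eq_iff indicator_def)
  ultimately show ?thesis by simp
qed

lemma cell_trivial_bound: "norm (LINT z|lborel. cell l \<delta> y z) \<le> A * measure lborel (cball (0 :: real ^ 'n) 2)"
proof -
  have "norm (LINT z|lborel. cell l \<delta> y z) \<le> (LINT z|lborel. norm (cell l \<delta> y z))"
    by (rule integral_norm_bound)
  also have "\<dots> \<le> (LINT z|lborel. A * indicator (cball (0 :: real ^ 'n) 2) z)"
  proof (rule integral_mono)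
    show "integrable lborel (\<lambda>z. norm (cell l \<delta> y z))" using integrable_cell by (rule integrable_norm)
    show "integrable lborel (\<lambda>z. A * indicator (cball (0 :: real ^ 'n) 2) z)"
      using emeasure_lborel_cball_finite[of "0 :: real ^ 'n" 2]
      by (intro integrable_mult_right integrable_real_indicator) auto
    show "norm (cell l \<delta> y z) \<le> A * indicator (cball 0 2) z" for z
      using norm_cell_le cell_eq_0[of z] by (auto simp: indicator_def)
  qed
  also have "\<dots> = A * measure lborel (cball (0 :: real ^ 'n) 2)" by simp
  finally show ?thesis .
qed

lemma cell_outside: "1 - eps + \<delta> \<le> norm y \<Longrightarrow> 0 \<le> \<delta> \<Longrightarrow> cell l \<delta> y z = 0"
proof (cases "norm z \<ge> 1")
  case False
  assume "1 - eps + \<delta> \<le> norm y" "0 \<le> \<delta>"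
  moreover have "norm y - norm (\<delta> *\<^sub>R z) \<le> norm (y + \<delta> *\<^sub>R z)" by (rule norm_diff_ineq)
  moreover have "norm (\<delta> *\<^sub>R z) \<le> \<delta> * 1" using False \<open>0 \<le> \<delta>\<close> by (simp add: mult_left_le)
  ultimately show ?thesis by (simp add: cell_def integrand_eq_0)
qed (rule cell_eq_0)

end

lemma has_vector_derivative_scaled_line:
  fixes f :: "real ^ 'n::finite \<Rightarrow> 'b::real_normed_vector"
  assumes "has_partial i f (x + (d * s) *\<^sub>R axis i 1)"
  shows "((\<lambda>s. f (x + (d * s) *\<^sub>R axis i 1)) has_vector_derivative d *\<^sub>R partial i f (x + (d * s) *\<^sub>R axis i 1)) (at s)"
proof -
  have "(((\<lambda>s. f (x + s *\<^sub>R axis i 1)) \<circ> (\<lambda>s. d * s)) has_vector_derivative d *\<^sub>R partial i f (x + (d * s) *\<^sub>R axis i 1)) (at s)"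
    by (intro vector_diff_chain_at has_vector_derivative_line assms) (auto intro!: derivative_eq_intros)
  then show ?thesis by (simp add: o_def)
qed

lemma norm_add_axis_square:
  fixes z :: "real ^ 'n::finite"
  shows "(norm (z + t *\<^sub>R axis i 1))\<^sup>2 = (norm z)\<^sup>2 + 2 * z $ i * t + t\<^sup>2"
  unfolding power2_norm_eq_inner
  by (simp add: inner_add_left inner_add_right inner_axis inner_axis' power2_eq_square algebra_simps)

text \<open>Along a line the square of the norm is a quadratic polynomial. It is assembled with the product rule of
\<open>poly_approx\<close> because its degree need not be below \<open>N\<close>; the shape of the constant is the one this gives.\<close>

lemma poly_approx_line_cutoff:
  fixes z :: "real ^ 'n::finite" and N :: nat
  assumes "norm z \<le> 2"
  defines "q \<equiv> (2 * real N + 2)\<^sup>2"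
  shows "poly_approx N (3 + q * 4 * 1 + q * 1 * (q * 1 * 1)) (\<lambda>t. of_real (1 - (norm (z + t *\<^sub>R axis i 1))\<^sup>2))"
    and "\<And>t. t \<in> {0..1} \<Longrightarrow> \<bar>(1 - (norm (z + t *\<^sub>R axis i 1))\<^sup>2) - (1 - (norm (z + 0 *\<^sub>R axis i 1))\<^sup>2)\<bar> \<le> 5 * t"
proof -
  have zi: "\<bar>z $ i\<bar> \<le> 2" using component_le_norm_cart[of z i] assms by simp
  have "(norm z)\<^sup>2 \<le> 2\<^sup>2" using assms by (intro power_mono) auto
  then have "(norm z)\<^sup>2 \<le> 4" by simp
  then have z2: "\<bar>1 - (norm z)\<^sup>2\<bar> \<le> 3" using zero_le_power2[of "norm z"] by linarith
  have "poly_approx N (3 + q * 4 * 1 + q * 1 * (q * 1 * 1))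
     (\<lambda>t. of_real (1 - (norm z)\<^sup>2) + of_real (- 2 * z $ i) * of_real t + of_real (- 1) * (of_real t * of_real t))"
    unfolding q_def
  proof (intro poly_approx_add poly_approx_mult poly_approx_const poly_approx_id)
    show "norm (of_real (1 - (norm z)\<^sup>2) :: complex) \<le> 3" using z2 by (simp only: norm_of_real)
    show "norm (of_real (- 2 * z $ i) :: complex) \<le> 4" using zi by (simp only: norm_of_real abs_mult)
    show "norm (of_real (- 1) :: complex) \<le> 1" by simp
  qed
  also have "(\<lambda>t. of_real (1 - (norm z)\<^sup>2) + of_real (- 2 * z $ i) * of_real t + of_real (- 1) * (of_real t * of_real t))
     = (\<lambda>t. complex_of_real (1 - (norm (z + t *\<^sub>R axis i 1))\<^sup>2))"
    unfolding norm_add_axis_square by (simp add: fun_eq_iff power2_eq_square algebra_simps)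
  finally show "poly_approx N (3 + q * 4 * 1 + q * 1 * (q * 1 * 1)) (\<lambda>t. of_real (1 - (norm (z + t *\<^sub>R axis i 1))\<^sup>2))" .
  fix t :: real assume t: "t \<in> {0..1}"
  have "\<bar>2 * z $ i * t + t\<^sup>2\<bar> \<le> \<bar>2 * z $ i\<bar> * t + t * t"
    using t abs_triangle_ineq[of "2 * z $ i * t" "t\<^sup>2"] by (simp add: abs_mult power2_eq_square)
  also have "\<dots> \<le> 4 * t + 1 * t" using t zi by (intro add_mono mult_right_mono) auto
  finally show "\<bar>(1 - (norm (z + t *\<^sub>R axis i 1))\<^sup>2) - (1 - (norm (z + 0 *\<^sub>R axis i 1))\<^sup>2)\<bar> \<le> 5 * t"
    unfolding norm_add_axis_square by (simp add: algebra_simps abs_minus_commute)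
qed

text \<open>With \<open>c\<close> the dimension, the last argument of \<open>line_const\<close> dominates the bound of \<open>poly_approx_line_cutoff\<close>, the linear coefficient
\<open>2 c\<close> of the phase and the slope \<open>5\<close> of the cutoff.\<close>

definition cell_const :: "nat \<Rightarrow> real \<Rightarrow> real \<Rightarrow> real" where
  "cell_const K c V =
    (let q = (2 * real (2 * K) + 2)\<^sup>2
     in line_const K (2 * K) ((3 + q * 4 * 1 + q * 1 * (q * 1 * 1)) + (2 * c + 6)) * V)"

text \<open>With \<open>\<lambda>\<delta>\<^sup>2 P \<le> 1\<close> the rescaled phase has derivatives of order \<open>m \<ge> 2\<close> bounded by \<open>\<lambda>\<delta>\<^sup>m P \<le> 1\<close>, a gradient that varies by at most
\<open>2 d\<close>, and a Hoelder remainder of size \<open>\<lambda>\<delta>\<^bsup>K+b\<^esup> P \<le> \<delta>\<^bsup>K+b-2\<^esup>\<close>. The bound on \<open>\<delta>\<close> keeps all the lines that meet the support inside the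
unit ball, and the lower bound on the frequency makes the \<open>2 K\<close> steps fit into the unit interval.\<close>

lemma (in stationary_phase_data) cell_oscillation:
  assumes l: "0 < l" and \<delta>: "0 < \<delta>" "\<delta> \<le> eps / 8" and lP: "l * \<delta>\<^sup>2 * P \<le> 1"
    and y: "norm y < 1 - eps + \<delta>" and big: "pi * real (2 * K) \<le> l * \<delta> * \<bar>partial i \<Phi> y\<bar>"
  defines "h \<equiv> pi / (l * \<delta> * \<bar>partial i \<Phi> y\<bar>)"
  shows "norm (LINT z|lborel. cell l \<delta> y z)
      \<le> cell_const K (real CARD('n)) (measure lborel (cball (0 :: real ^ 'n) 2)) * A *
         (h ^ (2 * K) + \<delta> powr (real K + b - 2) * h powr (real K + b) + \<delta> ^ K * h ^ K)"
proof -
  define N where "N = 2 * K"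
  define q where "q = (2 * real N + 2)\<^sup>2"
  define B where "B = (3 + q * 4 * 1 + q * 1 * (q * 1 * 1)) + (2 * real CARD('n) + 6)"
  define V where "V = measure lborel (cball (0 :: real ^ 'n) 2)"
  have q0: "q \<ge> 0" by (simp add: q_def)
  have B: "3 + q * 4 * 1 + q * 1 * (q * 1 * 1) \<le> B" "2 * real CARD('n) \<le> B" "5 \<le> B" "1 \<le> B" "0 \<le> B"
    using q0 by (auto simp: B_def intro!: add_nonneg_nonneg add_increasing)
  have C_def: "cell_const K (real CARD('n)) V = line_const K N B * V"
    by (simp only: cell_const_def Let_def N_def q_def B_def)
  define \<xi> where "\<xi> = l * \<delta> * partial i \<Phi> y"
  have ax: "\<bar>\<xi>\<bar> = l * \<delta> * \<bar>partial i \<Phi> y\<bar>" using l \<delta> by (simp add: \<xi>_def abs_mult)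
  have h_eq: "h = pi / \<bar>\<xi>\<bar>" by (simp add: h_def ax)
  have x0: "pi * real N \<le> \<bar>\<xi>\<bar>" using big by (simp add: ax N_def)
  have "0 < pi * real N" using K by (simp add: N_def)
  then have \<xi>0: "\<bar>\<xi>\<bar> > 0" using x0 by linarith
  have h: "0 < h" "real N * h \<le> 1" "\<bar>\<xi>\<bar> * h = pi"
    using \<xi>0 x0 by (auto simp: h_eq field_simps)
  have \<delta>1: "\<delta> \<le> 1" using \<delta> eps by simp
  have y1: "norm y < 1" using y \<delta> eps by simp
  define r1 where "r1 = \<delta> powr (real K + b - 2)"
  have E: "norm (\<Sum>k\<le>N. (- 1) ^ k * of_nat (N choose k) *
      (exp (- \<i> * of_real (\<xi> * (real k * h))) * cell l \<delta> y (z + (real k * h) *\<^sub>R axis i 1)))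
     \<le> line_const K N B * A * (h ^ N + r1 * h powr (real K + b) + \<delta> ^ K * h ^ K)" if z: "z \<in> cball 0 2" for z
  proof -
    define x where "x = y + \<delta> *\<^sub>R z"
    have z': "norm z \<le> 2" using z by simp
    have inb: "norm (x + (\<delta> * s) *\<^sub>R axis i 1) < 1" if "s \<in> {0..1}" for s
    proof -
      have "norm (x + (\<delta> * s) *\<^sub>R axis i 1) \<le> norm y + norm (\<delta> *\<^sub>R z) + norm ((\<delta> * s) *\<^sub>R axis i 1 :: real ^ 'n)"
        unfolding x_def by (intro norm_triangle_le add_mono norm_triangle_ineq) auto
      also have "\<dots> = norm y + \<delta> * norm z + \<delta> * s" using that \<delta> by simp
      also have "\<dots> \<le> norm y + \<delta> * 2 + \<delta> * 1"
        using that \<delta> z' by (intro add_mono mult_left_mono) auto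
      finally show ?thesis using y \<delta> eps by simp
    qed
    have x1: "norm x < 1" using inb[of 0] by simp
    define PP where "PP m s = l * \<delta> ^ m * (partial i ^^ m) \<Phi> (x + (\<delta> * s) *\<^sub>R axis i 1)" for m s
    define W where "W m s = (\<delta> ^ m) *\<^sub>R (partial i ^^ m) \<psi> (x + (\<delta> * s) *\<^sub>R axis i 1)" for m s
    define p where "p t = 1 - (norm (z + t *\<^sub>R axis i 1))\<^sup>2" for t
    have "norm (\<Sum>k\<le>N. (- 1) ^ k * of_nat (N choose k) *
        (exp (\<i> * of_real (PP 0 (real k * h) - \<xi> * (real k * h))) * W 0 (real k * h)
          * of_real (max 0 (p (real k * h)) ^ N)))
       \<le> line_const K N B * A * (h ^ N + r1 * h powr (real K + b) + \<delta> ^ K * h ^ K)"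
    proof (rule line_difference)
      show "(PP m has_real_derivative PP (Suc m) s) (at s)" if "m < K" "s \<in> {0..1}" for m s
      proof -
        have "has_partial i ((partial i ^^ m) \<Phi>) (x + (\<delta> * s) *\<^sub>R axis i 1)"
          by (rule Ck_on_has_partial_power[OF Phi_Ck that(1)]) (use inb[OF that(2)] in simp)
        from has_vector_derivative_scaled_line[OF this]
        have "((\<lambda>s. (partial i ^^ m) \<Phi> (x + (\<delta> * s) *\<^sub>R axis i 1)) has_real_derivative
           \<delta> * (partial i ^^ Suc m) \<Phi> (x + (\<delta> * s) *\<^sub>R axis i 1)) (at s)"
          by (simp add: has_real_derivative_iff_has_vector_derivative)
        from DERIV_cmult[OF this, of "l * \<delta> ^ m"] show ?thesis
          unfolding PP_def by (simp add: mult_ac)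
      qed
      show "(W m has_vector_derivative W (Suc m) s) (at s)" if "m < K" "s \<in> {0..1}" for m s
      proof -
        have "has_partial i ((partial i ^^ m) \<psi>) (x + (\<delta> * s) *\<^sub>R axis i 1)"
          by (rule Ck_on_has_partial_power[OF psi_Ck that(1)]) simp
        from has_vector_derivative_scaleR[OF DERIV_const[of "\<delta> ^ m"] has_vector_derivative_scaled_line[OF this]]
        show ?thesis unfolding W_def by (simp add: mult_ac)
      qed
      show "\<bar>PP 1 0 - \<xi>\<bar> \<le> B"
      proof -
        have "\<bar>PP 1 0 - \<xi>\<bar> = l * \<delta> * \<bar>partial i \<Phi> x - partial i \<Phi> y\<bar>"
          using l \<delta> by (simp add: PP_def \<xi>_def abs_mult flip: right_diff_distrib)
        also have "\<dots> \<le> l * \<delta> * (real CARD('n) * P * (\<delta> * 2))"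
        proof (intro mult_left_mono)
          have "norm (x - y) \<le> \<delta> * 2" using z' \<delta> by (simp add: x_def)
          then show "\<bar>partial i \<Phi> x - partial i \<Phi> y\<bar> \<le> real CARD('n) * P * (\<delta> * 2)"
            using P_nonneg by (intro order_trans[OF Phi_lipschitz[OF x1 y1]] mult_left_mono) auto
        qed (use l \<delta> in auto)
        also have "\<dots> = (2 * real CARD('n)) * (l * \<delta>\<^sup>2 * P)" by (simp add: power2_eq_square)
        also have "\<dots> \<le> (2 * real CARD('n)) * 1" using lP by (intro mult_left_mono) auto
        also have "\<dots> \<le> B" using B by simp
        finally show ?thesis .
      qed
      show "\<bar>PP m 0\<bar> \<le> B" if "2 \<le> m" "m \<le> K" for m
      proof -
        have "\<bar>PP m 0\<bar> = l * \<delta> ^ m * \<bar>(partial i ^^ m) \<Phi> x\<bar>" using l \<delta> by (simp add: PP_def abs_mult)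
        also have "\<dots> \<le> l * \<delta>\<^sup>2 * P"
          using l \<delta> \<delta>1 that Phi_bound[OF that x1] by (intro mult_mono power_decreasing) auto
        also have "\<dots> \<le> B" using lP B by simp
        finally show ?thesis .
      qed
      show "\<bar>PP K s - PP K 0\<bar> \<le> r1 * s powr b" if s: "s \<in> {0..1}" for s
      proof -
        have ds: "\<delta> * s \<le> 1" using s \<delta> \<delta>1 by (intro mult_le_one) auto
        have "\<bar>PP K s - PP K 0\<bar> = l * \<delta> ^ K * \<bar>(partial i ^^ K) \<Phi> (x + (\<delta> * s) *\<^sub>R axis i 1) - (partial i ^^ K) \<Phi> x\<bar>"
          using l \<delta> by (simp add: PP_def abs_mult flip: right_diff_distrib)
        also have "\<dots> \<le> l * \<delta> ^ K * (P * (\<delta> * s) powr b)"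
          using l \<delta> s ds x1 inb[OF s] by (intro mult_left_mono Phi_holder) auto
        also have "\<dots> = (l * \<delta>\<^sup>2 * P) * (r1 * s powr b)"
        proof -
          have "\<delta> ^ K * \<delta> powr b = \<delta>\<^sup>2 * r1"
          proof -
            have "\<delta>\<^sup>2 * r1 = \<delta> powr 2 * \<delta> powr (real K + b - 2)" using \<delta> by (simp add: r1_def)
            also have "\<dots> = \<delta> powr (real K + b)" by (simp flip: powr_add)
            also have "\<dots> = \<delta> ^ K * \<delta> powr b" using \<delta> by (simp add: powr_add powr_realpow)
            finally show ?thesis by simp
          qed
          then show ?thesis using \<delta> s by (simp add: powr_mult algebra_simps)
        qed
        also have "\<dots> \<le> 1 * (r1 * s powr b)" using lP by (intro mult_right_mono) (auto simp: r1_def)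
        finally show ?thesis by simp
      qed
      show "norm (W m s) \<le> A" if "m < K" "s \<in> {0..1}" for m s
      proof -
        have "norm (W m s) \<le> 1 * A"
          using \<delta> \<delta>1 that psi_bound[of m] unfolding W_def norm_scaleR by (intro mult_mono) (auto intro: power_le_one)
        then show ?thesis by simp
      qed
      show "norm (W K s) \<le> A * \<delta> ^ K" if "s \<in> {0..1}" for s
        using \<delta> psi_bound[of K] by (simp add: W_def mult_ac mult_left_mono)
      show "poly_approx N B (\<lambda>t. of_real (p t))"
        unfolding p_def using poly_approx_line_cutoff(1)[OF z'] B(1) unfolding q_def by (rule poly_approx_mono)
      show "\<bar>p t - p 0\<bar> \<le> B * t" if "t \<in> {0..1}" for t
        unfolding p_def using poly_approx_line_cutoff(2)[OF z' that] B(3) that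
        by (intro order_trans[OF _ mult_right_mono[OF B(3)]]) auto
      show "p t \<le> 1" for t by (simp add: p_def)
    qed (use h \<delta> K b B in \<open>auto simp: r1_def N_def\<close>)
    moreover have "exp (\<i> * of_real (PP 0 s - \<xi> * s)) * W 0 s * of_real (max 0 (p s) ^ N)
       = exp (- \<i> * of_real (\<xi> * s)) * cell l \<delta> y (z + s *\<^sub>R axis i 1)" for s
    proof -
      have "x + (\<delta> * s) *\<^sub>R axis i 1 = y + \<delta> *\<^sub>R (z + s *\<^sub>R axis i 1)"
        by (simp add: x_def scaleR_add_right)
      then show ?thesis
        by (simp add: PP_def W_def p_def cell_def integrand_def N_def exp_diff exp_minus right_diff_distrib divide_inverse mult_ac)
    qed
    ultimately show ?thesis by (simp only:)
  qed
  have "norm (LINT z|lborel. cell l \<delta> y z) \<le> (line_const K N B * A * (h ^ N + r1 * h powr (real K + b) + \<delta> ^ K * h ^ K)) * V"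
    unfolding V_def
  proof (rule oscillation_by_differences[OF measurable_cell integrable_cell h(3) E])
    fix z :: "real ^ 'n" and k assume z: "z \<notin> cball 0 2" and k: "k \<le> N"
    have "real k * h \<le> real N * h" using k h by (intro mult_right_mono) auto
    then have "real k * h \<le> 1" using h(2) by linarith
    moreover have "0 \<le> real k * h" using h(1) by simp
    ultimately have "norm ((real k * h) *\<^sub>R axis i 1 :: real ^ 'n) \<le> 1"
      by (simp only: norm_scaleR norm_axis_1 abs_of_nonneg mult_1_right)
    then have "1 \<le> norm (z + (real k * h) *\<^sub>R axis i 1)"
      using z norm_diff_ineq[of z "(real k * h) *\<^sub>R axis i 1"] by simp
    then show "cell l \<delta> y (z + (real k * h) *\<^sub>R axis i 1) = 0" by (rule cell_eq_0)
  qed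
  then show ?thesis
    unfolding V_def[symmetric] C_def unfolding r1_def N_def by (simp add: mult_ac)
qed

section \<open>Decay of the cell integrals and their sum\<close>

lemma line_const_nonneg: "0 \<le> B \<Longrightarrow> 0 \<le> line_const K N B"
  by (auto simp: line_const_def Let_def intro!: mult_nonneg_nonneg add_nonneg_nonneg sum_nonneg)

lemma cell_const_nonneg: "0 \<le> c \<Longrightarrow> 0 \<le> V \<Longrightarrow> 0 \<le> cell_const K c V"
  by (auto simp: cell_const_def Let_def intro!: mult_nonneg_nonneg line_const_nonneg add_nonneg_nonneg)

text \<open>The first term covers low frequencies, where the trivial bound is used, the second one high frequencies.\<close>

definition decay_const :: "nat \<Rightarrow> real \<Rightarrow> real \<Rightarrow> real \<Rightarrow> real" where
  "decay_const K b c V = V * (1 + 2 * pi * real K) powr (2 * (real K + b) - 2)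
     + 3 * cell_const K c V * (1 + (2 * pi) powr (2 * (real K + b) - 2))"

lemma decay_const_nonneg: "0 \<le> c \<Longrightarrow> 0 \<le> V \<Longrightarrow> 0 \<le> decay_const K b c V"
  using cell_const_nonneg[of c V K] by (auto simp: decay_const_def intro!: add_nonneg_nonneg mult_nonneg_nonneg)

context stationary_phase_data
begin

definition decay :: real where "decay = 2 * (real K + b) - 2"

lemma decay_bounds: "2 \<le> decay" "decay \<le> real (2 * K)" "real K \<le> decay"
  using Kb b by (auto simp: decay_def)

text \<open>Let \<open>h\<close> be the inverse frequency and \<open>v = max \<delta> h \<le> 1\<close>. Each of \<open>h\<^bsup>2K\<^esup>\<close>, \<open>\<delta>\<^bsup>K+b-2\<^esup> h\<^bsup>K+b\<^esup>\<close> and \<open>\<delta>\<^sup>K h\<^sup>K\<close> is a product of powers of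
\<open>\<delta>\<close> and \<open>h\<close> of total exponent at least \<open>2 (K + b) - 2\<close>, the number called \<open>decay\<close>, and hence at most \<open>v\<close> to that power.\<close>

lemma cell_decay:
  assumes l: "0 < l" and \<delta>: "0 < \<delta>" "\<delta> \<le> eps / 8" and lP: "l * \<delta>\<^sup>2 * P \<le> 1"
  shows "norm (LINT z|lborel. cell l \<delta> y z)
      \<le> decay_const K b (real CARD('n)) (measure lborel (cball (0 :: real ^ 'n) 2)) * A *
         (\<delta> powr decay + (1 + l * \<delta> * \<bar>partial i \<Phi> y\<bar>) powr - decay)"
proof -
  define V where "V = measure lborel (cball (0 :: real ^ 'n) 2)"
  define C1 where "C1 = cell_const K (real CARD('n)) V"
  define C where "C = decay_const K b (real CARD('n)) V"
  define w where "w = l * \<delta> * \<bar>partial i \<Phi> y\<bar>"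
  have V0: "0 \<le> V" by (simp add: V_def)
  have C10: "0 \<le> C1" unfolding C1_def using V0 by (intro cell_const_nonneg) auto
  have C0: "0 \<le> C" unfolding C_def using V0 by (intro decay_const_nonneg) auto
  have C: "C = V * (1 + 2 * pi * real K) powr decay + 3 * C1 * (1 + (2 * pi) powr decay)"
    by (simp add: C_def decay_const_def C1_def decay_def)
  have w0: "0 \<le> w" using l \<delta> by (simp add: w_def)
  have rhs0: "0 \<le> \<delta> powr decay" "0 \<le> (1 + w) powr - decay" by auto
  have "norm (LINT z|lborel. cell l \<delta> y z) \<le> C * A * (\<delta> powr decay + (1 + w) powr - decay)"
  proof -
    consider "1 - eps + \<delta> \<le> norm y" | "w < 2 * pi * real K"
      | "norm y < 1 - eps + \<delta>" "2 * pi * real K \<le> w" by linarith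
    then show ?thesis
    proof cases
      case 1
      then have "cell l \<delta> y = (\<lambda>z. 0)" using cell_outside \<delta> by (auto simp: fun_eq_iff)
      then show ?thesis using C0 A_nonneg rhs0 by simp
    next
      case 2
      have "1 \<le> (1 + 2 * pi * real K) powr decay * (1 + w) powr - decay"
      proof -
        have "(1 + w) powr decay \<le> (1 + 2 * pi * real K) powr decay"
          using 2 w0 decay_bounds by (intro powr_mono2) auto
        then have "(1 + w) powr decay * (1 + w) powr - decay \<le> (1 + 2 * pi * real K) powr decay * (1 + w) powr - decay"
          by (intro mult_right_mono) auto
        then show ?thesis using w0 by (simp flip: powr_add)
      qed
      from mult_left_mono[OF this, of "A * V"]
      have "A * V \<le> (V * (1 + 2 * pi * real K) powr decay) * A * (1 + w) powr - decay"
        using V0 A_nonneg by (simp add: mult_ac)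
      also have "\<dots> \<le> C * A * (\<delta> powr decay + (1 + w) powr - decay)"
        using C10 V0 A_nonneg rhs0 by (intro mult_mono) (auto simp: C intro!: mult_nonneg_nonneg add_nonneg_nonneg)
      finally show ?thesis using cell_trivial_bound[of l \<delta> y] by (simp add: V_def)
    next
      case 3
      have K1: "1 \<le> real K" using K by simp
      have "2 * pi * 1 \<le> 2 * pi * real K" using K1 by (intro mult_left_mono) auto
      then have wpi: "2 * pi \<le> w" using 3(2) by linarith
      then have w1: "1 \<le> w" "pi \<le> w" using pi_gt3 by linarith+
      define h where "h = pi / w"
      have h: "0 < h" "h \<le> 1" using w1 pi_gt_zero by (auto simp: h_def field_simps)
      define v where "v = max \<delta> h"
      \<comment> \<open>Both \<open>\<delta>\<close> and \<open>h\<close> are at most 1, so larger exponents give smaller powers.\<close>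
      have v: "0 < v" "v \<le> 1" "\<delta> \<le> v" "h \<le> v" using h \<delta> eps by (auto simp: v_def)
      have pw: "v powr real (2 * K) \<le> v powr decay" using v decay_bounds by (intro powr_mono') auto
      have t1: "h ^ (2 * K) \<le> v powr decay"
      proof -
        have "h ^ (2 * K) \<le> v ^ (2 * K)" using h v by (intro power_mono) auto
        also have "\<dots> = v powr real (2 * K)" using v by (simp add: powr_realpow del: of_nat_mult)
        finally show ?thesis using pw by simp
      qed
      have t2: "\<delta> powr (real K + b - 2) * h powr (real K + b) \<le> v powr decay"
      proof -
        have "\<delta> powr (real K + b - 2) * h powr (real K + b) \<le> v powr (real K + b - 2) * v powr (real K + b)"
          using Kb b v h \<delta> by (intro mult_mono powr_mono2) auto
        also have "\<dots> = v powr decay" by (simp add: decay_def algebra_simps flip: powr_add)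
        finally show ?thesis .
      qed
      have t3: "\<delta> ^ K * h ^ K \<le> v powr decay"
      proof -
        have "\<delta> ^ K * h ^ K \<le> v ^ K * v ^ K" using h v \<delta> by (intro mult_mono power_mono) auto
        also have "\<dots> = v powr real (2 * K)" using v by (simp add: powr_realpow mult_2 flip: power_add del: of_nat_mult of_nat_add)
        finally show ?thesis using pw by simp
      qed
      have "v powr decay \<le> \<delta> powr decay + h powr decay" by (auto simp: v_def max_def)
      also have "h powr decay \<le> (2 * pi) powr decay * (1 + w) powr - decay"
      proof -
        have "h \<le> 2 * pi / (1 + w)" using w1 by (simp add: h_def field_simps)
        then have "h powr decay \<le> (2 * pi / (1 + w)) powr decay"
          using h decay_bounds by (intro powr_mono2) auto
        also have "\<dots> = (2 * pi) powr decay * (1 + w) powr - decay"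
          using w0 by (simp add: powr_divide powr_minus_divide)
        finally show ?thesis .
      qed
      finally have vv: "v powr decay \<le> \<delta> powr decay + (2 * pi) powr decay * (1 + w) powr - decay" by simp
      also have "\<dots> \<le> (1 + (2 * pi) powr decay) * (\<delta> powr decay + (1 + w) powr - decay)"
        by (simp add: algebra_simps)
      finally have vv: "v powr decay \<le> (1 + (2 * pi) powr decay) * (\<delta> powr decay + (1 + w) powr - decay)" .
      have "norm (LINT z|lborel. cell l \<delta> y z)
         \<le> C1 * A * (h ^ (2 * K) + \<delta> powr (real K + b - 2) * h powr (real K + b) + \<delta> ^ K * h ^ K)"
        unfolding C1_def V_def h_def w_def
        by (rule cell_oscillation[OF l \<delta> lP 3(1)]) (use 3(2) in \<open>simp add: w_def mult_ac\<close>)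
      also have "\<dots> \<le> C1 * A * (3 * v powr decay)"
        using t1 t2 t3 C10 A_nonneg by (intro mult_left_mono) auto
      also have "\<dots> \<le> C1 * A * (3 * ((1 + (2 * pi) powr decay) * (\<delta> powr decay + (1 + w) powr - decay)))"
        using vv C10 A_nonneg by (intro mult_left_mono) auto
      also have "\<dots> = (3 * C1 * (1 + (2 * pi) powr decay)) * (A * (\<delta> powr decay + (1 + w) powr - decay))"
        by (simp add: mult_ac)
      also have "\<dots> \<le> C * (A * (\<delta> powr decay + (1 + w) powr - decay))"
        using V0 A_nonneg rhs0 by (intro mult_right_mono) (auto simp: C)
      finally show ?thesis by (simp add: mult_ac)
    qed
  qed
  then show ?thesis by (simp add: C_def V_def w_def)
qed

definition cutoff_mass :: real where
  "cutoff_mass = (LINT z|lborel. max 0 (1 - (norm (z :: real ^ 'n))\<^sup>2) ^ (2 * K))"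

lemma cutoff_mass_pos: "(3 / 4) ^ (2 * K) * measure lborel (cball (0 :: real ^ 'n) (1 / 2)) \<le> cutoff_mass"
proof -
  let ?c = "\<lambda>z :: real ^ 'n. max 0 (1 - (norm z)\<^sup>2) ^ (2 * K)"
  have "(LINT z|lborel. (3 / 4) ^ (2 * K) * indicator (cball (0 :: real ^ 'n) (1 / 2)) z) \<le> (LINT z|lborel. ?c z)"
  proof (rule integral_mono)
    show "integrable lborel (\<lambda>z. (3 / 4) ^ (2 * K) * indicator (cball (0 :: real ^ 'n) (1 / 2)) z :: real)"
      using emeasure_lborel_cball_finite[of "0 :: real ^ 'n" "1 / 2"]
      by (intro integrable_mult_right integrable_real_indicator) auto
    have "integrable lborel (\<lambda>z :: real ^ 'n. indicator (cball 0 1) z *\<^sub>R ?c z)"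
      by (intro borel_integrable_compact continuous_intros) auto
    moreover have "(\<lambda>z :: real ^ 'n. indicator (cball 0 1) z *\<^sub>R ?c z) = ?c"
      using cutoff_bounds(3) K by (auto simp: fun_eq_iff indicator_def)
    ultimately show "integrable lborel ?c" by simp
    fix z :: "real ^ 'n"
    show "(3 / 4) ^ (2 * K) * indicator (cball 0 (1 / 2)) z \<le> ?c z"
    proof (cases "norm z \<le> 1 / 2")
      case True
      then have "(norm z)\<^sup>2 \<le> (1 / 2)\<^sup>2" by (intro power_mono) auto
      then have "3 / 4 \<le> 1 - (norm z)\<^sup>2" by (simp add: power2_eq_square)
      then have "3 / 4 \<le> max 0 (1 - (norm z)\<^sup>2)" by (rule max.coboundedI2)
      then have "(3 / 4) ^ (2 * K) \<le> ?c z" by (rule power_mono) simp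
      then show ?thesis using True by simp
    next
      case False
      then show ?thesis using cutoff_bounds(1)[of z] by (simp add: indicator_def)
    qed
  qed
  then show ?thesis by (simp add: cutoff_mass_def)
qed

lemma integrable_cell_prod:
  assumes "0 \<le> \<delta>" "\<delta> \<le> 1"
  shows "integrable (lborel \<Otimes>\<^sub>M lborel) (\<lambda>(y, z). cell l \<delta> y z)"
proof -
  let ?T = "cball (0 :: real ^ 'n) 2 \<times> cball (0 :: real ^ 'n) 1"
  have "continuous_on ?T (\<lambda>p. cell l \<delta> (fst p) (snd p))"
    unfolding cell_def by (intro continuous_intros continuous_on_compose2[OF continuous_on_integrand]) auto
  then have "integrable lborel (\<lambda>p. indicator ?T p *\<^sub>R cell l \<delta> (fst p) (snd p))"
    by (intro borel_integrable_compact compact_Times) auto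
  moreover have "(\<lambda>p. indicator ?T p *\<^sub>R cell l \<delta> (fst p) (snd p)) = (\<lambda>(y, z). cell l \<delta> y z)"
  proof (intro ext, clarify)
    fix y z :: "real ^ 'n"
    have "cell l \<delta> y z = 0" if "(y, z) \<notin> ?T"
    proof (cases "norm z > 1")
      case False
      then have "norm y > 2" using that by auto
      then show ?thesis using cell_outside[of \<delta> y l z] assms eps by auto
    qed (simp add: cell_eq_0)
    then show "indicator ?T (y, z) *\<^sub>R cell l \<delta> (fst (y, z)) (snd (y, z)) = cell l \<delta> y z"
      by (auto simp: indicator_def)
  qed
  ultimately show ?thesis by (simp add: lborel_prod)
qed

text \<open>By Fubini the centres \<open>y\<close> can be integrated first; for fixed \<open>z\<close> this gives a translate of the original integral,
weighted by the cutoff at \<open>z\<close>.\<close>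

lemma integral_eq_cell_average:
  assumes "0 \<le> \<delta>" "\<delta> \<le> 1"
  shows "(LINT y|lborel. LINT z|lborel. cell l \<delta> y z) = of_real cutoff_mass * (LINT x|lborel. integrand l x)"
    and "integrable lborel (\<lambda>y. LINT z|lborel. cell l \<delta> y z)"
proof -
  have meas: "integrand l \<in> borel_measurable borel"
    using continuous_on_integrand by (rule borel_measurable_continuous_onI)
  have "(LINT y|lborel. LINT z|lborel. cell l \<delta> y z) = (LINT z|lborel. LINT y|lborel. cell l \<delta> y z)"
    by (rule lborel_pair.Fubini_integral[symmetric, OF integrable_cell_prod[OF assms]])
  also have "\<dots> = (LINT z|lborel. (LINT x|lborel. integrand l x) * of_real (max 0 (1 - (norm (z :: real ^ 'n))\<^sup>2) ^ (2 * K)))"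
    by (simp add: cell_def lborel_translate(2)[OF meas])
  also have "\<dots> = (LINT x|lborel. integrand l x) * of_real cutoff_mass"
    by (simp add: cutoff_mass_def del: of_real_power)
  finally show "(LINT y|lborel. LINT z|lborel. cell l \<delta> y z) = of_real cutoff_mass * (LINT x|lborel. integrand l x)"
    by (simp add: mult.commute)
  from lborel_pair.integrable_fst[OF integrable_cell_prod[OF assms]]
  show "integrable lborel (\<lambda>y. LINT z|lborel. cell l \<delta> y z)" by simp
qed

end

lemma norm_le_card_mult_component:
  fixes v :: "real ^ 'n"
  obtains i where "norm v \<le> real CARD('n) * \<bar>v $ i\<bar>"
proof -
  obtain i where i: "\<And>j. \<bar>v $ j\<bar> \<le> \<bar>v $ i\<bar>"
  proof -
    have "Max (range (\<lambda>j. \<bar>v $ j\<bar>)) \<in> range (\<lambda>j. \<bar>v $ j\<bar>)" by (rule Max_in) auto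
    then obtain i where "Max (range (\<lambda>j. \<bar>v $ j\<bar>)) = \<bar>v $ i\<bar>" by (rule rangeE)
    then have "\<bar>v $ j\<bar> \<le> \<bar>v $ i\<bar>" for j by (metis Max_ge finite finite_imageI rangeI)
    then show ?thesis by (rule that)
  qed
  have "norm v \<le> (\<Sum>j\<in>UNIV. \<bar>v $ j\<bar>)" by (rule norm_le_l1_cart)
  also have "\<dots> \<le> (\<Sum>j\<in>(UNIV :: 'n set). \<bar>v $ i\<bar>)" using i by (intro sum_mono) auto
  finally show ?thesis using that by simp
qed

text \<open>A majorant by indicators of sublevel sets, so that later on only the measures of those sets are needed.\<close>

lemma dyadic_bound:
  assumes "0 \<le> w" "0 < M"
  shows "ennreal ((1 + w) powr - M) \<le> (\<Sum>k. ennreal (2 powr M * (2 powr - M) ^ k) * indicator {..2 ^ k} w)"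
proof -
  have "\<exists>k. w \<le> 2 ^ k" using real_arch_pow[of 2 w] by (auto intro: less_imp_le)
  define k where "k = (LEAST k. w \<le> 2 ^ k)"
  have k: "w \<le> 2 ^ k" unfolding k_def by (rule LeastI_ex) fact
  have "(1 + w) powr - M \<le> 2 powr M * (2 powr - M) ^ k"
  proof (cases k)
    case 0
    have "(1 + w) powr - M \<le> 1 powr - M" using assms by (intro powr_mono2') auto
    also have "1 powr - M \<le> 2 powr M" using assms by (simp add: ge_one_powr_ge_zero)
    finally show ?thesis using 0 by simp
  next
    case (Suc j)
    then have "\<not> w \<le> 2 ^ j" using not_less_Least[of j "\<lambda>k. w \<le> 2 ^ k"] by (simp add: k_def)
    then have "(1 + w) powr - M \<le> (2 ^ j) powr - M" using assms by (intro powr_mono2') auto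
    also have "\<dots> = (2 powr - M) ^ j" by (simp add: powr_realpow[symmetric] powr_powr mult_ac)
    also have "\<dots> = 2 powr M * (2 powr - M) ^ k" using Suc by (simp add: powr_minus field_simps)
    finally show ?thesis .
  qed
  then have *: "ennreal ((1 + w) powr - M) \<le> ennreal (2 powr M * (2 powr - M) ^ k) * indicator {..2 ^ k} w"
    using k by (simp add: ennreal_leI)
  define F where "F j = ennreal (2 powr M * (2 powr - M) ^ j) * indicator {..2 ^ j} w" for j
  have "F k = sum F {k}" by simp
  also have "\<dots> \<le> (\<Sum>j. F j)" by (rule sum_le_suminf) auto
  finally show ?thesis using * by (simp add: F_def)
qed

text \<open>A decay of order \<open>M\<close> beats sublevel sets of measure \<open>O(t\<^sup>d)\<close> when \<open>M > d\<close>: the dyadic sum is a geometric series.\<close>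

lemma nn_integral_decay:
  fixes w :: "'a::euclidean_space \<Rightarrow> real"
  assumes B: "B \<in> sets borel" and S: "\<And>t. {y \<in> B. w y \<le> t} \<in> sets borel"
    and w: "\<And>y. y \<in> B \<Longrightarrow> 0 \<le> w y" and D: "0 \<le> D"
    and mS: "\<And>t. 0 < t \<Longrightarrow> emeasure lborel {y \<in> B. w y \<le> t} \<le> ennreal (D * t ^ d)"
    and M: "real d < M"
  shows "(\<integral>\<^sup>+y. (\<Sum>k. ennreal (2 powr M * (2 powr - M) ^ k) * indicator {y \<in> B. w y \<le> 2 ^ k} y) \<partial>lborel)
     \<le> ennreal (D * (2 powr M / (1 - 2 powr (real d - M))))"
proof -
  let ?r = "2 powr (real d - M)"
  have r: "0 \<le> ?r" "?r < 1" using M by (auto intro: powr_less_one)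
  have "(\<integral>\<^sup>+y. (\<Sum>k. ennreal (2 powr M * (2 powr - M) ^ k) * indicator {y \<in> B. w y \<le> 2 ^ k} y) \<partial>lborel)
     = (\<Sum>k. \<integral>\<^sup>+y. ennreal (2 powr M * (2 powr - M) ^ k) * indicator {y \<in> B. w y \<le> 2 ^ k} y \<partial>lborel)"
    using S by (intro nn_integral_suminf) auto
  also have "\<dots> = (\<Sum>k. ennreal (2 powr M * (2 powr - M) ^ k) * emeasure lborel {y \<in> B. w y \<le> 2 ^ k})"
    using S by (simp add: nn_integral_cmult_indicator)
  also have "\<dots> \<le> (\<Sum>k. ennreal (D * 2 powr M * ?r ^ k))"
  proof (rule suminf_le)
    fix k :: nat
    have "ennreal (2 powr M * (2 powr - M) ^ k) * emeasure lborel {y \<in> B. w y \<le> 2 ^ k}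
       \<le> ennreal (2 powr M * (2 powr - M) ^ k) * ennreal (D * (2 ^ k) ^ d)"
      using mS[of "2 ^ k"] by (intro mult_left_mono) auto
    also have "\<dots> = ennreal (2 powr M * (2 powr - M) ^ k * (D * (2 ^ k) ^ d))"
      using D by (simp add: ennreal_mult)
    also have "2 powr M * (2 powr - M) ^ k * (D * (2 ^ k) ^ d) = D * 2 powr M * ?r ^ k"
      by (simp add: powr_diff powr_minus powr_realpow power_divide field_simps flip: power_mult)
    finally show "ennreal (2 powr M * (2 powr - M) ^ k) * emeasure lborel {y \<in> B. w y \<le> 2 ^ k}
       \<le> ennreal (D * 2 powr M * ?r ^ k)" .
  qed auto
  also have "\<dots> = ennreal (\<Sum>k. D * 2 powr M * ?r ^ k)"
    using r D by (intro suminf_ennreal2) (auto intro!: summable_mult summable_geometric)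
  also have "(\<Sum>k. D * 2 powr M * ?r ^ k) = D * (2 powr M / (1 - ?r))"
    using r by (subst suminf_mult) (auto intro: summable_geometric simp: suminf_geometric)
  finally show ?thesis .
qed

context stationary_phase_data
begin

text \<open>The gradient maps the set injectively into a ball of radius \<open>t / a\<close> and expands volumes by at least \<open>L\<close>.\<close>

lemma small_gradient_measure:
  assumes cont: "continuous_on (ball 0 1) (grad \<Phi>)" and inj: "inj_on (grad \<Phi>) (ball 0 1)"
    and der: "\<And>x. x \<in> ball 0 1 \<Longrightarrow> (grad \<Phi> has_derivative (\<lambda>v. H x *v v)) (at x)"
    and L: "0 < L" "\<And>x. x \<in> ball 0 1 \<Longrightarrow> L \<le> \<bar>det (H x)\<bar>"
    and a: "0 < a"
  shows "{y \<in> ball 0 1. a * norm (grad \<Phi> y) \<le> t} \<in> sets borel"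
    and "0 < t \<Longrightarrow> emeasure lborel {y \<in> ball 0 1. a * norm (grad \<Phi> y) \<le> t}
       \<le> ennreal (measure lborel (ball (0 :: real ^ 'n) 1) / (a ^ CARD('n) * L) * t ^ CARD('n))"
proof -
  let ?S = "{y \<in> ball 0 1. a * norm (grad \<Phi> y) \<le> t}"
  have "open (ball 0 1 \<inter> (\<lambda>y. a * norm (grad \<Phi> y)) -` {t<..})"
    by (intro continuous_open_preimage continuous_intros cont) auto
  then have "ball 0 1 - (ball 0 1 \<inter> (\<lambda>y. a * norm (grad \<Phi> y)) -` {t<..}) \<in> sets borel" by auto
  moreover have "?S = ball 0 1 - (ball 0 1 \<inter> (\<lambda>y. a * norm (grad \<Phi> y)) -` {t<..})" by auto
  ultimately show S: "?S \<in> sets borel" by simp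
  assume t: "0 < t"
  have fin: "emeasure lborel ?S < \<infinity>"
  proof -
    have "emeasure lborel ?S \<le> emeasure lborel (ball (0 :: real ^ 'n) 1)" by (rule emeasure_mono) auto
    also have "\<dots> < \<infinity>" using emeasure_lborel_ball_finite[of "0 :: real ^ 'n" 1] by simp
    finally show ?thesis .
  qed
  have "L * measure lborel ?S \<le> measure lborel (cball (0 :: real ^ 'n) (t / a))"
  proof (rule jacobian_lower_bound[where f = "grad \<Phi>" and H = H, OF S fin])
    show "grad \<Phi> ` ?S \<subseteq> cball 0 (t / a)" using a by (auto simp: field_simps)
    show "inj_on (grad \<Phi>) ?S" by (rule inj_on_subset[OF inj]) auto
  qed (use der L emeasure_lborel_cball_finite[of "0 :: real ^ 'n" "t / a"] in auto)
  also have "\<dots> = (t / a) ^ CARD('n) * measure lborel (ball (0 :: real ^ 'n) 1)"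
    using content_ball_conv_unit_ball[of "t / a" "0 :: real ^ 'n"] t a by (simp add: content_cball_conv_ball)
  finally have "measure lborel ?S \<le> measure lborel (ball (0 :: real ^ 'n) 1) / (a ^ CARD('n) * L) * t ^ CARD('n)"
    using L(1) a by (simp add: field_simps power_divide)
  then show "emeasure lborel ?S \<le> ennreal (measure lborel (ball (0 :: real ^ 'n) 1) / (a ^ CARD('n) * L) * t ^ CARD('n))"
    using fin by (simp add: emeasure_eq_ennreal_measure ennreal_leI)
qed

lemma integral_bound:
  assumes cont: "continuous_on (ball 0 1) (grad \<Phi>)" and inj: "inj_on (grad \<Phi>) (ball 0 1)"
    and der: "\<And>x. x \<in> ball 0 1 \<Longrightarrow> (grad \<Phi> has_derivative (\<lambda>v. H x *v v)) (at x)"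
    and L: "0 < L" "\<And>x. x \<in> ball 0 1 \<Longrightarrow> L \<le> \<bar>det (H x)\<bar>"
    and l: "0 < l" and \<delta>: "0 < \<delta>" "\<delta> \<le> eps / 8" and lP: "l * \<delta>\<^sup>2 * P \<le> 1"
    and d: "real CARD('n) < decay"
  defines "V \<equiv> measure lborel (ball (0 :: real ^ 'n) 1)"
  defines "C \<equiv> decay_const K b (real CARD('n)) (measure lborel (cball (0 :: real ^ 'n) 2))"
  shows "cutoff_mass * norm (LINT x|lborel. integrand l x)
     \<le> C * A * (\<delta> powr decay * V + V / ((l * \<delta> / real CARD('n)) ^ CARD('n) * L) * (2 powr decay / (1 - 2 powr (real CARD('n) - decay))))"
proof -
  define J where "J y = (LINT z|lborel. cell l \<delta> y z)" for y
  define a where "a = l * \<delta> / real CARD('n)"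
  define w where "w y = a * norm (grad \<Phi> y)" for y
  define G where "G y = (\<Sum>k. ennreal (2 powr decay * (2 powr - decay) ^ k) * indicator {y \<in> ball 0 1. w y \<le> 2 ^ k} y)" for y
  have a: "0 < a" using l \<delta> by (simp add: a_def)
  have C0: "0 \<le> C" unfolding C_def by (intro decay_const_nonneg) auto
  have CA: "0 \<le> C * A" using C0 A_nonneg by simp
  have \<delta>1: "0 \<le> \<delta>" "\<delta> \<le> 1" using \<delta> eps by auto
  note S = small_gradient_measure[OF cont inj der L a]
  have GS: "{y \<in> ball 0 1. w y \<le> t} \<in> sets borel" for t using S(1) by (simp add: w_def)
  have mass: "0 \<le> cutoff_mass" using order_trans[OF _ cutoff_mass_pos] by simp
  have pt: "ennreal (norm (J y)) \<le> ennreal (C * A) * (ennreal (\<delta> powr decay) * indicator (ball 0 1) y + G y)" for y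
  proof (cases "norm y < 1")
    case False
    then have "cell l \<delta> y = (\<lambda>z. 0)" using cell_outside[of \<delta> y l] \<delta> eps by (auto simp: fun_eq_iff)
    then show ?thesis by (simp add: J_def)
  next
    case True
    obtain i where i: "norm (grad \<Phi> y) \<le> real CARD('n) * \<bar>grad \<Phi> y $ i\<bar>"
      by (rule norm_le_card_mult_component)
    have "w y \<le> a * (real CARD('n) * \<bar>grad \<Phi> y $ i\<bar>)" using i a by (simp add: w_def mult_left_mono)
    also have "\<dots> = l * \<delta> * \<bar>partial i \<Phi> y\<bar>" by (simp add: a_def grad_def)
    finally have wi: "w y \<le> l * \<delta> * \<bar>partial i \<Phi> y\<bar>" .
    have w0: "0 \<le> w y" using a by (simp add: w_def)
    have "norm (J y) \<le> C * A * (\<delta> powr decay + (1 + l * \<delta> * \<bar>partial i \<Phi> y\<bar>) powr - decay)"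
      unfolding J_def C_def by (rule cell_decay[OF l \<delta> lP])
    also have "\<dots> \<le> C * A * (\<delta> powr decay + (1 + w y) powr - decay)"
      using CA wi w0 decay_bounds by (intro mult_left_mono add_left_mono powr_mono2') auto
    finally have "ennreal (norm (J y)) \<le> ennreal (C * A) * (ennreal (\<delta> powr decay) + ennreal ((1 + w y) powr - decay))"
      using CA by (simp add: ennreal_leI flip: ennreal_mult ennreal_plus)
    also have "ennreal ((1 + w y) powr - decay) \<le> G y"
    proof -
      have "indicator {..2 ^ k} (w y) = (indicator {y \<in> ball 0 1. w y \<le> 2 ^ k} y :: ennreal)" for k :: nat
        using True by (simp add: indicator_def)
      then show ?thesis using dyadic_bound[OF w0, of decay] decay_bounds by (simp add: G_def)
    qed
    finally show ?thesis using True by (simp add: mult_left_mono add_left_mono)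
  qed
  have measG: "G \<in> borel_measurable borel"
  proof -
    note GS[measurable]
    show ?thesis unfolding G_def by measurable
  qed
  have "cutoff_mass * norm (LINT x|lborel. integrand l x) = norm (LINT y|lborel. J y)"
    unfolding J_def integral_eq_cell_average(1)[OF \<delta>1] using mass by (simp add: norm_mult)
  then have s1: "ennreal (cutoff_mass * norm (LINT x|lborel. integrand l x)) \<le> (\<integral>\<^sup>+y. ennreal (norm (J y)) \<partial>lborel)"
    using integral_norm_bound_ennreal[OF integral_eq_cell_average(2)[OF \<delta>1, of l]] by (simp add: J_def[abs_def])
  define F where "F y = ennreal (\<delta> powr decay) * indicator (ball 0 1) y" for y :: "real ^ 'n"
  have ballm: "ball (0 :: real ^ 'n) 1 \<in> sets lborel" by simp
  have measF: "F \<in> borel_measurable lborel"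
    unfolding F_def using ballm by (intro borel_measurable_times_ennreal borel_measurable_const borel_measurable_indicator)
  have measG': "G \<in> borel_measurable lborel" using measG by simp
  have s2: "(\<integral>\<^sup>+y. ennreal (norm (J y)) \<partial>lborel) \<le> (\<integral>\<^sup>+y. ennreal (C * A) * (F y + G y) \<partial>lborel)"
    unfolding F_def by (intro nn_integral_mono pt)
  have s3: "(\<integral>\<^sup>+y. ennreal (C * A) * (F y + G y) \<partial>lborel)
     = ennreal (C * A) * ((\<integral>\<^sup>+y. F y \<partial>lborel) + (\<integral>\<^sup>+y. G y \<partial>lborel))"
    unfolding nn_integral_cmult[OF borel_measurable_add[OF measF measG']] nn_integral_add[OF measF measG'] ..
  have sF: "(\<integral>\<^sup>+y. F y \<partial>lborel) = ennreal (\<delta> powr decay * V)"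
    using emeasure_lborel_ball_finite[of "0 :: real ^ 'n" 1] unfolding F_def
    by (simp add: nn_integral_cmult_indicator V_def emeasure_eq_ennreal_measure ennreal_mult)
  define R where "R = V / (a ^ CARD('n) * L) * (2 powr decay / (1 - 2 powr (real CARD('n) - decay)))"
  have sG: "(\<integral>\<^sup>+y. G y \<partial>lborel) \<le> ennreal R"
    unfolding G_def R_def
  proof (rule nn_integral_decay[OF _ GS])
    show "emeasure lborel {y \<in> ball 0 1. w y \<le> t} \<le> ennreal (V / (a ^ CARD('n) * L) * t ^ CARD('n))" if "0 < t" for t
      using S(2)[OF _ _ that] by (simp add: w_def V_def)
  qed (use a L d in \<open>auto simp: w_def V_def\<close>)
  have "2 powr (real CARD('n) - decay) \<le> 1" using d powr_mono[of "real CARD('n) - decay" 0 2] by simp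
  then have R0: "0 \<le> R" using a L by (simp add: R_def V_def)
  have V0: "0 \<le> \<delta> powr decay * V" by (simp add: V_def)
  have "ennreal (cutoff_mass * norm (LINT x|lborel. integrand l x)) \<le> ennreal (C * A) * (ennreal (\<delta> powr decay * V) + (\<integral>\<^sup>+y. G y \<partial>lborel))"
    using order_trans[OF s1 s2] unfolding s3 sF .
  then have "ennreal (cutoff_mass * norm (LINT x|lborel. integrand l x)) \<le> ennreal (C * A) * (ennreal (\<delta> powr decay * V) + ennreal R)"
    by (rule order_trans) (intro mult_left_mono add_left_mono sG zero_le)
  then have "ennreal (cutoff_mass * norm (LINT x|lborel. integrand l x)) \<le> ennreal (C * A * (\<delta> powr decay * V + R))"
    using CA R0 V0 by (simp add: ennreal_mult ennreal_plus)
  then have "cutoff_mass * norm (LINT x|lborel. integrand l x) \<le> C * A * (\<delta> powr decay * V + R)"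
    using CA R0 V0 by (subst (asm) ennreal_le_iff) (auto intro!: mult_nonneg_nonneg add_nonneg_nonneg)
  then show ?thesis by (simp add: R_def a_def)
qed

end

section \<open>The norms of the phase and of the amplitude\<close>

lemma holder_quotients_cong:
  assumes "\<And>x. x \<in> S \<Longrightarrow> f x = g x"
  shows "holder_quotients b S f = holder_quotients b S g"
proof -
  have "(u = norm (f x - f y) / norm (x - y) powr b \<and> x \<in> S \<and> y \<in> S \<and> x \<noteq> y) \<longleftrightarrow>
      (u = norm (g x - g y) / norm (x - y) powr b \<and> x \<in> S \<and> y \<in> S \<and> x \<noteq> y)" for u x y
    using assms[of x] assms[of y] by auto
  then show ?thesis unfolding holder_quotients_def by simp
qed

text \<open>The suprema in the norm dominate the values only if they are suprema of bounded sets, and every one of them has to be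
non-negative for a single term to be dominated by the sum.\<close>

lemma Cr_norm_bounds:
  fixes g :: "real ^ 'n::finite \<Rightarrow> 'b::real_normed_vector"
  assumes S: "S = ball 0 1"
    and bd: "\<And>\<alpha>. mi_order \<alpha> \<le> nat \<lfloor>r\<rfloor> \<Longrightarrow> bounded (Dmi \<alpha> g ` S)"
    and hq: "\<And>\<alpha>. r \<notin> \<int> \<Longrightarrow> mi_order \<alpha> = nat \<lfloor>r\<rfloor> \<Longrightarrow> bdd_above (holder_quotients (frac r) S (Dmi \<alpha> g))"
  shows "0 \<le> Cr_norm r S g"
    and "\<And>\<alpha> x. mi_order \<alpha> \<le> nat \<lfloor>r\<rfloor> \<Longrightarrow> x \<in> S \<Longrightarrow> norm (Dmi \<alpha> g x) \<le> Cr_norm r S g"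
    and "\<And>\<alpha> x y. r \<notin> \<int> \<Longrightarrow> mi_order \<alpha> = nat \<lfloor>r\<rfloor> \<Longrightarrow> x \<in> S \<Longrightarrow> y \<in> S \<Longrightarrow>
           norm (Dmi \<alpha> g x - Dmi \<alpha> g y) \<le> Cr_norm r S g * norm (x - y) powr frac r"
proof -
  let ?k = "nat \<lfloor>r\<rfloor>"
  let ?s = "\<lambda>\<alpha>. SUP x\<in>S. norm (Dmi \<alpha> g x)"
  let ?h = "\<lambda>\<alpha>. holder_seminorm (frac r) S (Dmi \<alpha> g)"
  have fin: "finite {\<alpha> :: 'n \<Rightarrow> nat. mi_order \<alpha> \<le> ?k}" by (rule finite_multi_indices)
  have fin': "finite {\<alpha> :: 'n \<Rightarrow> nat. mi_order \<alpha> = ?k}" by (rule finite_subset[OF _ fin]) auto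
  have sup: "norm (Dmi \<alpha> g x) \<le> ?s \<alpha>" if "mi_order \<alpha> \<le> ?k" "x \<in> S" for \<alpha> x
  proof (rule cSUP_upper[OF that(2)])
    have "bounded (Dmi \<alpha> g ` S)" by (rule bd[OF that(1)])
    then obtain B where "\<forall>y\<in>Dmi \<alpha> g ` S. norm y \<le> B" unfolding bounded_iff by blast
    then show "bdd_above ((\<lambda>x. norm (Dmi \<alpha> g x)) ` S)" by (intro bdd_aboveI2[of _ _ B]) auto
  qed
  have s0: "0 \<le> ?s \<alpha>" if "mi_order \<alpha> \<le> ?k" for \<alpha>
    using order_trans[OF norm_ge_zero sup[OF that, of 0]] by (simp add: S)
  have hold: "norm (Dmi \<alpha> g x - Dmi \<alpha> g y) / norm (x - y) powr frac r \<le> ?h \<alpha>"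
    if "r \<notin> \<int>" "mi_order \<alpha> = ?k" "x \<in> S" "y \<in> S" "x \<noteq> y" for \<alpha> x y
    unfolding holder_seminorm_def
  proof (rule cSup_upper[OF _ hq[OF that(1,2)]])
    show "norm (Dmi \<alpha> g x - Dmi \<alpha> g y) / norm (x - y) powr frac r \<in> holder_quotients (frac r) S (Dmi \<alpha> g)"
      unfolding holder_quotients_def using that(3-5) by blast
  qed
  have h0: "0 \<le> ?h \<alpha>" if "r \<notin> \<int>" "mi_order \<alpha> = ?k" for \<alpha>
  proof -
    have ne: "(0 :: real ^ 'n) \<noteq> (1 / 2) *\<^sub>R axis undefined 1"
      by (metis axis_eq_0_iff scaleR_eq_0_iff zero_neq_one divide_eq_0_iff zero_neq_numeral)
    have "0 \<le> norm (Dmi \<alpha> g 0 - Dmi \<alpha> g ((1 / 2) *\<^sub>R axis undefined 1)) / norm (0 - (1 / 2) *\<^sub>R axis undefined 1 :: real ^ 'n) powr frac r"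
      by (intro divide_nonneg_nonneg) auto
    also have "\<dots> \<le> ?h \<alpha>" by (rule hold[OF that _ _ ne]) (auto simp: S)
    finally show ?thesis .
  qed
  have eq: "Cr_norm r S g = (\<Sum>\<alpha> | mi_order \<alpha> \<le> ?k. ?s \<alpha>) + (if r \<in> \<int> then 0 else \<Sum>\<alpha> | mi_order \<alpha> = ?k. ?h \<alpha>)"
    by (simp add: Cr_norm_def Ck_norm_def)
  have a0: "0 \<le> (\<Sum>\<alpha> | mi_order \<alpha> \<le> ?k. ?s \<alpha>)" using s0 by (intro sum_nonneg) auto
  have b0: "0 \<le> (if r \<in> \<int> then 0 else \<Sum>\<alpha> | mi_order \<alpha> = ?k. ?h \<alpha>)" using h0 by (auto intro!: sum_nonneg)
  show nn: "0 \<le> Cr_norm r S g" using a0 b0 unfolding eq by simp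
  show "norm (Dmi \<alpha> g x) \<le> Cr_norm r S g" if "mi_order \<alpha> \<le> ?k" "x \<in> S" for \<alpha> x
  proof -
    have "?s \<alpha> \<le> (\<Sum>\<alpha> | mi_order \<alpha> \<le> ?k. ?s \<alpha>)" using that s0 fin by (intro member_le_sum) auto
    then show ?thesis using sup[OF that] b0 unfolding eq by linarith
  qed
  show "norm (Dmi \<alpha> g x - Dmi \<alpha> g y) \<le> Cr_norm r S g * norm (x - y) powr frac r"
    if r: "r \<notin> \<int>" "mi_order \<alpha> = ?k" "x \<in> S" "y \<in> S" for \<alpha> x y
  proof (cases "x = y")
    case False
    have "?h \<alpha> \<le> (\<Sum>\<alpha> | mi_order \<alpha> = ?k. ?h \<alpha>)" using r h0 fin' by (intro member_le_sum) auto
    then have "norm (Dmi \<alpha> g x - Dmi \<alpha> g y) / norm (x - y) powr frac r \<le> Cr_norm r S g"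
      using hold[OF r False] a0 r(1) unfolding eq by simp
    then show ?thesis using False by (simp add: field_simps)
  qed simp
qed

text \<open>A derivative of order at least two along any list of directions is, up to the order of differentiation, one of the
functions \<open>D\<^sup>\<alpha> D\<^sup>\<beta> \<Phi>\<close> with \<open>|\<beta>| = 2\<close> that enter \<open>Pnorm\<close>.\<close>

lemma Cr_on_derivative_bounds:
  fixes \<Phi> :: "real ^ 'n::finite \<Rightarrow> real"
  assumes C: "Cr_on r (ball 0 1) \<Phi>" and r: "2 \<le> r"
  shows "0 \<le> Pnorm r \<Phi>"
    and "2 \<le> length is \<Longrightarrow> length is \<le> nat \<lfloor>r\<rfloor> \<Longrightarrow> x \<in> ball 0 1 \<Longrightarrow> \<bar>foldr partial is \<Phi> x\<bar> \<le> Pnorm r \<Phi>"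
    and "r \<notin> \<int> \<Longrightarrow> length is = nat \<lfloor>r\<rfloor> \<Longrightarrow> x \<in> ball 0 1 \<Longrightarrow> y \<in> ball 0 1 \<Longrightarrow>
           \<bar>foldr partial is \<Phi> x - foldr partial is \<Phi> y\<bar> \<le> Pnorm r \<Phi> * norm (x - y) powr frac r"
proof -
  let ?U = "ball 0 1 :: (real ^ 'n) set"
  let ?n = "nat \<lfloor>r\<rfloor>"
  have Ck: "Ck_on ?n ?U \<Phi>" using C by (simp add: Cr_on_def)
  have fl: "nat \<lfloor>r - 2\<rfloor> = ?n - 2" "2 \<le> ?n" using r by linarith+
  have Zr: "r - 2 \<in> \<int> \<longleftrightarrow> r \<in> \<int>" by (metis Ints_add Ints_diff Ints_numeral diff_add_cancel)
  have fr: "frac (r - 2) = frac r" by (simp add: frac_def)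
  have comp: "Dmi \<alpha> (Dmi \<beta> \<Phi>) x = Dmi (\<lambda>i. \<alpha> i + \<beta> i) \<Phi> x" "mi_order (\<lambda>i. \<alpha> i + \<beta> i) = mi_order \<alpha> + 2"
    if \<beta>: "mi_order \<beta> = 2" and \<alpha>: "mi_order \<alpha> \<le> ?n - 2" and x: "x \<in> ?U" for \<alpha> \<beta> :: "'n \<Rightarrow> nat" and x
  proof -
    obtain la where la: "\<And>i. count_list la i = \<alpha> i" "length la = mi_order \<alpha>" "Dmi \<alpha> (Dmi \<beta> \<Phi>) = foldr partial la (Dmi \<beta> \<Phi>)"
      by (rule Dmi_eq_foldr[of \<alpha>]) blast
    obtain lb where lb: "\<And>i. count_list lb i = \<beta> i" "length lb = mi_order \<beta>" "Dmi \<beta> \<Phi> = foldr partial lb \<Phi>"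
      by (rule Dmi_eq_foldr[of \<beta>]) blast
    have cl: "count_list (la @ lb) = (\<lambda>i. \<alpha> i + \<beta> i)" by (simp add: fun_eq_iff la(1) lb(1))
    have "Ck_on (length (la @ lb)) ?U \<Phi>" by (rule Ck_on_mono[OF Ck]) (use la lb \<alpha> \<beta> fl in simp)
    from Dmi_eq_on[OF open_ball this x] have e: "Dmi (\<lambda>i. \<alpha> i + \<beta> i) \<Phi> x = foldr partial la (foldr partial lb \<Phi>) x"
      by (simp add: cl)
    show "Dmi \<alpha> (Dmi \<beta> \<Phi>) x = Dmi (\<lambda>i. \<alpha> i + \<beta> i) \<Phi> x"
      by (subst la(3), subst lb(3), rule e[symmetric])
    show "mi_order (\<lambda>i. \<alpha> i + \<beta> i) = mi_order \<alpha> + 2"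
      using \<beta> by (simp add: mi_order_def sum.distrib)
  qed
  have bd: "bounded (Dmi \<alpha> (Dmi \<beta> \<Phi>) ` ?U)" if "mi_order \<beta> = 2" "mi_order \<alpha> \<le> nat \<lfloor>r - 2\<rfloor>" for \<alpha> \<beta>
  proof -
    have \<alpha>: "mi_order \<alpha> \<le> ?n - 2" using that(2) fl by simp
    have "Dmi \<alpha> (Dmi \<beta> \<Phi>) ` ?U = Dmi (\<lambda>i. \<alpha> i + \<beta> i) \<Phi> ` ?U"
      by (rule image_cong[OF refl comp(1)[OF that(1) \<alpha>]])
    moreover have "mi_order (\<lambda>i. \<alpha> i + \<beta> i) \<le> ?n" using comp(2)[OF that(1) \<alpha>, of 0] \<alpha> fl by simp
    ultimately show ?thesis using C by (simp add: Cr_on_def)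
  qed
  have hq: "bdd_above (holder_quotients (frac (r - 2)) ?U (Dmi \<alpha> (Dmi \<beta> \<Phi>)))"
    if "mi_order \<beta> = 2" "r - 2 \<notin> \<int>" "mi_order \<alpha> = nat \<lfloor>r - 2\<rfloor>" for \<alpha> \<beta>
  proof -
    have \<alpha>: "mi_order \<alpha> \<le> ?n - 2" using that(3) fl by simp
    have "holder_quotients (frac (r - 2)) ?U (Dmi \<alpha> (Dmi \<beta> \<Phi>)) = holder_quotients (frac r) ?U (Dmi (\<lambda>i. \<alpha> i + \<beta> i) \<Phi>)"
      unfolding fr by (rule holder_quotients_cong[OF comp(1)[OF that(1) \<alpha>]])
    moreover have "mi_order (\<lambda>i. \<alpha> i + \<beta> i) = mi_order \<alpha> + 2"
      by (rule comp(2)[OF that(1) \<alpha>, of 0]) simp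
    then have "mi_order (\<lambda>i. \<alpha> i + \<beta> i) = ?n" using that(3) fl by linarith
    ultimately show ?thesis using C that(2) Zr by (simp add: Cr_on_def)
  qed
  have fin: "finite {\<beta> :: 'n \<Rightarrow> nat. mi_order \<beta> = 2}"
    by (rule finite_subset[OF _ finite_multi_indices[of 2]]) auto
  have nn: "0 \<le> Cr_norm (r - 2) ?U (Dmi \<beta> \<Phi>)" if "mi_order \<beta> = 2" for \<beta>
    by (rule Cr_norm_bounds(1)[OF refl bd[OF that] hq[OF that]])
  show "0 \<le> Pnorm r \<Phi>" unfolding Pnorm_def using nn by (intro sum_nonneg) auto
  have le: "Cr_norm (r - 2) ?U (Dmi \<beta> \<Phi>) \<le> Pnorm r \<Phi>" if "mi_order \<beta> = 2" for \<beta>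
    unfolding Pnorm_def using that nn fin by (intro member_le_sum) auto
  have split: "\<exists>\<alpha> \<beta>. mi_order \<beta> = 2 \<and> mi_order \<alpha> = length is - 2 \<and>
       (\<forall>x\<in>?U. Dmi \<alpha> (Dmi \<beta> \<Phi>) x = foldr partial is \<Phi> x)" if l: "2 \<le> length is" "length is \<le> ?n" for "is"
  proof -
    let ?la = "take (length is - 2) is" and ?lb = "drop (length is - 2) is"
    have o: "mi_order (count_list ?lb) = 2" "mi_order (count_list ?la) = length is - 2"
      using l by (simp_all add: mi_order_count_list)
    have o': "mi_order (count_list ?la) \<le> ?n - 2" using l o by simp
    have Ckl: "Ck_on (length is) ?U \<Phi>" by (rule Ck_on_mono[OF Ck l(2)])
    have "(\<lambda>i. count_list ?la i + count_list ?lb i) = count_list is"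
      by (rule ext) (simp flip: count_list_append)
    then have "Dmi (count_list ?la) (Dmi (count_list ?lb) \<Phi>) x = foldr partial is \<Phi> x" if "x \<in> ?U" for x
      using comp(1)[OF o(1) o' that] Dmi_eq_on[OF open_ball Ckl that] by simp
    then show ?thesis using o by blast
  qed
  show "\<bar>foldr partial is \<Phi> x\<bar> \<le> Pnorm r \<Phi>" if h: "2 \<le> length is" "length is \<le> ?n" "x \<in> ?U"
  proof -
    obtain \<alpha> \<beta> where ab: "mi_order \<beta> = 2" "mi_order \<alpha> = length is - 2"
       "\<forall>x\<in>?U. Dmi \<alpha> (Dmi \<beta> \<Phi>) x = foldr partial is \<Phi> x" using split[OF h(1,2)] by blast
    have "norm (Dmi \<alpha> (Dmi \<beta> \<Phi>) x) \<le> Cr_norm (r - 2) ?U (Dmi \<beta> \<Phi>)"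
      by (rule Cr_norm_bounds(2)[OF refl bd[OF ab(1)] hq[OF ab(1)] _ h(3)]) (use ab h fl in auto)
    then show ?thesis using le[OF ab(1)] ab(3) h(3) by auto
  qed
  show "\<bar>foldr partial is \<Phi> x - foldr partial is \<Phi> y\<bar> \<le> Pnorm r \<Phi> * norm (x - y) powr frac r"
    if h: "r \<notin> \<int>" "length is = ?n" "x \<in> ?U" "y \<in> ?U"
  proof -
    have l: "2 \<le> length is" "length is \<le> ?n" using h fl by auto
    obtain \<alpha> \<beta> where ab: "mi_order \<beta> = 2" "mi_order \<alpha> = length is - 2"
       "\<forall>x\<in>?U. Dmi \<alpha> (Dmi \<beta> \<Phi>) x = foldr partial is \<Phi> x" using split[OF l] by blast
    have "norm (Dmi \<alpha> (Dmi \<beta> \<Phi>) x - Dmi \<alpha> (Dmi \<beta> \<Phi>) y) \<le> Cr_norm (r - 2) ?U (Dmi \<beta> \<Phi>) * norm (x - y) powr frac (r - 2)"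
      by (rule Cr_norm_bounds(3)[OF refl bd[OF ab(1)] hq[OF ab(1)] _ _ h(3,4)]) (use ab h fl Zr in auto)
    also have "\<dots> \<le> Pnorm r \<Phi> * norm (x - y) powr frac r"
      unfolding fr using le[OF ab(1)] by (intro mult_right_mono) auto
    finally show ?thesis using ab(3) h(3,4) by simp
  qed
qed

lemma partial_power_eq_0:
  assumes "open S" "\<And>y. y \<in> S \<Longrightarrow> f y = 0" "x \<in> S"
  shows "(partial i ^^ m) f x = 0"
  using assms(3)
proof (induction m arbitrary: x)
  case (Suc m)
  have "partial i ((partial i ^^ m) f) x = partial i (\<lambda>_. 0) x"
    by (rule partial_cong_open(2)[OF assms(1) Suc.prems Suc.IH])
  also have "\<dots> = 0" by (simp add: partial_def)
  finally show ?case by simp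
qed (simp add: assms)

lemma Cck_derivative_bounds:
  fixes \<psi> :: "real ^ 'n::finite \<Rightarrow> complex"
  assumes \<psi>: "Cck K (ball 0 \<rho>) \<psi>" and "\<rho> < 1" and "m \<le> K"
  shows "norm ((partial i ^^ m) \<psi> x) \<le> Anorm (real K) \<psi>"
proof -
  have Ck: "Ck_on K UNIV \<psi>" by (rule Cck_imp_Ck_on_UNIV[OF open_ball \<psi>])
  have bd: "bounded (Dmi \<alpha> \<psi> ` ball 0 1)" if "mi_order \<alpha> \<le> nat \<lfloor>real K\<rfloor>" for \<alpha>
  proof -
    obtain la where la: "length la = mi_order \<alpha>" "Dmi \<alpha> \<psi> = foldr partial la \<psi>"
      by (rule Dmi_eq_foldr[of \<alpha>]) blast
    have "Ck_on (length la + 0) UNIV \<psi>" by (rule Ck_on_mono[OF Ck]) (use la that in simp)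
    then have "Ck_on 0 UNIV (foldr partial la \<psi>)" by (rule Ck_on_foldr_partial)
    then have "continuous_on (cball 0 1) (Dmi \<alpha> \<psi>)" using la by (auto intro: continuous_on_subset)
    then have "bounded (Dmi \<alpha> \<psi> ` cball 0 1)" by (intro compact_imp_bounded compact_continuous_image) auto
    then show ?thesis by (rule bounded_subset) auto
  qed
  show ?thesis
  proof (cases "norm x < 1")
    case True
    have "norm (Dmi (\<lambda>j. if j = i then m else 0) \<psi> x) \<le> Cr_norm (real K) (ball 0 1) \<psi>"
      by (rule Cr_norm_bounds(2)[OF refl bd]) (use True assms(3) in \<open>auto simp: mi_order_axis\<close>)
    then show ?thesis by (simp add: Dmi_axis Anorm_def)
  next
    case False
    have "(partial i ^^ m) \<psi> x = 0"
    proof (rule partial_power_eq_0)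
      show "open (- closure {x. \<psi> x \<noteq> 0})" by (rule open_Compl[OF closed_closure])
      show "x \<in> - closure {x. \<psi> x \<noteq> 0}" using False \<psi> assms(2) by (force simp: Cck_def)
      show "\<psi> y = 0" if "y \<in> - closure {x. \<psi> x \<noteq> 0}" for y
        using that closure_subset[of "{x. \<psi> x \<noteq> 0}"] by auto
    qed
    moreover have "0 \<le> Cr_norm (real K) (ball 0 1) \<psi>" by (rule Cr_norm_bounds(1)[OF refl bd]) auto
    ultimately show ?thesis by (simp add: Anorm_def)
  qed
qed

lemma abs_det_le:
  fixes A :: "real ^ 'n::finite ^ 'n"
  assumes "\<And>i j. \<bar>A $ i $ j\<bar> \<le> M"
  shows "\<bar>det A\<bar> \<le> fact CARD('n) * M ^ CARD('n)"
proof -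
  have "\<bar>det A\<bar> \<le> (\<Sum>p | p permutes (UNIV :: 'n set). M ^ CARD('n))"
    unfolding det_def
  proof (rule order_trans[OF sum_abs], rule sum_mono)
    fix p :: "'n \<Rightarrow> 'n"
    have "\<bar>of_int (sign p) * (\<Prod>i\<in>UNIV. A $ i $ p i)\<bar> = (\<Prod>i\<in>UNIV. \<bar>A $ i $ p i\<bar>)"
      by (simp add: abs_mult abs_prod sign_def)
    also have "\<dots> \<le> (\<Prod>i\<in>(UNIV :: 'n set). M)" using assms by (intro prod_mono) auto
    finally show "\<bar>of_int (sign p) * (\<Prod>i\<in>UNIV. A $ i $ p i)\<bar> \<le> M ^ CARD('n)" by simp
  qed
  also have "\<dots> = fact CARD('n) * M ^ CARD('n)"
    using card_permutations[of "UNIV :: 'n set" "CARD('n)"] by simp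
  finally show ?thesis .
qed

lemma grad_has_derivative:
  fixes \<Phi> :: "real ^ 'n::finite \<Rightarrow> real"
  assumes "open S" "Ck_on 2 S \<Phi>" "x \<in> S"
  shows "(grad \<Phi> has_derivative (\<lambda>v. transpose (hessian \<Phi> x) *v v)) (at x)"
proof -
  have "Ck_on 1 S (partial i \<Phi>)" for i using assms(2) by (simp add: numeral_2_eq_2)
  then have d: "(partial i \<Phi> has_derivative (\<lambda>v. \<Sum>j\<in>UNIV. v $ j * partial j (partial i \<Phi>) x)) (at x)" for i
    by (rule has_derivative_of_continuous_partials[OF assms(1,3)])
  have "((\<lambda>y. grad \<Phi> y \<bullet> axis i 1) has_derivative (\<lambda>v. (transpose (hessian \<Phi> x) *v v) \<bullet> axis i 1)) (at x)" for i
    using d[of i] by (simp add: grad_def inner_axis matrix_vector_mult_def transpose_def hessian_def mult.commute)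
  then show ?thesis
    by (subst has_derivative_componentwise_within) (auto simp: Basis_vec_def)
qed

lemma partial_lipschitz:
  fixes f :: "real ^ 'n::finite \<Rightarrow> real"
  assumes "convex S" "open S" "Ck_on 1 S f" "\<And>i z. z \<in> S \<Longrightarrow> \<bar>partial i f z\<bar> \<le> P" "x \<in> S" "y \<in> S"
  shows "\<bar>f x - f y\<bar> \<le> real CARD('n) * P * norm (x - y)"
proof -
  define F where "F z v = (\<Sum>i\<in>UNIV. v $ i * partial i f z)" for z v
  have D: "(f has_derivative F z) (at z within S)" if "z \<in> S" for z
    unfolding F_def
    by (rule has_derivative_at_withinI[OF has_derivative_of_continuous_partials[OF assms(2) that assms(3)]])
  have O: "onorm (F z) \<le> real CARD('n) * P" if z: "z \<in> S" for z
  proof (rule onorm_le)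
    fix v :: "real ^ 'n"
    have "\<bar>F z v\<bar> \<le> (\<Sum>i\<in>(UNIV :: 'n set). norm v * P)"
      unfolding F_def
    proof (rule order_trans[OF sum_abs], rule sum_mono)
      fix i
      have "\<bar>v $ i\<bar> * \<bar>partial i f z\<bar> \<le> norm v * P"
        by (rule mult_mono[OF component_le_norm_cart assms(4)[OF z]]) auto
      then show "\<bar>v $ i * partial i f z\<bar> \<le> norm v * P" by (simp only: abs_mult)
    qed
    then show "norm (F z v) \<le> real CARD('n) * P * norm v" by (simp add: mult_ac)
  qed
  from differentiable_bound[OF assms(1) D O assms(5,6)] show ?thesis by simp
qed

text \<open>If \<open>r \<ge> K + 1\<close>, then the Hoelder condition with exponent 1 comes from the bound on the derivative of order \<open>K + 1\<close>. Otherwise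
\<open>K\<close> is the integer part of \<open>r\<close> and the condition is the one contained in the norm; in that case \<open>K \<ge> 2\<close> because \<open>r \<ge> 2\<close>.\<close>

lemma stationary_phase_data_of_norms:
  fixes \<Phi> :: "real ^ 'n::finite \<Rightarrow> real" and \<psi> :: "real ^ 'n \<Rightarrow> complex" and r eps :: real
  defines "K \<equiv> CARD('n) div 2 + 1"
  assumes r: "r > (real CARD('n) + 2) / 2" "2 \<le> r" and eps: "0 < eps" "eps < 1"
    and \<Phi>: "Cr_on r (ball 0 1) \<Phi>" and \<psi>: "Cck K (ball 0 (1 - eps)) \<psi>"
  shows "stationary_phase_data \<Phi> \<psi> K (min 1 (r - real K)) (Pnorm r \<Phi>) (Anorm (real K) \<psi>) eps"
proof -
  let ?n = "nat \<lfloor>r\<rfloor>" and ?P = "Pnorm r \<Phi>"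
  have "real (CARD('n) div 2) \<le> real CARD('n) / 2" by linarith
  then have Kr: "real K < r" using r(1) by (simp add: K_def)
  then have Kn: "K \<le> ?n" by linarith
  have n2: "2 \<le> ?n" using r(2) by linarith
  have K0: "0 < K" by (simp add: K_def)
  have Ck: "Ck_on ?n (ball 0 1) \<Phi>" using \<Phi> by (simp add: Cr_on_def)
  have pow: "(partial i ^^ m) \<Phi> = foldr partial (replicate m i) \<Phi>" for i m by simp
  note bds = Cr_on_derivative_bounds[OF \<Phi> r(2)]
  show ?thesis
  proof
    show "\<bar>(partial i ^^ m) \<Phi> x\<bar> \<le> ?P" if "2 \<le> m" "m \<le> K" "norm x < 1" for i m and x :: "real ^ 'n"
      unfolding pow by (rule bds(2)) (use that Kn in auto)
    show "\<bar>(partial i ^^ K) \<Phi> (x + s *\<^sub>R axis i 1) - (partial i ^^ K) \<Phi> x\<bar> \<le> ?P * s powr min 1 (r - real K)"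
      if s: "0 \<le> s" "s \<le> 1" and x: "norm x < 1" "norm (x + s *\<^sub>R axis i 1) < 1" for i s and x :: "real ^ 'n"
    proof (cases "r \<ge> real K + 1")
      case True
      then have Kn1: "Suc K \<le> ?n" by linarith
      show ?thesis
      proof (cases "s = 0")
        case False
        \<comment> \<open>The segment stays in the ball by convexity.\<close>
        have seg: "x + t *\<^sub>R axis i 1 \<in> ball 0 1" if "0 \<le> t" "t \<le> s" for t
        proof -
          have "(1 - t / s) *\<^sub>R x + (t / s) *\<^sub>R (x + s *\<^sub>R axis i 1) \<in> ball 0 1"
            using x that s False by (intro convexD_alt[OF convex_ball]) auto
          moreover have "(1 - t / s) *\<^sub>R x + (t / s) *\<^sub>R (x + s *\<^sub>R axis i 1) = x + t *\<^sub>R axis i 1"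
            using False by (simp add: algebra_simps)
          ultimately show ?thesis by simp
        qed
        have der: "((\<lambda>t. (partial i ^^ K) \<Phi> (x + t *\<^sub>R axis i 1)) has_real_derivative
            (partial i ^^ Suc K) \<Phi> (x + t *\<^sub>R axis i 1)) (at t)" if "0 \<le> t" "t \<le> s" for t
          unfolding has_real_derivative_iff_has_vector_derivative funpow.simps o_apply
          by (intro has_vector_derivative_line Ck_on_has_partial_power[OF Ck] seg that) (use Kn1 in simp)
        have "0 < s" using s False by simp
        from MVT2[OF this der] obtain t where t: "0 < t" "t < s"
          "(partial i ^^ K) \<Phi> (x + s *\<^sub>R axis i 1) - (partial i ^^ K) \<Phi> (x + 0 *\<^sub>R axis i 1)
             = (s - 0) * (partial i ^^ Suc K) \<Phi> (x + t *\<^sub>R axis i 1)"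
          by blast
        have "\<bar>(partial i ^^ Suc K) \<Phi> (x + t *\<^sub>R axis i 1)\<bar> \<le> ?P"
          unfolding pow by (rule bds(2)) (use Kn1 K0 seg[of t] t in auto)
        then have "\<bar>(partial i ^^ K) \<Phi> (x + s *\<^sub>R axis i 1) - (partial i ^^ K) \<Phi> x\<bar> \<le> s * ?P"
          using t(3) s by (simp add: abs_mult mult_left_mono del: funpow.simps)
        then show ?thesis using True s by (simp add: min_def mult.commute)
      qed simp
    next
      case False
      have fl: "\<lfloor>r\<rfloor> = int K" using Kr False by (intro floor_unique) auto
      then have "r \<notin> \<int>" using Kr by (metis Ints_cases floor_of_int less_irrefl of_int_of_nat_eq)
      moreover have "length (replicate K i) = ?n" using fl by simp
      ultimately have "\<bar>(partial i ^^ K) \<Phi> (x + s *\<^sub>R axis i 1) - (partial i ^^ K) \<Phi> x\<bar>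
         \<le> ?P * norm (x + s *\<^sub>R axis i 1 - x) powr frac r"
        unfolding pow by (rule bds(3)) (use x in auto)
      moreover have "frac r = min 1 (r - real K)" using fl False Kr by (simp add: frac_def)
      ultimately show ?thesis using s by simp
    qed
    show "\<bar>partial i \<Phi> x - partial i \<Phi> y\<bar> \<le> real CARD('n) * ?P * norm (x - y)"
      if "norm x < 1" "norm y < 1" for i and x y :: "real ^ 'n"
    proof (rule partial_lipschitz[of "ball 0 1"])
      have "Ck_on (Suc 1) (ball 0 1) \<Phi>" by (rule Ck_on_mono[OF Ck]) (use n2 in simp)
      then show "Ck_on 1 (ball 0 1) (partial i \<Phi>)" by simp
      show "\<bar>partial j (partial i \<Phi>) z\<bar> \<le> ?P" if "z \<in> ball 0 1" for j z
        using bds(2)[of "[j, i]" z] n2 that by simp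
    qed (use that in auto)
    show "Ck_on K (ball 0 1) \<Phi>" by (rule Ck_on_mono[OF Ck Kn])
    show "Ck_on K UNIV \<psi>" by (rule Cck_imp_Ck_on_UNIV[OF open_ball \<psi>])
    show "norm ((partial i ^^ m) \<psi> x) \<le> Anorm (real K) \<psi>" if "m \<le> K" for i m x
      by (rule Cck_derivative_bounds[OF \<psi> _ that]) (use eps in simp)
    show "\<psi> x = 0" if "1 - eps \<le> norm x" for x
      using \<psi> that closure_subset[of "{x. \<psi> x \<noteq> 0}"] by (force simp: Cck_def)
  qed (use K0 Kr eps r(2) in \<open>auto simp: min_def\<close>)
qed

section \<open>The stationary phase estimate\<close>

lemma trivial_integral_bound:
  assumes "stationary_phase_data (\<Phi> :: real ^ 'n::finite \<Rightarrow> real) \<psi> K b P A eps"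
  shows "norm (osc_integral l \<Phi> \<psi>) \<le> A * measure lborel (ball (0 :: real ^ 'n) 1)"
proof -
  interpret stationary_phase_data \<Phi> \<psi> K b P A eps by fact
  have "norm (osc_integral l \<Phi> \<psi>) \<le> (LINT x|lborel. norm (integrand l x))"
    unfolding osc_integral_def integrand_def by (rule integral_norm_bound)
  also have "\<dots> \<le> (LINT x|lborel. A * indicator (ball (0 :: real ^ 'n) 1) x)"
  proof (rule integral_mono')
    show "integrable lborel (\<lambda>x. A * indicator (ball (0 :: real ^ 'n) 1) x)"
      using emeasure_lborel_ball_finite[of "0 :: real ^ 'n" 1]
      by (intro integrable_mult_right integrable_real_indicator) auto
    show "norm (integrand l x) \<le> A * indicator (ball 0 1) x" for x
      using norm_integrand_le[of l x] integrand_eq_0[of x l] eps by (cases "norm x < 1") auto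
    show "0 \<le> A * indicator (ball 0 1) x" for x :: "real ^ 'n"
      using A_nonneg by (simp add: indicator_def)
  qed
  also have "\<dots> = A * measure lborel (ball (0 :: real ^ 'n) 1)" by simp
  finally show ?thesis .
qed

text \<open>The first summand is the constant for \<open>\<delta> \<le> eps / 8\<close>, where cells fit between the support of the amplitude and the
boundary of the ball; the second one is the constant for larger \<open>\<delta>\<close>, where the trivial bound suffices.\<close>

definition phase_const :: "'n::finite itself \<Rightarrow> nat \<Rightarrow> real \<Rightarrow> real \<Rightarrow> real" where
  "phase_const (_ :: 'n itself) K b eps =
    (let d = CARD('n); M = 2 * (real K + b) - 2; V = measure lborel (ball (0 :: real ^ 'n) 1) in
       decay_const K b (real d) (measure lborel (cball (0 :: real ^ 'n) 2)) * V
         * (fact d + real d ^ d * (2 powr M / (1 - 2 powr (real d - M))))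
         / ((3 / 4) ^ (2 * K) * measure lborel (cball (0 :: real ^ 'n) (1 / 2)))
       + V * (8 / eps) ^ d * fact d)"

text \<open>The choice \<open>\<delta>\<^sup>2 = 1 / (l Q)\<close> with \<open>Q = max 1 P\<close> balances the scale against the second derivatives and turns \<open>1 / (l \<delta>)\<close> into \<open>\<delta> Q\<close>,
so that the right-hand side of \<open>integral_bound\<close> becomes \<open>(\<delta> Q)\<^sup>d / L = l\<^bsup>-d/2\<^esup> Q\<^bsup>d/2\<^esup> / L\<close>. The term \<open>\<delta>\<^sup>M\<close> carries no factor \<open>1 / L\<close>; it is absorbed because
a determinant is bounded by the entries of the matrix, which gives \<open>L \<le> d! Q\<^sup>d\<close>.\<close>

lemma (in stationary_phase_data) stationary_phase_bound:
  assumes cont: "continuous_on (ball 0 1) (grad \<Phi>)" and inj: "inj_on (grad \<Phi>) (ball 0 1)"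
    and der: "\<And>x. x \<in> ball 0 1 \<Longrightarrow> (grad \<Phi> has_derivative (\<lambda>v. H x *v v)) (at x)"
    and L: "0 < L" "\<And>x. x \<in> ball 0 1 \<Longrightarrow> L \<le> \<bar>det (H x)\<bar>"
    and H: "\<And>x i j. x \<in> ball 0 1 \<Longrightarrow> \<bar>H x $ i $ j\<bar> \<le> P"
    and l: "1 \<le> l" and d: "real CARD('n) < decay"
  shows "l powr (real CARD('n) / 2) * norm (osc_integral l \<Phi> \<psi>)
    \<le> phase_const TYPE('n) K b eps / L * (1 + P powr (real CARD('n) / 2)) * A"
proof -
  define dd where "dd = CARD('n)"
  define Q where "Q = max 1 P"
  define \<delta> where "\<delta> = 1 / sqrt (l * Q)"
  define V where "V = measure lborel (ball (0 :: real ^ 'n) 1)"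
  define C where "C = decay_const K b (real dd) (measure lborel (cball (0 :: real ^ 'n) 2))"
  define R where "R = 2 powr decay / (1 - 2 powr (real dd - decay))"
  define c0 where "c0 = (3 / 4) ^ (2 * K) * measure lborel (cball (0 :: real ^ 'n) (1 / 2))"
  define I where "I = norm (osc_integral l \<Phi> \<psi>)"
  have pc: "phase_const TYPE('n) K b eps = C * V * (fact dd + real dd ^ dd * R) / c0 + V * (8 / eps) ^ dd * fact dd"
    by (simp add: phase_const_def Let_def C_def V_def R_def c0_def dd_def decay_def)
  have Q: "1 \<le> Q" "P \<le> Q" by (auto simp: Q_def)
  have lQ: "1 \<le> l * Q" using mult_mono[of 1 l 1 Q] l Q by simp
  have \<delta>: "0 < \<delta>" "\<delta> \<le> 1" "\<delta>\<^sup>2 = 1 / (l * Q)"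
    using lQ by (auto simp: \<delta>_def power_divide field_simps)
  have dd: "0 < dd" "real dd < decay" using d by (auto simp: dd_def)
  have V0: "0 \<le> V" by (simp add: V_def)
  have C0: "0 \<le> C" unfolding C_def by (intro decay_const_nonneg) auto
  have c00: "0 < c0" unfolding c0_def by (simp add: content_cball_pos)
  have "2 powr (real dd - decay) \<le> 1" using dd powr_mono[of "real dd - decay" 0 2] by simp
  then have R0: "0 \<le> R" by (simp add: R_def)
  \<comment> \<open>This absorbs the terms that do not carry the factor \<open>1 / L\<close>.\<close>
  have Ldet: "1 \<le> fact dd * Q ^ dd / L"
  proof -
    have "L \<le> \<bar>det (H 0)\<bar>" using L by simp
    also have "\<dots> \<le> fact dd * P ^ dd" unfolding dd_def by (rule abs_det_le) (simp add: H)
    also have "\<dots> \<le> fact dd * Q ^ dd" using Q P_nonneg by (intro mult_left_mono power_mono) auto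
    finally show ?thesis using L by simp
  qed
  define G where "G = \<delta> ^ dd * Q ^ dd / L"
  have G0: "0 \<le> G" using \<delta> Q L by (simp add: G_def)
  have small: "\<delta> ^ dd \<le> fact dd * G"
    using mult_left_mono[OF Ldet, of "\<delta> ^ dd"] \<delta> by (simp add: G_def mult_ac)
  have "I \<le> phase_const TYPE('n) K b eps * A * G"
  proof (cases "\<delta> \<le> eps / 8")
    case True
    have lP: "l * \<delta>\<^sup>2 * P \<le> 1" 
    proof -
      have "l * \<delta>\<^sup>2 * P = P / Q" using \<delta>(3) l by simp
      then show ?thesis using Q by simp
    qed
    have "c0 * I \<le> cutoff_mass * I"
      unfolding I_def c0_def using cutoff_mass_pos by (intro mult_right_mono) auto
    also have "\<dots> \<le> C * A * (\<delta> powr decay * V + V / ((l * \<delta> / real dd) ^ dd * L) * R)"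
      using integral_bound[OF cont inj der L _ \<delta>(1) True lP d] l
      by (simp add: I_def osc_integral_def integrand_def C_def V_def R_def dd_def)
    also have "\<dots> \<le> C * A * (fact dd * G * V + V * (real dd ^ dd * G) * R)"
    proof -
      have "\<delta> powr decay \<le> \<delta> powr real dd" using \<delta> dd by (intro powr_mono') auto
      then have 1: "\<delta> powr decay \<le> fact dd * G" using small \<delta> by (simp add: powr_realpow)
      have "1 / (l * \<delta>) = \<delta> * Q" using \<delta>(1,3) l Q by (simp add: field_simps power2_eq_square)
      then have "real dd * (\<delta> * Q) = real dd / (l * \<delta>)" by (metis times_divide_eq_right mult.right_neutral)
      then have "(real dd * (\<delta> * Q)) ^ dd / L = (real dd / (l * \<delta>)) ^ dd / L" by simp
      then have 2: "real dd ^ dd * G = 1 / ((l * \<delta> / real dd) ^ dd * L)"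
        by (simp add: G_def power_mult_distrib power_divide mult_ac)
      have "V / ((l * \<delta> / real dd) ^ dd * L) = V * (real dd ^ dd * G)" unfolding 2 by simp
      then show ?thesis using 1 C0 A_nonneg V0 R0
        by (intro mult_left_mono add_mono mult_right_mono) auto
    qed
    also have "\<dots> = c0 * ((C * V * (fact dd + real dd ^ dd * R) / c0) * A * G)"
      using c00 by (simp add: field_simps)
    finally have "I \<le> (C * V * (fact dd + real dd ^ dd * R) / c0) * A * G"
      using c00 by (rule mult_left_le_imp_le)
    also have "\<dots> \<le> phase_const TYPE('n) K b eps * A * G"
      unfolding pc using V0 eps A_nonneg G0 by (intro mult_right_mono) auto
    finally show ?thesis .
  next
    case False
    have "1 \<le> 8 / eps * \<delta>" using False eps by (simp add: field_simps)
    then have "1 \<le> (8 / eps * \<delta>) ^ dd" by (rule one_le_power)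
    also have "\<dots> \<le> (8 / eps) ^ dd * (fact dd * G)"
      unfolding power_mult_distrib using small eps by (intro mult_left_mono) auto
    finally have "A * V * 1 \<le> A * V * ((8 / eps) ^ dd * (fact dd * G))"
      using A_nonneg V0 by (intro mult_left_mono) auto
    then have "I \<le> (V * (8 / eps) ^ dd * fact dd) * A * G"
      using trivial_integral_bound[OF stationary_phase_data_axioms, of l] by (simp add: I_def V_def mult_ac)
    also have "\<dots> \<le> phase_const TYPE('n) K b eps * A * G"
      unfolding pc using V0 C0 c00 R0 A_nonneg G0 by (intro mult_right_mono) auto
    finally show ?thesis .
  qed
  then have "l powr (real dd / 2) * I \<le> l powr (real dd / 2) * (phase_const TYPE('n) K b eps * A * G)"
    by (intro mult_left_mono) auto
  also have "\<dots> = phase_const TYPE('n) K b eps / L * Q powr (real dd / 2) * A"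
  proof -
    have "\<delta> * Q = sqrt (Q / l)"
      using l Q by (simp add: \<delta>_def real_sqrt_mult real_sqrt_divide field_simps)
    then have "(\<delta> * Q) ^ dd = ((Q / l) powr (1 / 2)) powr real dd"
      using l Q by (simp add: powr_half_sqrt powr_realpow)
    also have "\<dots> = Q powr (real dd / 2) / l powr (real dd / 2)"
      using l Q by (simp add: powr_powr powr_divide)
    finally have "l powr (real dd / 2) * (\<delta> * Q) ^ dd = Q powr (real dd / 2)" using l by simp
    then show ?thesis by (simp add: G_def power_mult_distrib mult_ac)
  qed
  also have "\<dots> \<le> phase_const TYPE('n) K b eps / L * (1 + P powr (real dd / 2)) * A"
  proof -
    have "Q powr (real dd / 2) \<le> 1 + P powr (real dd / 2)" by (auto simp: Q_def max_def)
    moreover have "0 \<le> phase_const TYPE('n) K b eps / L"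
      unfolding pc using V0 C0 c00 R0 L eps by (auto intro!: divide_nonneg_nonneg add_nonneg_nonneg mult_nonneg_nonneg)
    ultimately show ?thesis using A_nonneg by (intro mult_right_mono mult_left_mono) auto
  qed
  finally show ?thesis by (simp add: dd_def I_def)
qed

theorem theorem1p2:
  fixes n0 eps0 :: real
  assumes "n0 > (real CARD('n::finite) + 2) / 2" and "n0 \<ge> 2"
    and "0 < eps0" and "eps0 < 1"
  shows "\<exists>C::real. \<forall>(\<Phi> :: real ^ 'n \<Rightarrow> real) (\<psi> :: real ^ 'n \<Rightarrow> complex).
           Cr_on n0 (ball 0 1) \<Phi> \<longrightarrow>
           Cck (CARD('n) div 2 + 1) (ball 0 (1 - eps0)) \<psi> \<longrightarrow>
           inj_on (grad \<Phi>) (ball 0 1) \<longrightarrow>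
           Lstar \<Phi> > 0 \<longrightarrow>
           (\<forall>l\<ge>1. l powr (real CARD('n) / 2) * norm (osc_integral l \<Phi> \<psi>)
              \<le> C / Lstar \<Phi> * (1 + Pnorm n0 \<Phi> powr (real CARD('n) / 2))
                  * Anorm (real (CARD('n) div 2 + 1)) \<psi>)"
proof -
  define K where "K = CARD('n) div 2 + 1"
  define b where "b = min 1 (n0 - real K)"
  show ?thesis
  proof (intro exI[of _ "phase_const TYPE('n) K b eps0"] allI impI)
    fix \<Phi> :: "real ^ 'n \<Rightarrow> real" and \<psi> :: "real ^ 'n \<Rightarrow> complex" and l :: real
    assume \<Phi>: "Cr_on n0 (ball 0 1) \<Phi>" and \<psi>: "Cck (CARD('n) div 2 + 1) (ball 0 (1 - eps0)) \<psi>"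
      and inj: "inj_on (grad \<Phi>) (ball 0 1)" and L: "Lstar \<Phi> > 0" and l: "1 \<le> l"
    interpret stationary_phase_data \<Phi> \<psi> K b "Pnorm n0 \<Phi>" "Anorm (real K) \<psi>" eps0
      unfolding K_def b_def by (rule stationary_phase_data_of_norms[OF assms \<Phi> \<psi>])
    have "2 \<le> nat \<lfloor>n0\<rfloor>" using assms(2) by linarith
    then have C2: "Ck_on 2 (ball 0 1) \<Phi>" using \<Phi> unfolding Cr_on_def by (auto intro: Ck_on_mono)
    have "l powr (real CARD('n) / 2) * norm (osc_integral l \<Phi> \<psi>)
       \<le> phase_const TYPE('n) K b eps0 / Lstar \<Phi> * (1 + Pnorm n0 \<Phi> powr (real CARD('n) / 2)) * Anorm (real K) \<psi>"
    proof (rule stationary_phase_bound[OF _ inj _ L _ _ l])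
      show der: "(grad \<Phi> has_derivative (\<lambda>v. transpose (hessian \<Phi> x) *v v)) (at x)" if "x \<in> ball 0 1" for x
        by (rule grad_has_derivative[OF open_ball C2 that])
      then show "continuous_on (ball 0 1) (grad \<Phi>)"
        by (auto intro!: continuous_at_imp_continuous_on has_derivative_continuous)
      show "Lstar \<Phi> \<le> \<bar>det (transpose (hessian \<Phi> x))\<bar>" if "x \<in> ball 0 1" for x
        unfolding Lstar_def det_transpose by (rule cINF_lower[OF _ that]) (auto intro: bdd_belowI[of _ 0])
      show "\<bar>transpose (hessian \<Phi> x) $ i $ j\<bar> \<le> Pnorm n0 \<Phi>" if "x \<in> ball 0 1" for x i j
        using Cr_on_derivative_bounds(2)[OF \<Phi> assms(2), of "[j, i]" x] \<open>2 \<le> nat \<lfloor>n0\<rfloor>\<close> that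
        by (simp add: transpose_def hessian_def)
      have "real CARD('n) / 2 - 1 < real (CARD('n) div 2)" by linarith
      then show "real CARD('n) < decay"
        using assms(1) unfolding decay_def unfolding b_def K_def min_def by (auto simp: field_simps)
    qed
    then show "l powr (real CARD('n) / 2) * norm (osc_integral l \<Phi> \<psi>)
              \<le> phase_const TYPE('n) K b eps0 / Lstar \<Phi> * (1 + Pnorm n0 \<Phi> powr (real CARD('n) / 2))
                  * Anorm (real (CARD('n) div 2 + 1)) \<psi>"
      by (simp only: K_def)
  qed
qed

end
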